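(* Let $d\ge 1$, $\hbar>0$, and let $v\in C^1(\mathbb{R}^d)$ be a real-valued function, bounded from below, with $\min_{x\in\mathbb{R}^d} v(x)=0$. Let $a\in C^4(\mathbb{R}^d)$ be real-valued, and suppose that all its partial derivatives of orders $1,2,3,4$ are bounded on $\mathbb{R}^d$. Then every real eigenfunction $\psi_\hbar$ of the operator $H_\hbar=-\hbar^2\Delta+v(x)$ in $L_2(\mathbb{R}^d)$ satisfies the identity $$\int_{\mathbb{R}^d}\Bigl(4\hbar^2\sum_{j,k=1}^d a_{jk}\,\partial_k\psi_\hbar\,\partial_j\psi_\hbar-\hbar^2(\Delta^2 a)\,\psi_\hbar^2-2\langle\nabla a,\nabla v\rangle\,\psi_\hbar^2\Bigr)dx=0,$$ where $a_{jk}=\partial^2 a/\partial x_j\partial x_k$.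
   Context: $H_\hbar=-\hbar^2\Delta+v(x)$ is the self-adjoint Schrödinger operator in $L_2(\mathbb{R}^d)$. An eigenfunction $\psi_\hbar$ with eigenvalue $\lambda_\hbar$ is a nonzero function $\psi_\hbar\in L_2(\mathbb{R}^d)$ in the domain of $H_\hbar$ with $-\hbar^2\Delta\psi_\hbar+v\psi_\hbar=\lambda_\hbar\psi_\hbar$. $\langle\cdot,\cdot\rangle$ is the Euclidean scalar product in $\mathbb{R}^d$ and $\Delta^2$ is the bi-Laplacian.
   Formalization: For v only C^1 the term <grad a, grad v> psi^2 need not be Lebesgue integrable, so the integral may not exist; the identity is proved as the limit 0 of integrals with smooth cutoffs eta(x/R), for every cutoff with eta(0)=1, and hence for the Lebesgue integral whenever the integrand is integrable. *)

theory Defs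
  imports "HOL-Analysis.Analysis"
begin

definition has_partial :: "'n::finite \<Rightarrow> (real^'n \<Rightarrow> real) \<Rightarrow> real^'n \<Rightarrow> bool" where
  "has_partial j f x \<longleftrightarrow> (\<lambda>t. f (x + t *\<^sub>R axis j 1)) differentiable (at (0::real))"

definition partial :: "'n::finite \<Rightarrow> (real^'n \<Rightarrow> real) \<Rightarrow> real^'n \<Rightarrow> real" where
  "partial j f x = deriv (\<lambda>t. f (x + t *\<^sub>R axis j 1)) (0::real)"

primrec partials :: "'n::finite list \<Rightarrow> (real^'n \<Rightarrow> real) \<Rightarrow> real^'n \<Rightarrow> real" where
  "partials [] f = f"
| "partials (j # js) f = partial j (partials js f)"

definition C_k :: "nat \<Rightarrow> (real^'n::finite \<Rightarrow> real) \<Rightarrow> bool" where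
  "C_k m f \<longleftrightarrow>
     (\<forall>js. length js \<le> m \<longrightarrow> continuous_on UNIV (partials js f)) \<and>
     (\<forall>js. length js < m \<longrightarrow> (\<forall>j x. has_partial j (partials js f) x))"

definition laplacian :: "(real^'n::finite \<Rightarrow> real) \<Rightarrow> real^'n \<Rightarrow> real" where
  "laplacian f x = (\<Sum>j\<in>UNIV. partial j (partial j f) x)"

definition grad :: "(real^'n::finite \<Rightarrow> real) \<Rightarrow> real^'n \<Rightarrow> real^'n" where
  "grad f x = (\<chi> j. partial j f x)"

definition test_function :: "(real^'n::finite \<Rightarrow> real) \<Rightarrow> bool" where
  "test_function \<phi> \<longleftrightarrow> (\<forall>m. C_k m \<phi>) \<and> (\<exists>K. compact K \<and> (\<forall>x. x \<notin> K \<longrightarrow> \<phi> x = 0))"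

definition L2_function :: "(real^'n::finite \<Rightarrow> real) \<Rightarrow> bool" where
  "L2_function f \<longleftrightarrow> f \<in> borel_measurable lborel \<and> integrable lborel (\<lambda>x. (f x)\<^sup>2)"

definition locally_integrable :: "(real^'n::finite \<Rightarrow> real) \<Rightarrow> bool" where
  "locally_integrable f \<longleftrightarrow>
     f \<in> borel_measurable lborel \<and> (\<forall>K. compact K \<longrightarrow> set_integrable lborel K f)"

definition weak_partial :: "'n::finite \<Rightarrow> (real^'n \<Rightarrow> real) \<Rightarrow> (real^'n \<Rightarrow> real) \<Rightarrow> bool" where
  "weak_partial j f g \<longleftrightarrow> locally_integrable f \<and> locally_integrable g \<and>
     (\<forall>\<phi>. test_function \<phi> \<longrightarrow>
        (LINT x|lborel. f x * partial j \<phi> x) = - (LINT x|lborel. g x * \<phi> x))"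

text \<open>
  The graph of the self-adjoint operator \<open>H = -h\<^sup>2 \<Delta> + v\<close> in \<open>L\<^sub>2\<close>, for continuous \<open>v\<close> bounded
  from below: \<open>\<psi>\<close> is in the domain and \<open>H \<psi> = f\<close> iff \<open>\<psi>\<close> and the distribution
  \<open>-h\<^sup>2 \<Delta>\<psi> + v \<psi> = f\<close> are in \<open>L\<^sub>2\<close>. This is the adjoint of \<open>-h\<^sup>2 \<Delta> + v\<close> on the test functions,
  which is essentially self-adjoint (Kato), so it is its only self-adjoint extension.
  Since \<open>v\<close> is real, the real Hilbert space suffices for real eigenfunctions.
\<close>
definition schrodinger_graph ::
    "real \<Rightarrow> (real^'n::finite \<Rightarrow> real) \<Rightarrow> (real^'n \<Rightarrow> real) \<Rightarrow> (real^'n \<Rightarrow> real) \<Rightarrow> bool" where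
  "schrodinger_graph h v \<psi> f \<longleftrightarrow> L2_function \<psi> \<and> L2_function f \<and>
     (\<forall>\<phi>. test_function \<phi> \<longrightarrow>
        (LINT x|lborel. \<psi> x * (- h\<^sup>2 * laplacian \<phi> x + v x * \<phi> x)) = (LINT x|lborel. f x * \<phi> x))"

definition eigenfunction ::
    "real \<Rightarrow> (real^'n::finite \<Rightarrow> real) \<Rightarrow> real \<Rightarrow> (real^'n \<Rightarrow> real) \<Rightarrow> bool" where
  "eigenfunction h v \<mu> \<psi> \<longleftrightarrow>
     schrodinger_graph h v \<psi> (\<lambda>x. \<mu> * \<psi> x) \<and> \<not> (AE x in lborel. \<psi> x = 0)"

text \<open>
  Integral over the whole space as a limit of smoothly truncated Lebesgue integrals, independent
  of the truncation. It extends the Lebesgue integral (lemma below) to functions that are only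
  conditionally integrable, for which \<^term>\<open>integral\<^sup>L\<close> is \<open>0\<close> by convention.
\<close>
definition has_cutoff_integral :: "(real^'n::finite \<Rightarrow> real) \<Rightarrow> real \<Rightarrow> bool" where
  "has_cutoff_integral F I \<longleftrightarrow>
     (\<forall>\<eta>. test_function \<eta> \<and> \<eta> 0 = 1 \<longrightarrow>
        (\<forall>R>0. integrable lborel (\<lambda>x. \<eta> ((1 / R) *\<^sub>R x) * F x)) \<and>
        ((\<lambda>R. LINT x|lborel. \<eta> ((1 / R) *\<^sub>R x) * F x) \<longlongrightarrow> I) at_top)"

lemma test_function_continuous: "test_function \<phi> \<Longrightarrow> continuous_on UNIV \<phi>"
  unfolding test_function_def C_k_def by (metis le0 list.size(3) partials.simps(1))

lemma test_function_bounded: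
  assumes "test_function \<phi>"
  obtains B where "\<And>x. \<bar>\<phi> x\<bar> \<le> B"
proof -
  obtain K where K: "compact K" "\<And>x. x \<notin> K \<Longrightarrow> \<phi> x = 0"
    using assms unfolding test_function_def by auto
  have "compact (\<phi> ` K)"
    using K(1) test_function_continuous[OF assms] compact_continuous_image continuous_on_subset
    by blast
  then obtain B where B: "\<And>y. y \<in> \<phi> ` K \<Longrightarrow> norm y \<le> B"
    using compact_imp_bounded bounded_iff by metis
  have "\<bar>\<phi> x\<bar> \<le> max B 0" for x
    using B[of "\<phi> x"] K(2)[of x] by (cases "x \<in> K") auto
  then show ?thesis using that by blast
qed

lemma has_cutoff_integral_lebesgue:
  fixes F :: "real^'n::finite \<Rightarrow> real"
  assumes F: "integrable lborel F"
  shows "has_cutoff_integral F (integral\<^sup>L lborel F)"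
  unfolding has_cutoff_integral_def
proof (intro allI impI)
  fix \<eta> :: "real^'n \<Rightarrow> real"
  assume \<eta>: "test_function \<eta> \<and> \<eta> 0 = 1"
  then obtain B where B: "\<And>x. \<bar>\<eta> x\<bar> \<le> B" using test_function_bounded by blast
  have cont: "continuous_on UNIV \<eta>" using \<eta> test_function_continuous by blast
  then have [measurable]: "\<eta> \<in> borel_measurable borel" by (rule borel_measurable_continuous_onI)
  have [measurable]: "F \<in> borel_measurable borel" using F by auto
  have bound: "norm (\<eta> y * F x) \<le> B * norm (F x)" for x y
    using B[of y] by (simp add: abs_mult mult_right_mono)
  have dom: "integrable lborel (\<lambda>x. B * norm (F x))" using F by simp
  have 1: "integrable lborel (\<lambda>x. \<eta> ((1 / R) *\<^sub>R x) * F x)" for R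
    by (rule Bochner_Integration.integrable_bound[OF dom])
       (use bound in \<open>auto intro: order_trans[OF _ abs_ge_self]\<close>)
  have 2: "((\<lambda>R. \<eta> ((1 / R) *\<^sub>R x) * F x) \<longlongrightarrow> F x) at_top" for x
  proof -
    have "((\<lambda>R::real. (1 / R) *\<^sub>R x) \<longlongrightarrow> 0 *\<^sub>R x) at_top"
      by (intro tendsto_intros tendsto_divide_0[OF tendsto_const]
          filterlim_at_top_imp_at_infinity filterlim_ident)
    moreover have "isCont \<eta> 0" using cont by (simp add: continuous_on_eq_continuous_at)
    ultimately have "((\<lambda>R. \<eta> ((1 / R) *\<^sub>R x)) \<longlongrightarrow> \<eta> 0) at_top"
      using isCont_tendsto_compose by fastforce
    then have "((\<lambda>R. \<eta> ((1 / R) *\<^sub>R x) * F x) \<longlongrightarrow> \<eta> 0 * F x) at_top"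
      by (intro tendsto_intros)
    then show ?thesis using \<eta> by simp
  qed
  have "((\<lambda>R. LINT x|lborel. \<eta> ((1 / R) *\<^sub>R x) * F x) \<longlongrightarrow> integral\<^sup>L lborel F) at_top"
    by (rule integral_dominated_convergence_at_top[where w="\<lambda>x. B * norm (F x)"])
       (use dom 2 bound in auto)
  with 1 show "(\<forall>R>0. integrable lborel (\<lambda>x. \<eta> ((1 / R) *\<^sub>R x) * F x)) \<and>
      ((\<lambda>R. LINT x|lborel. \<eta> ((1 / R) *\<^sub>R x) * F x) \<longlongrightarrow> integral\<^sup>L lborel F) at_top"
    by blast
qed

text \<open>Here \<open>G\<close> is the (weak) gradient of \<open>\<psi>\<close>.\<close>
definition virial_integrand ::
    "real \<Rightarrow> (real^'n::finite \<Rightarrow> real) \<Rightarrow> (real^'n \<Rightarrow> real) \<Rightarrow> (real^'n \<Rightarrow> real) \<Rightarrow>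
     ('n \<Rightarrow> real^'n \<Rightarrow> real) \<Rightarrow> real^'n \<Rightarrow> real" where
  "virial_integrand h v a \<psi> G x =
     4 * h\<^sup>2 * (\<Sum>j\<in>UNIV. \<Sum>k\<in>UNIV. partial j (partial k a) x * G k x * G j x)
     - h\<^sup>2 * laplacian (laplacian a) x * (\<psi> x)\<^sup>2
     - 2 * (grad a x \<bullet> grad v x) * (\<psi> x)\<^sup>2"

end

theory Submission imports Defs "HOL-Computational_Algebra.Polynomial" begin

text \<open>
  For a smooth solution \<open>u\<close> of \<open>h\<^sup>2 \<Delta>u = (v - \<mu>) u\<close> and a compactly supported vector field \<open>b\<close>, multiplying
  the equation by \<open>2 b \<cdot> \<nabla>u + (div b) u\<close> and integrating by parts gives an identity between
  \<open>\<Sum> \<partial>\<^sub>j b\<^sub>k \<partial>\<^sub>j u \<partial>\<^sub>k u\<close>, \<open>\<nabla>(div b) \<cdot> u \<nabla>u\<close> and \<open>b \<cdot> \<nabla>v u\<^sup>2\<close>. It only involves first derivatives of \<open>u\<close>, so it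
  survives a limit in which \<open>u\<close>, \<open>\<nabla>u\<close> and \<open>\<Delta>u\<close> converge in \<open>L\<^sub>2\<close> on balls; the mollifications of \<open>\<psi>\<close> converge in this
  sense, because the energy identity bounds \<open>\<nabla>u\<close> by \<open>u\<close> and \<open>\<Delta>u\<close>, and so no \<open>H\<^sup>2\<close> regularity of
  \<open>\<psi>\<close> is needed. Since \<open>v \<ge> 0\<close>, the energy identity also shows that \<open>\<nabla>\<psi>\<close> is square integrable on the
  whole space. Now take \<open>b(x) = \<eta>(x / R) \<nabla>a(x)\<close>: the terms with a derivative of the cutoff are \<open>O(1 / R)\<close>.
\<close>

text \<open>The factor \<open>grad v\<close> shapes the proof: nothing bounds it, so the integrand
  need not be integrable, and the identity is obtained as a limit of truncations. There
  \<open>grad v\<close> appears only in the wanted term: with w = v - \<mu>, the equation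
  contributes w b . grad(\<psi>^2) + w (div b) \<psi>^2, whose integral is that of -(b . grad v)
  \<psi>^2, while each error term is a bounded derivative of a times a derivative of the cutoff
  times a product of two square integrable functions. The Lebesgue integral then vanishes too: it
  equals the cutoff limit if the integrand is integrable, and is 0 by convention otherwise.
  Mollified functions do not solve the equation, since mollification does not commute with v. The
  smooth identities therefore keep the Laplacian of u as it is, and the equation is used only for
  the limits. Only the Laplacians are shown to converge, not the single second derivatives, so the
  Hessian of u must cancel except for its trace. The summand (div b) u of the multiplier removes
  (div b) |grad u|^2; the gradient of div b that it brings in becomes the bi-Laplacian of a after
  one more integration by parts.\<close>

section \<open>Pointwise partial derivatives along the coordinate axes\<close>

text \<open>Existence and value in one relation: \<open>partial\<close> is total because
  \<open>deriv\<close> is, so equations about it would hide differentiability. In this form the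
  rules of calculus compose, and \<open>has_pd_partial\<close> returns to \<open>partial\<close> at
  the end.\<close>

definition has_pd :: "'n::finite \<Rightarrow> (real^'n \<Rightarrow> real) \<Rightarrow> (real^'n \<Rightarrow> real) \<Rightarrow> bool" where
  "has_pd j f f' \<longleftrightarrow> (\<forall>x. ((\<lambda>t. f (x + t *\<^sub>R axis j 1)) has_real_derivative f' x) (at 0))"

lemma has_pdD:
  "has_pd j f f' \<Longrightarrow> ((\<lambda>t. f (x + t *\<^sub>R axis j 1)) has_real_derivative f' x) (at 0)"
  by (simp add: has_pd_def)

lemma has_pd_partial: "has_pd j f f' \<Longrightarrow> partial j f = f'"
  by (auto simp: has_pd_def partial_def fun_eq_iff intro: DERIV_imp_deriv)

lemma has_pd_imp_has_partial: "has_pd j f f' \<Longrightarrow> has_partial j f x"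
  unfolding has_pd_def has_partial_def using real_differentiable_def by blast

lemma has_partial_imp_has_pd: "(\<And>x. has_partial j f x) \<Longrightarrow> has_pd j f (partial j f)"
  unfolding has_pd_def has_partial_def partial_def
  by (simp add: DERIV_deriv_iff_real_differentiable)

text \<open>The definition speaks only of the parameter 0; moving the base point along the axis
  gives the derivative at every t, as the mean value bound \<open>has_pd_diff_bound\<close>
  requires.\<close>

lemma has_pd_at:
  assumes "has_pd j f f'"
  shows "((\<lambda>t. f (x + t *\<^sub>R axis j 1)) has_real_derivative f' (x + t *\<^sub>R axis j 1)) (at t)"
proof -
  have "((\<lambda>s. f ((x + t *\<^sub>R axis j 1) + s *\<^sub>R axis j 1)) has_real_derivative
      f' (x + t *\<^sub>R axis j 1)) (at (t - t))"
    using has_pdD[OF assms] by simp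
  then have "((\<lambda>s. f ((x + t *\<^sub>R axis j 1) + (s - t) *\<^sub>R axis j 1)) has_real_derivative
      f' (x + t *\<^sub>R axis j 1) * 1) (at t)"
    by (intro DERIV_chain'[where f="\<lambda>s. s - t", unfolded o_def])
       (auto intro!: derivative_eq_intros)
  then show ?thesis by (simp add: algebra_simps)
qed

lemma has_pd_const: "has_pd j (\<lambda>x. c) (\<lambda>x. 0)"
  by (simp add: has_pd_def)

lemma has_pd_add: "has_pd j f f' \<Longrightarrow> has_pd j g g' \<Longrightarrow> has_pd j (\<lambda>x. f x + g x) (\<lambda>x. f' x + g' x)"
  unfolding has_pd_def by (auto intro!: DERIV_add)

lemma has_pd_diff: "has_pd j f f' \<Longrightarrow> has_pd j g g' \<Longrightarrow> has_pd j (\<lambda>x. f x - g x) (\<lambda>x. f' x - g' x)"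
  unfolding has_pd_def by (auto intro!: DERIV_diff)

lemma has_pd_mult:
  "has_pd j f f' \<Longrightarrow> has_pd j g g' \<Longrightarrow> has_pd j (\<lambda>x. f x * g x) (\<lambda>x. f' x * g x + f x * g' x)"
  unfolding has_pd_def by (auto intro!: derivative_eq_intros)

lemma has_pd_cmult: "has_pd j f f' \<Longrightarrow> has_pd j (\<lambda>x. c * f x) (\<lambda>x. c * f' x)"
  unfolding has_pd_def by (auto intro!: derivative_eq_intros)

lemma has_pd_sum:
  "(\<And>i. i \<in> I \<Longrightarrow> has_pd j (f i) (f' i)) \<Longrightarrow> has_pd j (\<lambda>x. \<Sum>i\<in>I. f i x) (\<lambda>x. \<Sum>i\<in>I. f' i x)"
  unfolding has_pd_def by (auto intro!: DERIV_sum)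

lemma has_pd_affine:
  assumes "has_pd j f f'"
  shows "has_pd j (\<lambda>y. f (x + c *\<^sub>R y)) (\<lambda>y. c * f' (x + c *\<^sub>R y))"
  unfolding has_pd_def
proof
  fix y
  have "((\<lambda>s. f ((x + c *\<^sub>R y) + s *\<^sub>R axis j 1)) has_real_derivative f' (x + c *\<^sub>R y)) (at (c * 0))"
    using has_pdD[OF assms] by simp
  then have "((\<lambda>t. f ((x + c *\<^sub>R y) + (c * t) *\<^sub>R axis j 1)) has_real_derivative
      f' (x + c *\<^sub>R y) * c) (at 0)"
    by (intro DERIV_chain'[where f="\<lambda>t. c * t"])
       (auto intro!: derivative_eq_intros)
  then show "((\<lambda>t. f (x + c *\<^sub>R (y + t *\<^sub>R axis j 1))) has_real_derivative
      c * f' (x + c *\<^sub>R y)) (at 0)"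
    by (simp add: algebra_simps)
qed

section \<open>Smoothness and supports of test functions\<close>

lemma C_k_continuous: "C_k m f \<Longrightarrow> length js \<le> m \<Longrightarrow> continuous_on UNIV (partials js f)"
  by (simp add: C_k_def)

lemma C_k_has_pd:
  "C_k m f \<Longrightarrow> length js < m \<Longrightarrow> has_pd j (partials js f) (partials (j # js) f)"
  by (simp add: C_k_def has_partial_imp_has_pd)

lemma test_function_has_pd: "test_function \<phi> \<Longrightarrow> has_pd j (partials js \<phi>) (partials (j # js) \<phi>)"
  unfolding test_function_def using C_k_has_pd[of "Suc (length js)"] by blast

lemma test_function_partials_continuous: "test_function \<phi> \<Longrightarrow> continuous_on UNIV (partials js \<phi>)"
  unfolding test_function_def using C_k_continuous by blast

lemma partials_closed:
  assumes "f \<in> S"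
    and pd: "\<And>g j. g \<in> S \<Longrightarrow> \<exists>g'\<in>S. has_pd j g g'"
  shows "partials js f \<in> S"
proof (induction js)
  case (Cons j js)
  then show ?case using pd has_pd_partial by force
qed (use assms in simp)

text \<open>Smoothness by coinduction: iterated derivatives never leave a family of continuous
  functions that is closed under partial differentiation, so all of them exist and are continuous
  without being computed. Affine images of test functions and the bump function are shown to be
  smooth in this way.\<close>

lemma C_k_coinduct:
  assumes "f \<in> S" and cont: "\<And>g. g \<in> S \<Longrightarrow> continuous_on UNIV g"
    and pd: "\<And>g j. g \<in> S \<Longrightarrow> \<exists>g'\<in>S. has_pd j g g'"
  shows "C_k m f"
  unfolding C_k_def
proof (intro conjI allI impI)
  show "continuous_on UNIV (partials js f)" for js
    by (rule cont[OF partials_closed[OF assms(1,3)]])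
  show "has_partial j (partials js f) x" for js j x
    using pd[OF partials_closed[OF assms(1,3), of js], of j] has_pd_imp_has_partial by blast
qed

text \<open>The complement of \<open>K\<close> is open, so f vanishes on a piece of the axis line
  around the point. Supports thus pass to derivatives without growing.\<close>

lemma support_has_pd:
  assumes pd: "has_pd j f f'" and K: "closed K" "\<And>x. x \<notin> K \<Longrightarrow> f x = 0" and x: "x \<notin> K"
  shows "f' x = 0"
proof -
  have "continuous_on UNIV (\<lambda>t::real. x + t *\<^sub>R axis j 1)" by (intro continuous_intros)
  then have "open ((\<lambda>t::real. x + t *\<^sub>R axis j 1) -` (- K))"
    using K(1) by (intro open_vimage) auto
  then have "open {t. x + t *\<^sub>R axis j 1 \<notin> K}" by (simp add: vimage_def)
  moreover have "0 \<in> {t. x + t *\<^sub>R axis j 1 \<notin> K}" using x by simp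
  ultimately have "\<forall>\<^sub>F t in nhds 0. x + t *\<^sub>R axis j 1 \<notin> K"
    using eventually_nhds by blast
  then have "\<forall>\<^sub>F t in nhds 0. f (x + t *\<^sub>R axis j 1) = 0" by eventually_elim (use K(2) in auto)
  then have "((\<lambda>t. f (x + t *\<^sub>R axis j 1)) has_real_derivative 0) (at 0)"
    by (subst DERIV_cong_ev[OF refl _ refl, where g="\<lambda>_. 0"]) auto
  then show ?thesis using has_pdD[OF pd] DERIV_unique by blast
qed

lemma test_function_support:
  assumes "test_function \<phi>"
  obtains r where "r > 0" "\<And>js x. norm x > r \<Longrightarrow> partials js \<phi> x = 0"
proof -
  obtain K where K: "compact K" "\<And>x. x \<notin> K \<Longrightarrow> \<phi> x = 0"
    using assms unfolding test_function_def by auto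
  obtain r where r: "r > 0" "K \<subseteq> cball 0 r"
    using compact_imp_bounded[OF K(1)] bounded_subset_ballD ball_subset_cball by (metis subset_trans)
  have "partials js \<phi> x = 0" if "x \<notin> cball 0 r" for js x
    using that
  proof (induction js arbitrary: x)
    case (Cons j js)
    show ?case
      by (rule support_has_pd[OF test_function_has_pd[OF assms] closed_cball Cons.IH Cons.prems])
  next
    case Nil
    then have "x \<notin> K" using r(2) by blast
    then show ?case using K(2) by simp
  qed
  then show ?thesis using that[OF r(1)] by (auto simp: not_le)
qed

lemma test_function_affine:
  fixes \<phi> :: "real^'n::finite \<Rightarrow> real"
  assumes t: "test_function \<phi>" and c: "c \<noteq> 0"
  shows partials_affine: "partials js (\<lambda>y. \<phi> (x + c *\<^sub>R y)) = (\<lambda>y. c ^ length js * partials js \<phi> (x + c *\<^sub>R y))"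
    and "test_function (\<lambda>y. b * \<phi> (x + c *\<^sub>R y))"
proof -
  have pd: "has_pd j (\<lambda>y. b * partials js \<phi> (x + c *\<^sub>R y)) (\<lambda>y. (b * c) * partials (j # js) \<phi> (x + c *\<^sub>R y))" for j b js
    using has_pd_cmult[OF has_pd_affine[OF test_function_has_pd[OF t, of j js], of x c], of b] by (simp add: mult.assoc)
  show "partials js (\<lambda>y. \<phi> (x + c *\<^sub>R y)) = (\<lambda>y. c ^ length js * partials js \<phi> (x + c *\<^sub>R y))"
  proof (induction js)
    case (Cons j js)
    show ?case unfolding partials.simps(2) Cons.IH
      using has_pd_partial[OF pd[of j "c ^ length js" js]] by (simp add: mult.commute)
  qed simp
  \<comment> \<open>Every differentiation produces a factor \<open>c\<close>, so arbitrary scalar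
    factors are included to close the family.\<close>
  define S where "S = {(\<lambda>y. b * partials js \<phi> (x + c *\<^sub>R y)) | b js. True}"
  have "C_k m (\<lambda>y. b * \<phi> (x + c *\<^sub>R y))" for m
  proof (rule C_k_coinduct[where S=S])
    show "(\<lambda>y. b * \<phi> (x + c *\<^sub>R y)) \<in> S"
      unfolding S_def by (rule CollectI, rule exI[of _ b], rule exI[of _ "[]"]) simp
    show "continuous_on UNIV g" if g_in: "g \<in> S" for g
    proof -
      obtain b js where g: "g = (\<lambda>y. b * partials js \<phi> (x + c *\<^sub>R y))" using g_in S_def by blast
      have "continuous_on UNIV (\<lambda>y. partials js \<phi> (x + c *\<^sub>R y))"
        by (rule continuous_on_compose2[OF test_function_partials_continuous[OF t]])
           (auto intro!: continuous_intros)
      then show ?thesis unfolding g by (intro continuous_on_mult_left)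
    qed
    show "\<exists>g'\<in>S. has_pd j g g'" if g_in: "g \<in> S" for g j
    proof -
      obtain b js where g: "g = (\<lambda>y. b * partials js \<phi> (x + c *\<^sub>R y))" using g_in S_def by blast
      have "(\<lambda>y. (b * c) * partials (j # js) \<phi> (x + c *\<^sub>R y)) \<in> S" unfolding S_def by blast
      then show ?thesis using pd unfolding g by blast
    qed
  qed
  moreover obtain K where K: "compact K" "\<And>x. x \<notin> K \<Longrightarrow> \<phi> x = 0"
    using t unfolding test_function_def by auto
  have "compact ((\<lambda>z. (1/c) *\<^sub>R (z - x)) ` K)"
    by (rule compact_continuous_image[OF _ K(1)]) (intro continuous_intros)
  moreover have "b * \<phi> (x + c *\<^sub>R y) = 0" if "y \<notin> (\<lambda>z. (1/c) *\<^sub>R (z - x)) ` K" for y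
  proof -
    have "y = (1/c) *\<^sub>R ((x + c *\<^sub>R y) - x)" using c by simp
    then have "x + c *\<^sub>R y \<notin> K" using that by blast
    then show ?thesis using K(2) by simp
  qed
  ultimately show "test_function (\<lambda>y. b * \<phi> (x + c *\<^sub>R y))"
    unfolding test_function_def by blast
qed

subsection \<open>A bump function\<close>

text \<open>For \<open>p\<close> = 1 this is the classical exp(-1/t), extended by 0. All its
  derivatives are polynomials in 1/t times exp(-1/t), and keeping the polynomial as a parameter
  makes the family closed under differentiation.\<close>

definition flat_exp :: "real poly \<Rightarrow> real \<Rightarrow> real" where
  "flat_exp p t = (if t > 0 then poly p (1 / t) * exp (- 1 / t) else 0)"

lemma tendsto_poly_exp_0: "((\<lambda>s. poly p s * exp (- s)) \<longlongrightarrow> (0::real)) at_top"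
proof -
  have "((\<lambda>s. \<Sum>i\<le>degree p. coeff p i * (s ^ i / exp s)) \<longlongrightarrow> (\<Sum>i\<le>degree p. coeff p i * 0)) at_top"
    by (intro tendsto_sum tendsto_mult tendsto_const tendsto_power_div_exp_0)
  then show ?thesis
    by (simp add: poly_altdef sum_distrib_right exp_minus divide_inverse mult.assoc)
qed

text \<open>In s = 1/t one has ds/dt = -s^2, so p(s) exp(-s) has the derivative s^2 (p(s) - p'(s))
  exp(-s); the polynomial \<open>[:0, 0, 1:]\<close> is s^2.\<close>

lemma DERIV_flat_exp:
  "(flat_exp p has_real_derivative flat_exp ([:0, 0, 1:] * (p - pderiv p)) t) (at t)"
proof (cases t "0::real" rule: linorder_cases)
  case less
  have "\<forall>\<^sub>F x in nhds t. x < 0"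
    using less eventually_nhds_in_open[of "{..<0}" t] by simp
  then have "\<forall>\<^sub>F x in nhds t. flat_exp p x = 0"
    by eventually_elim (auto simp: flat_exp_def)
  then have "(flat_exp p has_real_derivative 0) (at t)"
    by (subst DERIV_cong_ev[OF refl _ refl, where g="\<lambda>_. 0"]) auto
  then show ?thesis using less by (simp add: flat_exp_def)
next
  case greater
  have "\<forall>\<^sub>F x in nhds t. x > 0"
    using greater eventually_nhds_in_open[of "{0<..}" t] by simp
  then have "\<forall>\<^sub>F x in nhds t. flat_exp p x = poly p (1 / x) * exp (- 1 / x)"
    by eventually_elim (auto simp: flat_exp_def)
  moreover have "((\<lambda>x. poly p (1 / x) * exp (- 1 / x)) has_real_derivative
      flat_exp ([:0, 0, 1:] * (p - pderiv p)) t) (at t)"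
  proof -
    have "((\<lambda>x. poly p (1 / x)) has_real_derivative poly (pderiv p) (1 / t) * (- 1 / t\<^sup>2)) (at t)"
      by (rule DERIV_chain'[OF _ poly_DERIV])
         (use greater in \<open>auto intro!: derivative_eq_intros simp: power2_eq_square\<close>)
    moreover have "((\<lambda>x. exp (- 1 / x)) has_real_derivative exp (- 1 / t) * (1 / t\<^sup>2)) (at t)"
      using greater by (auto intro!: derivative_eq_intros simp: power2_eq_square)
    ultimately show ?thesis
      using greater by (auto intro!: derivative_eq_intros simp: flat_exp_def field_simps power2_eq_square)
  qed
  ultimately show ?thesis by (subst DERIV_cong_ev[OF refl _ refl])
next
  case equal
  have R: "((\<lambda>x. flat_exp p x / x) \<longlongrightarrow> 0) (at_right 0)"
  proof -
    \<comment> \<open>The difference quotient at 0 is s p(s) exp(-s) with s = 1/x, and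
      \<open>pCons 0 p\<close> is the polynomial s p(s).\<close>
    have "((\<lambda>x. poly (pCons 0 p) (inverse x) * exp (- inverse x)) \<longlongrightarrow> (0::real)) (at_right 0)"
      by (rule filterlim_compose[OF tendsto_poly_exp_0 filterlim_inverse_at_top_right])
    moreover have "\<forall>\<^sub>F x in at_right 0. poly (pCons 0 p) (inverse x) * exp (- inverse x) = flat_exp p x / (x::real)"
      by (auto simp: eventually_at_filter flat_exp_def field_simps)
    ultimately show ?thesis using filterlim_cong by force
  qed
  have L: "((\<lambda>x. flat_exp p x / x) \<longlongrightarrow> 0) (at_left 0)"
    by (rule tendsto_eventually) (auto simp: eventually_at_filter flat_exp_def)
  have "((\<lambda>x. flat_exp p x / x) \<longlongrightarrow> 0) (at 0)" using L R by (simp add: filterlim_split_at)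
  then show ?thesis using equal by (simp add: DERIV_def flat_exp_def)
qed

text \<open>A product of one-dimensional bumps, supported in the cube [-1, 1]^n. The factors for the
  two faces of each direction carry separate polynomials, since the product rule differentiates them
  one at a time.\<close>

definition bump_gen :: "('n::finite \<Rightarrow> real poly) \<Rightarrow> ('n \<Rightarrow> real poly) \<Rightarrow> real^'n \<Rightarrow> real" where
  "bump_gen p q x = (\<Prod>i\<in>UNIV. flat_exp (p i) (1 + x $ i) * flat_exp (q i) (1 - x $ i))"

definition flat_step :: "real poly \<Rightarrow> real poly" where
  "flat_step p = [:0, 0, 1:] * (p - pderiv p)"

lemma has_pd_bump_gen:
  "has_pd j (bump_gen p q)
    (\<lambda>x. bump_gen (p(j := flat_step (p j))) q x - bump_gen p (q(j := flat_step (q j))) x)"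
  unfolding has_pd_def
proof
  fix x :: "real^'a"
  define A where "A = (\<Prod>i\<in>UNIV-{j}. flat_exp (p i) (1 + x $ i) * flat_exp (q i) (1 - x $ i))"
  have eq: "bump_gen p' q' (x + t *\<^sub>R axis j 1) =
      (flat_exp (p' j) (1 + (x $ j + t)) * flat_exp (q' j) (1 - (x $ j + t))) * A"
    if "\<And>i. i \<noteq> j \<Longrightarrow> p' i = p i" "\<And>i. i \<noteq> j \<Longrightarrow> q' i = q i" for t p' q'
    unfolding bump_gen_def A_def
    by (subst prod.remove[of UNIV j]) (auto simp: axis_def that intro!: prod.cong)
  have "((\<lambda>t. flat_exp (p j) (1 + (x $ j + t))) has_real_derivative
      flat_exp (flat_step (p j)) (1 + (x $ j + 0)) * 1) (at 0)"
    by (rule DERIV_chain'[OF _ DERIV_flat_exp[folded flat_step_def]])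
       (auto intro!: derivative_eq_intros)
  moreover have "((\<lambda>t. flat_exp (q j) (1 - (x $ j + t))) has_real_derivative
      flat_exp (flat_step (q j)) (1 - (x $ j + 0)) * - 1) (at 0)"
    by (rule DERIV_chain'[OF _ DERIV_flat_exp[folded flat_step_def]])
       (auto intro!: derivative_eq_intros)
  moreover have "bump_gen (p(j := flat_step (p j))) q x = 
      (flat_exp (flat_step (p j)) (1 + x $ j) * flat_exp (q j) (1 - x $ j)) * A"
    using eq[of "p(j := flat_step (p j))" q 0] by simp
  moreover have "bump_gen p (q(j := flat_step (q j))) x = 
      (flat_exp (p j) (1 + x $ j) * flat_exp (flat_step (q j)) (1 - x $ j)) * A"
    using eq[of p "q(j := flat_step (q j))" 0] by simp
  ultimately show "((\<lambda>t. bump_gen p q (x + t *\<^sub>R axis j 1)) has_real_derivative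
      bump_gen (p(j := flat_step (p j))) q x - bump_gen p (q(j := flat_step (q j))) x) (at 0)"
    by (subst eq) (auto intro!: derivative_eq_intros simp: algebra_simps)
qed

text \<open>The inner derivative of 1 - x_j is -1, so a derivative of a generator is a difference of
  two generators. Closure under differences therefore already gives closure under
  differentiation.\<close>

inductive_set bump_span :: "(real^'n::finite \<Rightarrow> real) set" where
  gen: "bump_gen p q \<in> bump_span"
| diff: "f \<in> bump_span \<Longrightarrow> g \<in> bump_span \<Longrightarrow> (\<lambda>x. f x - g x) \<in> bump_span"

lemma continuous_on_flat_exp: "continuous_on UNIV (flat_exp p)"
  by (rule DERIV_continuous_on) (rule has_field_derivative_at_within[OF DERIV_flat_exp])

lemma bump_span_continuous: "f \<in> bump_span \<Longrightarrow> continuous_on UNIV f"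
proof (induction rule: bump_span.induct)
  case (gen p q)
  show ?case unfolding bump_gen_def[abs_def]
    by (intro continuous_intros continuous_on_compose2[OF continuous_on_flat_exp]) auto
qed (intro continuous_intros)

lemma bump_span_has_pd: "f \<in> bump_span \<Longrightarrow> \<exists>f'\<in>bump_span. has_pd j f f'"
proof (induction rule: bump_span.induct)
  case (gen p q)
  show ?case by (rule bexI, rule has_pd_bump_gen) (intro bump_span.intros)
next
  case (diff f g)
  then obtain f' g' where "f' \<in> bump_span" "has_pd j f f'" "g' \<in> bump_span" "has_pd j g g'" by blast
  then show ?case using has_pd_diff[of j f f' g g'] bump_span.diff[of f' g'] by blast
qed

definition bump :: "real^'n::finite \<Rightarrow> real" where
  "bump = bump_gen (\<lambda>_. 1) (\<lambda>_. 1)"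

lemma bump_nonneg: "0 \<le> bump x"
  by (auto simp: bump_def bump_gen_def flat_exp_def intro!: prod_nonneg)

lemma bump_pos: "norm x < 1 \<Longrightarrow> 0 < bump x"
proof -
  assume x: "norm x < 1"
  have "\<bar>x $ i\<bar> < 1" for i using component_le_norm_cart[of x i] x by linarith
  then have "0 < 1 + x $ i \<and> 0 < 1 - x $ i" for i using abs_less_iff[of "x $ i" 1] by auto
  then show ?thesis by (auto simp: bump_def bump_gen_def flat_exp_def intro!: prod_pos)
qed

text \<open>The radius is crude but explicit: on the cube the norm is at most the l^1 norm, hence at
  most the dimension.\<close>

lemma bump_eq_0: "norm x > CARD('n) \<Longrightarrow> bump x = 0" for x :: "real^'n::finite"
proof -
  assume x: "norm x > CARD('n)"
  have "\<exists>i. \<bar>x $ i\<bar> > 1"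
  proof (rule ccontr)
    assume "\<not> ?thesis"
    then have "(\<Sum>i\<in>UNIV. \<bar>x $ i\<bar>) \<le> (\<Sum>i\<in>(UNIV::'n set). 1)"
      by (intro sum_mono) (auto simp: not_less)
    then show False using x norm_le_l1_cart[of x] by simp
  qed
  then obtain i where "1 < \<bar>x $ i\<bar>" by blast
  then have "1 + x $ i \<le> 0 \<or> 1 - x $ i \<le> 0" by linarith
  then have "flat_exp 1 (1 + x $ i) * flat_exp 1 (1 - x $ i) = 0" by (auto simp: flat_exp_def)
  then show ?thesis unfolding bump_def bump_gen_def by (intro prod_zero) auto
qed

lemma test_function_bump: "test_function (bump :: real^'n::finite \<Rightarrow> real)"
proof -
  have "(bump :: real^'n \<Rightarrow> real) \<in> bump_span" unfolding bump_def by (rule bump_span.gen)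
  then have "C_k m (bump :: real^'n \<Rightarrow> real)" for m
    by (rule C_k_coinduct[OF _ bump_span_continuous bump_span_has_pd])
  then show ?thesis
    unfolding test_function_def using bump_eq_0[where 'n='n]
    by (auto intro!: exI[of _ "cball 0 (real CARD('n))"])
qed

text \<open>Differentiations in different directions update the polynomials at different indices,
  and such updates commute. The symmetry of the Hessians of all mollified functions goes back to
  this computation.\<close>

lemma bump_partial_commute:
  "partial j (partial k bump) = (partial k (partial j bump) :: real^'n::finite \<Rightarrow> real)"
proof -
  have 1: "partial j (bump_gen p q) =
    (\<lambda>x. bump_gen (p(j := flat_step (p j))) q x - bump_gen p (q(j := flat_step (q j))) x)" for j p and q :: "'n \<Rightarrow> _"
    by (rule has_pd_partial[OF has_pd_bump_gen])
  have 2: "partial j (\<lambda>x. bump_gen p q x - bump_gen p' q' x) =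
     (\<lambda>x. partial j (bump_gen p q) x - partial j (bump_gen p' q') x)" for j p q p' and q' :: "'n \<Rightarrow> _"
    unfolding 1 by (rule has_pd_partial[OF has_pd_diff[OF has_pd_bump_gen has_pd_bump_gen]])
  show ?thesis
    by (cases "j = k") (simp_all add: bump_def 1 2 fun_upd_twist algebra_simps)
qed

subsection \<open>Continuous functions with compact support\<close>

text \<open>The weights of the integral identities: they can be integrated against any locally
  integrable function, and their derivatives are supplied one at a time by \<open>has_pd\<close>, so
  that weights of finite smoothness, built from a and v, are covered.\<close>

definition cont_csupp :: "(real^'n::finite \<Rightarrow> real) \<Rightarrow> bool" where
  "cont_csupp f \<longleftrightarrow> continuous_on UNIV f \<and> (\<exists>r. \<forall>x. norm x > r \<longrightarrow> f x = 0)"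

lemma cont_csuppE:
  assumes "cont_csupp f"
  obtains r M where "r > 0" "M > 0" "\<And>x. norm x > r \<Longrightarrow> f x = 0" "\<And>x. \<bar>f x\<bar> \<le> M"
proof -
  obtain r where r: "\<And>x. norm x > r \<Longrightarrow> f x = 0" and c: "continuous_on UNIV f"
    using assms unfolding cont_csupp_def by blast
  have "compact (f ` cball 0 r)"
    by (rule compact_continuous_image[OF continuous_on_subset[OF c]]) auto
  then obtain B where B: "\<And>y. y \<in> f ` cball 0 r \<Longrightarrow> norm y \<le> B"
    using compact_imp_bounded bounded_iff by metis
  have "\<bar>f x\<bar> \<le> max B 1" for x
    using B[of "f x"] r[of x] by (cases "x \<in> cball 0 r") auto
  then show ?thesis using that[of "max r 1" "max B 1"] r by auto
qed

lemma cont_csupp_measurable: "cont_csupp f \<Longrightarrow> f \<in> borel_measurable borel"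
  unfolding cont_csupp_def by (blast intro: borel_measurable_continuous_onI)

lemma cont_csupp_mult_right:
  "cont_csupp f \<Longrightarrow> continuous_on UNIV g \<Longrightarrow> cont_csupp (\<lambda>x. f x * g x)"
  unfolding cont_csupp_def by (auto intro!: continuous_intros)

lemma cont_csupp_mult_left:
  "continuous_on UNIV g \<Longrightarrow> cont_csupp f \<Longrightarrow> cont_csupp (\<lambda>x. g x * f x)"
  unfolding cont_csupp_def by (auto intro!: continuous_intros)

lemma cont_csupp_0: "cont_csupp (\<lambda>x. 0)"
  unfolding cont_csupp_def by auto

lemma cont_csupp_add: "cont_csupp f \<Longrightarrow> cont_csupp g \<Longrightarrow> cont_csupp (\<lambda>x. f x + g x)"
proof -
  assume f: "cont_csupp f" and g: "cont_csupp g"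
  obtain r s where "\<And>x. norm x > r \<Longrightarrow> f x = 0" "\<And>x. norm x > s \<Longrightarrow> g x = 0"
    using f g unfolding cont_csupp_def by blast
  then have "\<forall>x. norm x > max r s \<longrightarrow> f x + g x = 0" by auto
  then show ?thesis using f g unfolding cont_csupp_def by (blast intro: continuous_on_add)
qed

lemma cont_csupp_sum: "(\<And>i. i \<in> I \<Longrightarrow> cont_csupp (f i)) \<Longrightarrow> cont_csupp (\<lambda>x. \<Sum>i\<in>I. f i x)"
  by (induction I rule: infinite_finite_induct) (auto intro: cont_csupp_add cont_csupp_0)

lemma cont_csupp_diff: "cont_csupp f \<Longrightarrow> cont_csupp g \<Longrightarrow> cont_csupp (\<lambda>x. f x - g x)"
  using cont_csupp_add[of f "\<lambda>x. (-1) * g x"] cont_csupp_mult_left[of "\<lambda>_. -1" g] by simp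

lemma cont_csupp_has_pd:
  assumes "cont_csupp f" "has_pd j f f'" "continuous_on UNIV f'"
  shows "cont_csupp f'"
proof -
  obtain r where r: "\<And>x. norm x > r \<Longrightarrow> f x = 0"
    using assms unfolding cont_csupp_def by blast
  have "f' x = 0" if "norm x > r" for x
    by (rule support_has_pd[OF assms(2) closed_cball[of 0 r]]) (use r that in auto)
  then show ?thesis using assms(3) unfolding cont_csupp_def by blast
qed

lemma cont_csupp_test: "test_function \<phi> \<Longrightarrow> cont_csupp (partials js \<phi>)"
  unfolding cont_csupp_def
  using test_function_support[of \<phi>] test_function_partials_continuous[of \<phi> js] by metis

section \<open>Local integrability\<close>

lemma locally_integrable_cball:
  "locally_integrable f \<Longrightarrow> integrable lborel (\<lambda>x. indicator (cball 0 r) x * f x)"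
  using compact_cball[of 0 r] unfolding locally_integrable_def set_integrable_def by fastforce

lemma locally_integrableI:
  assumes [measurable]: "f \<in> borel_measurable borel"
    and int: "\<And>r. integrable lborel (\<lambda>x. indicator (cball 0 r) x * f x)"
  shows "locally_integrable f"
  unfolding locally_integrable_def
proof (intro conjI allI impI)
  fix K :: "(real^'a) set" assume K: "compact K"
  then obtain r where r: "K \<subseteq> cball 0 r"
    using bounded_subset_ballD[OF compact_imp_bounded[OF K], of 0] ball_subset_cball by blast
  have [measurable]: "K \<in> sets borel" by (rule borel_closed[OF compact_imp_closed[OF K]])
  show "set_integrable lborel K f" unfolding set_integrable_def
    by (rule Bochner_Integration.integrable_bound[OF int[of r]])
       (use r in \<open>auto simp: indicator_def intro!: AE_I2\<close>)
qed simp

lemma locally_integrable_mult: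
  assumes f: "locally_integrable f" and \<phi>: "cont_csupp \<phi>"
  shows "integrable lborel (\<lambda>x. \<phi> x * f x)"
proof -
  obtain r M where r: "\<And>x. norm x > r \<Longrightarrow> \<phi> x = 0" "\<And>x. \<bar>\<phi> x\<bar> \<le> M"
    using cont_csuppE[OF \<phi>] by metis
  have [measurable]: "f \<in> borel_measurable borel" "\<phi> \<in> borel_measurable borel"
    using f cont_csupp_measurable[OF \<phi>] by (auto simp: locally_integrable_def)
  have "integrable lborel (\<lambda>x. M * (indicator (cball 0 r) x * f x))"
    using locally_integrable_cball[OF f] by simp
  then show ?thesis
  proof (rule Bochner_Integration.integrable_bound)
    show "AE x in lborel. norm (\<phi> x * f x) \<le> norm (M * (indicator (cball 0 r) x * f x))"
    proof (intro AE_I2)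
      fix x
      show "norm (\<phi> x * f x) \<le> norm (M * (indicator (cball 0 r) x * f x))"
      proof (cases "x \<in> cball 0 r")
        case True
        have "\<bar>\<phi> x\<bar> * \<bar>f x\<bar> \<le> \<bar>M\<bar> * \<bar>f x\<bar>"
          using r(2)[of x] by (intro mult_right_mono) auto
        then show ?thesis using True by (simp add: abs_mult)
      qed (use r(1) in auto)
    qed
  qed simp
qed

lemma locally_integrable_continuous:
  assumes "continuous_on UNIV f"
  shows "locally_integrable f"
proof (rule locally_integrableI)
  show [measurable]: "f \<in> borel_measurable borel" using assms by (rule borel_measurable_continuous_onI)
  have "integrable lborel (\<lambda>x. indicator (cball 0 r) x *\<^sub>R f x)" for r
    using borel_integrable_compact[OF compact_cball continuous_on_subset[OF assms]] 
    unfolding set_integrable_def by blast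
  then show "integrable lborel (\<lambda>x. indicator (cball 0 r) x * f x)" for r by simp
qed

lemma cont_csupp_integrable: "cont_csupp f \<Longrightarrow> integrable lborel f"
  using locally_integrable_mult[of "\<lambda>_. 1" f] locally_integrable_continuous[of "\<lambda>_. 1"] by simp

subsection \<open>Convolution\<close>

text \<open>For |c| = 1 the Jacobian factor is 1, which covers the translations and the reflection
  that convolutions use.\<close>

lemma lborel_distr_affine:
  "\<bar>c\<bar> = 1 \<Longrightarrow> distr lborel borel (\<lambda>x::real^'n::finite. t + c *\<^sub>R x) = lborel"
  using lborel_affine[of c t] by (auto simp: density_1)

lemma integral_affine:
  fixes t :: "real^'n::finite"
  assumes "\<bar>c\<bar> = 1" "f \<in> borel_measurable borel"
  shows "(LINT x|lborel. f (t + c *\<^sub>R x)) = (LINT x|lborel. (f x :: real))"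
  using integral_distr[of "\<lambda>x. t + c *\<^sub>R x" lborel borel f] assms lborel_distr_affine[of c t] by simp

lemma integrable_affine:
  fixes t :: "real^'n::finite"
  assumes "\<bar>c\<bar> = 1" "integrable lborel f"
  shows "integrable lborel (\<lambda>x. f (t + c *\<^sub>R x) :: real)"
  using integrable_distr_eq[of "\<lambda>x. t + c *\<^sub>R x" lborel borel f] assms lborel_distr_affine[of c t] by simp

lemma integral_translate: "f \<in> borel_measurable borel \<Longrightarrow> (LINT x|lborel. f (x - z)) = (LINT x|lborel. (f x :: real))"
  for z :: "real^'n::finite"
  using integral_affine[of 1 f "-z"] by simp

lemma integrable_translate: "integrable lborel f \<Longrightarrow> integrable lborel (\<lambda>x. f (x - z) :: real)"
  for z :: "real^'n::finite"
  using integrable_affine[of 1 f "-z"] by simp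

definition conv :: "(real^'n::finite \<Rightarrow> real) \<Rightarrow> (real^'n \<Rightarrow> real) \<Rightarrow> real^'n \<Rightarrow> real" where
  "conv \<phi> f x = (LINT y|lborel. \<phi> (x - y) * f y)"

lemma cont_csupp_affine:
  assumes "cont_csupp \<phi>" "c \<noteq> 0"
  shows "cont_csupp (\<lambda>y. \<phi> (x + c *\<^sub>R y))"
proof -
  obtain r where r: "\<And>x. norm x > r \<Longrightarrow> \<phi> x = 0" and cont: "continuous_on UNIV \<phi>"
    using assms unfolding cont_csupp_def by blast
  have "\<phi> (x + c *\<^sub>R y) = 0" if "norm y > (r + norm x) / \<bar>c\<bar>" for y
  proof (rule r)
    have "norm (c *\<^sub>R y) > r + norm x" using that assms(2) by (simp add: field_simps)
    then show "norm (x + c *\<^sub>R y) > r" using norm_diff_ineq[of "c *\<^sub>R y" x] by (simp add: add.commute)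
  qed
  moreover have "continuous_on UNIV (\<lambda>y. \<phi> (x + c *\<^sub>R y))"
    by (rule continuous_on_compose2[OF cont]) (auto intro!: continuous_intros)
  ultimately show ?thesis unfolding cont_csupp_def by blast
qed

lemma cont_csupp_reflect: "cont_csupp \<phi> \<Longrightarrow> cont_csupp (\<lambda>y. \<phi> (x - y))"
  using cont_csupp_affine[of \<phi> "-1" x] by simp

lemma conv_commute:
  assumes [measurable]: "f \<in> borel_measurable borel" "\<phi> \<in> borel_measurable borel"
  shows "conv \<phi> f x = (LINT z|lborel. \<phi> z * f (x - z))"
  unfolding conv_def using integral_affine[of "-1" "\<lambda>z. \<phi> z * f (x - z)" x] by simp

lemma conv_integrable: "cont_csupp \<phi> \<Longrightarrow> locally_integrable f \<Longrightarrow> integrable lborel (\<lambda>y. \<phi> (x - y) * f y)"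
  by (rule locally_integrable_mult[OF _ cont_csupp_reflect])

lemma continuous_on_conv:
  assumes \<phi>: "cont_csupp \<phi>" and f: "locally_integrable f"
  shows "continuous_on UNIV (conv \<phi> f)"
proof -
  obtain r M where r: "r > 0" "\<And>x. norm x > r \<Longrightarrow> \<phi> x = 0" "M > 0" "\<And>x. \<bar>\<phi> x\<bar> \<le> M"
    using cont_csuppE[OF \<phi>] by metis
  have cont: "continuous_on UNIV \<phi>" using \<phi> by (simp add: cont_csupp_def)
  have [measurable]: "f \<in> borel_measurable borel" "\<phi> \<in> borel_measurable borel"
    using f cont_csupp_measurable[OF \<phi>] by (auto simp: locally_integrable_def)
  show ?thesis
  proof (clarsimp simp: continuous_on_sequentially comp_def)
    fix X :: "nat \<Rightarrow> real^'a" and x assume X: "X \<longlonglongrightarrow> x"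
    obtain B where B: "\<And>n. norm (X n) \<le> B"
      using convergent_imp_Bseq[OF convergentI[OF X]] by (rule BseqE) blast
    show "(\<lambda>n. conv \<phi> f (X n)) \<longlonglongrightarrow> conv \<phi> f x"
      unfolding conv_def
    \<comment> \<open>The points \<open>X n\<close> stay in the ball of radius B and \<phi> vanishes
      beyond radius r, so all integrands live on one ball.\<close>
    proof (rule integral_dominated_convergence[where w="\<lambda>y. M * \<bar>indicator (cball 0 (B + r)) y * f y\<bar>"])
      show "integrable lborel (\<lambda>y. M * \<bar>indicator (cball 0 (B + r)) y * f y\<bar>)"
        using locally_integrable_cball[OF f] by (intro integrable_mult_right integrable_abs)
      show "AE y in lborel. (\<lambda>n. \<phi> (X n - y) * f y) \<longlonglongrightarrow> \<phi> (x - y) * f y"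
      proof (intro AE_I2 tendsto_mult tendsto_const)
        fix y
        have "(\<lambda>n. X n - y) \<longlonglongrightarrow> x - y" using X by (intro tendsto_intros)
        then show "(\<lambda>n. \<phi> (X n - y)) \<longlonglongrightarrow> \<phi> (x - y)"
          using cont continuous_on_tendsto_compose[of UNIV \<phi>] by simp
      qed
      show "AE y in lborel. norm (\<phi> (X n - y) * f y) \<le> M * \<bar>indicator (cball 0 (B + r)) y * f y\<bar>" for n
      proof (intro AE_I2)
        fix y
        show "norm (\<phi> (X n - y) * f y) \<le> M * \<bar>indicator (cball 0 (B + r)) y * f y\<bar>"
        proof (cases "norm y \<le> B + r")
          case True
          then show ?thesis using r(4) by (simp add: abs_mult mult_right_mono)
        next
          case False
          then have "norm (X n - y) > r"
            using B[of n] norm_triangle_ineq2[of y "X n"] by (simp add: norm_minus_commute)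
          then show ?thesis using r(2) r(3) by (auto intro!: mult_nonneg_nonneg)
        qed
      qed
    qed simp_all
  qed
qed

lemma has_pd_diff_bound:
  assumes "has_pd j f f'" "\<And>x. \<bar>f' x\<bar> \<le> M"
  shows "\<bar>f (x + t *\<^sub>R axis j 1) - f x\<bar> \<le> M * \<bar>t\<bar>"
proof -
  have "norm (f (x + t *\<^sub>R axis j 1) - f (x + 0 *\<^sub>R axis j 1)) \<le> M * norm (t - 0)"
    by (rule field_differentiable_bound[of UNIV _ "\<lambda>t. f' (x + t *\<^sub>R axis j 1)"])
       (use has_pd_at[OF assms(1)] assms(2) in auto)
  then show ?thesis by simp
qed

text \<open>All derivatives fall on \<phi>: its difference quotients are bounded by the supremum of
  |\<phi>'| and, for bounded increments, supported in one ball, so local integrability of f yields a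
  majorant.\<close>

lemma has_pd_conv:
  assumes \<phi>: "cont_csupp \<phi>" and pd: "has_pd j \<phi> \<phi>'" and \<phi>': "continuous_on UNIV \<phi>'"
    and f: "locally_integrable f"
  shows "has_pd j (conv \<phi> f) (conv \<phi>' f)"
  unfolding has_pd_def
proof
  fix x
  have c': "cont_csupp \<phi>'" by (rule cont_csupp_has_pd[OF \<phi> pd \<phi>'])
  obtain M where M: "M > 0" "\<And>x. \<bar>\<phi>' x\<bar> \<le> M" using cont_csuppE[OF c'] by metis
  obtain r where r: "r > 0" "\<And>x. norm x > r \<Longrightarrow> \<phi> x = 0" using cont_csuppE[OF \<phi>] by metis
  have [measurable]: "f \<in> borel_measurable borel" "\<phi> \<in> borel_measurable borel" "\<phi>' \<in> borel_measurable borel"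
    using f cont_csupp_measurable[OF \<phi>] cont_csupp_measurable[OF c'] by (auto simp: locally_integrable_def)
  have "((\<lambda>t. (conv \<phi> f (x + t *\<^sub>R axis j 1) - conv \<phi> f x) / t) \<longlongrightarrow> conv \<phi>' f x) (at 0)"
    unfolding tendsto_at_iff_sequentially comp_def
  proof (intro allI impI)
    fix X :: "nat \<Rightarrow> real" assume X: "\<forall>i. X i \<in> UNIV - {0}" "X \<longlonglongrightarrow> 0"
    obtain B where B: "\<And>n. norm (X n) \<le> B"
      using convergent_imp_Bseq[OF convergentI[OF X(2)]] by (rule BseqE) blast
    define q where "q n y = (\<phi> ((x - y) + X n *\<^sub>R axis j 1) - \<phi> (x - y)) / X n * f y" for n y
    have eq: "(conv \<phi> f (x + X n *\<^sub>R axis j 1) - conv \<phi> f x) / X n = integral\<^sup>L lborel (q n)" for n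
    proof -
      have "(conv \<phi> f (x + X n *\<^sub>R axis j 1) - conv \<phi> f x) / X n =
        (LINT y|lborel. (\<phi> (x + X n *\<^sub>R axis j 1 - y) * f y - \<phi> (x - y) * f y) / X n)"
        unfolding conv_def using conv_integrable[OF \<phi> f] by (simp)
      also have "\<dots> = integral\<^sup>L lborel (q n)"
        unfolding q_def by (intro Bochner_Integration.integral_cong) (auto simp: field_simps)
      finally show ?thesis .
    qed
    have "(\<lambda>n. integral\<^sup>L lborel (q n)) \<longlonglongrightarrow> conv \<phi>' f x"
      unfolding conv_def
    proof (rule integral_dominated_convergence[where w="\<lambda>y. M * \<bar>indicator (cball 0 (B + norm x + r)) y * f y\<bar>"])
      show "integrable lborel (\<lambda>y. M * \<bar>indicator (cball 0 (B + norm x + r)) y * f y\<bar>)"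
        using locally_integrable_cball[OF f] by (intro integrable_mult_right integrable_abs)
      show "AE y in lborel. (\<lambda>n. q n y) \<longlonglongrightarrow> \<phi>' (x - y) * f y"
      proof (intro AE_I2)
        fix y
        have "((\<lambda>t. (\<phi> ((x - y) + t *\<^sub>R axis j 1) - \<phi> (x - y)) / t) \<longlongrightarrow> \<phi>' (x - y)) (at 0)"
          using has_pdD[OF pd, of "x - y"] unfolding DERIV_def by simp
        then have "(\<lambda>n. (\<phi> ((x - y) + X n *\<^sub>R axis j 1) - \<phi> (x - y)) / X n) \<longlonglongrightarrow> \<phi>' (x - y)"
          using X unfolding tendsto_at_iff_sequentially comp_def by blast
        then show "(\<lambda>n. q n y) \<longlonglongrightarrow> \<phi>' (x - y) * f y"
          unfolding q_def by (intro tendsto_mult tendsto_const)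
      qed
      show "AE y in lborel. norm (q n y) \<le> M * \<bar>indicator (cball 0 (B + norm x + r)) y * f y\<bar>" for n
      proof (intro AE_I2)
        fix y
        have Xn: "\<bar>X n\<bar> > 0" using X by auto
        show "norm (q n y) \<le> M * \<bar>indicator (cball 0 (B + norm x + r)) y * f y\<bar>"
        proof (cases "norm y \<le> B + norm x + r")
          case True
          have "\<bar>\<phi> ((x - y) + X n *\<^sub>R axis j 1) - \<phi> (x - y)\<bar> / \<bar>X n\<bar> \<le> M"
            using has_pd_diff_bound[OF pd M(2), of "x - y" "X n"] Xn by (simp add: pos_divide_le_eq)
          then have "\<bar>\<phi> ((x - y) + X n *\<^sub>R axis j 1) - \<phi> (x - y)\<bar> / \<bar>X n\<bar> * \<bar>f y\<bar> \<le> M * \<bar>f y\<bar>"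
            by (rule mult_right_mono) simp
          then show ?thesis using True by (simp add: q_def abs_mult)
        next
          case False
          \<comment> \<open>Both terms of the difference quotient vanish here: x - y has norm larger
            than r + B, and the increment has norm at most B.\<close>
          have "norm y - norm x \<le> norm (x - y)"
            using norm_triangle_ineq2[of y x] by (simp add: norm_minus_commute)
          then have far: "norm (x - y) > r + B" using False by linarith
          have "0 \<le> B" using order_trans[OF norm_ge_zero B[of n]] .
          then have "norm (x - y) > r" using far by linarith
          moreover have "norm ((x - y) + X n *\<^sub>R axis j 1) > r"
          proof -
            have "norm (X n *\<^sub>R axis j (1::real)) \<le> B" using B[of n] by simp
            then show ?thesis
              using far norm_diff_ineq[of "x - y" "X n *\<^sub>R axis j 1"] by linarith
          qed
          ultimately show ?thesis using r(2) M(1) by (simp add: q_def)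
        qed
      qed
    qed (simp_all add: q_def[abs_def])
    then show "(\<lambda>n. (conv \<phi> f (x + X n *\<^sub>R axis j 1) - conv \<phi> f x) / X n) \<longlonglongrightarrow> conv \<phi>' f x"
      by (simp add: eq)
  qed
  then show "((\<lambda>t. conv \<phi> f (x + t *\<^sub>R axis j 1)) has_real_derivative conv \<phi>' f x) (at 0)"
    unfolding DERIV_def by simp
qed

text \<open>Differentiate the convolution of \<open>f\<close> with the constant \<open>1\<close>, which does not depend on the point.\<close>
lemma integral_has_pd_eq_0:
  assumes f: "cont_csupp f" and pd: "has_pd j f f'" and f': "continuous_on UNIV f'"
  shows "(LINT x|lborel. f' x) = 0"
proof -
  have m: "f \<in> borel_measurable borel" "f' \<in> borel_measurable borel"
    using f f' borel_measurable_continuous_onI unfolding cont_csupp_def by blast+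
  have 1: "conv g (\<lambda>_. 1) = (\<lambda>x. LINT y|lborel. g y)" if "g \<in> borel_measurable borel" for g
    using conv_commute[OF _ that, of "\<lambda>_. 1"] by auto
  have "has_pd j (conv f (\<lambda>_. 1)) (conv f' (\<lambda>_. 1))"
    by (rule has_pd_conv[OF f pd f' locally_integrable_continuous]) simp
  then have "has_pd j (\<lambda>x. LINT y|lborel. f y) (\<lambda>x. LINT y|lborel. f' y)"
    unfolding 1[OF m(1)] 1[OF m(2)] .
  then have "(\<lambda>x::real^'a. LINT y|lborel. f' y) = (\<lambda>x. 0)"
    using has_pd_partial has_pd_const by metis
  then show ?thesis by (rule fun_cong)
qed

lemma partials_conv:
  assumes "test_function \<phi>" "locally_integrable f"
  shows "partials js (conv \<phi> f) = conv (partials js \<phi>) f"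
    and "has_pd j (partials js (conv \<phi> f)) (partials (j # js) (conv \<phi> f))"
    and "continuous_on UNIV (partials js (conv \<phi> f))"
proof -
  have pd: "has_pd j (conv (partials js \<phi>) f) (conv (partials (j # js) \<phi>) f)" for j js
    by (rule has_pd_conv[OF cont_csupp_test[OF assms(1)] test_function_has_pd[OF assms(1)]
        test_function_partials_continuous[OF assms(1)] assms(2)])
  have *: "partials js (conv \<phi> f) = conv (partials js \<phi>) f" for js
  proof (induction js)
    case (Cons j js)
    then show ?case using has_pd_partial[OF pd[of j js]] by simp
  qed simp
  show "partials js (conv \<phi> f) = conv (partials js \<phi>) f" by (rule *)
  show "has_pd j (partials js (conv \<phi> f)) (partials (j # js) (conv \<phi> f))"
    unfolding * by (rule pd)
  show "continuous_on UNIV (partials js (conv \<phi> f))"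
    unfolding * by (rule continuous_on_conv[OF cont_csupp_test[OF assms(1)] assms(2)])
qed

subsection \<open>Continuity of translations\<close>

definition transl_cont :: "(real^'n::finite \<Rightarrow> real) \<Rightarrow> bool" where
  "transl_cont f \<longleftrightarrow> ((\<lambda>z. LINT x|lborel. \<bar>f (x - z) - f x\<bar>) \<longlongrightarrow> 0) (at 0)"

text \<open>Translation preserves the L^1 norm, so the translation error of f exceeds that of g by
  at most twice the L^1 distance of f and g. With e/4 for each of the three terms the total stays
  below e.\<close>

lemma transl_cont_approx:
  fixes f :: "real^'n::finite \<Rightarrow> real"
  assumes f: "integrable lborel f"
    and approx: "\<And>e. e > 0 \<Longrightarrow> \<exists>g. integrable lborel g \<and> transl_cont g \<and> (LINT x|lborel. \<bar>f x - g x\<bar>) < e"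
  shows "transl_cont f"
  unfolding transl_cont_def
proof (rule tendstoI)
  fix e :: real assume "e > 0"
  then obtain g where g: "integrable lborel g" "transl_cont g" "(LINT x|lborel. \<bar>f x - g x\<bar>) < e / 4"
    using approx[of "e / 4"] by auto
  have [measurable]: "f \<in> borel_measurable borel" "g \<in> borel_measurable borel" using f g by auto
  have "\<forall>\<^sub>F z in at 0. dist (LINT x|lborel. \<bar>g (x - z) - g x\<bar>) 0 < e / 4"
    using g(2) \<open>e > 0\<close> unfolding transl_cont_def by (intro tendstoD) auto
  then show "\<forall>\<^sub>F z in at 0. dist (LINT x|lborel. \<bar>f (x - z) - f x\<bar>) 0 < e"
  proof eventually_elim
    case (elim z)
    have i: "integrable lborel (\<lambda>x. \<bar>f (x - z) - g (x - z)\<bar>)" "integrable lborel (\<lambda>x. \<bar>f x - g x\<bar>)"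
      "integrable lborel (\<lambda>x. \<bar>g (x - z) - g x\<bar>)" "integrable lborel (\<lambda>x. \<bar>f (x - z) - f x\<bar>)"
      using f g(1) integrable_translate[OF f] integrable_translate[OF g(1)] by auto
    have "(LINT x|lborel. \<bar>f (x - z) - f x\<bar>) \<le>
      (LINT x|lborel. \<bar>f (x - z) - g (x - z)\<bar> + \<bar>g (x - z) - g x\<bar> + \<bar>f x - g x\<bar>)"
      using i by (intro integral_mono) auto
    also have "\<dots> = (LINT x|lborel. \<bar>f (x - z) - g (x - z)\<bar>) + (LINT x|lborel. \<bar>g (x - z) - g x\<bar>) + (LINT x|lborel. \<bar>f x - g x\<bar>)"
      using i by simp
    also have "(LINT x|lborel. \<bar>f (x - z) - g (x - z)\<bar>) = (LINT x|lborel. \<bar>f x - g x\<bar>)"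
      using integral_translate[of "\<lambda>x. \<bar>f x - g x\<bar>" z] by simp
    finally have "(LINT x|lborel. \<bar>f (x - z) - f x\<bar>) < e"
      using elim g(3) \<open>e > 0\<close> by (simp add: field_simps)
    moreover have "(LINT x|lborel. \<bar>f (x - z) - f x\<bar>) \<ge> 0" by simp
    ultimately show ?case by simp
  qed
qed

text \<open>For open \<open>U\<close>, \<open>1\<^sub>U(x - z) \<rightarrow> 1\<close> on \<open>U\<close>, and the mass of \<open>1\<^sub>U(\<cdot> - z)\<close> is conserved.\<close>
lemma transl_cont_open:
  fixes U :: "(real^'n::finite) set"
  assumes U: "open U" "emeasure lborel U < \<infinity>"
  shows "transl_cont (indicator U)"
  unfolding transl_cont_def tendsto_at_iff_sequentially comp_def
proof (intro allI impI)
  fix Z :: "nat \<Rightarrow> real^'n" assume Z: "Z \<longlonglongrightarrow> 0"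
  have [measurable]: "U \<in> sets borel" using U by simp
  let ?I = "indicator U :: real^'n \<Rightarrow> real"
  have iU: "integrable lborel ?I" using U by (simp add: integrable_indicator_iff)
  have iUz: "integrable lborel (\<lambda>x. ?I (x - z))" for z by (rule integrable_translate[OF iU])
  have iUU: "integrable lborel (\<lambda>x. ?I x * ?I (x - z))" for z
    by (rule Bochner_Integration.integrable_bound[OF iU]) (auto simp: indicator_def)
  have eq: "(LINT x|lborel. \<bar>?I (x - z) - ?I x\<bar>) = 2 * (LINT x|lborel. ?I x) - 2 * (LINT x|lborel. ?I x * ?I (x - z))" for z
  proof -
    have "(LINT x|lborel. \<bar>?I (x - z) - ?I x\<bar>) = (LINT x|lborel. ?I (x - z) + ?I x - 2 * (?I x * ?I (x - z)))"
      by (intro Bochner_Integration.integral_cong) (auto simp: indicator_def)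
    also have "\<dots> = (LINT x|lborel. ?I (x - z)) + (LINT x|lborel. ?I x) - 2 * (LINT x|lborel. ?I x * ?I (x - z))"
      by (simp only: Bochner_Integration.integral_diff[OF Bochner_Integration.integrable_add[OF iUz iU]
          integrable_mult_right[OF iUU]] Bochner_Integration.integral_add[OF iUz iU] integral_mult_right_zero)
    also have "(LINT x|lborel. ?I (x - z)) = (LINT x|lborel. ?I x)" by (rule integral_translate) simp
    finally show ?thesis by simp
  qed
  have "(\<lambda>n. LINT x|lborel. ?I x * ?I (x - Z n)) \<longlonglongrightarrow> (LINT x|lborel. ?I x)"
  proof (rule integral_dominated_convergence[where w="?I"])
    show "AE x in lborel. (\<lambda>n. ?I x * ?I (x - Z n)) \<longlonglongrightarrow> ?I x"
    proof (intro AE_I2)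
      fix x
      show "(\<lambda>n. ?I x * ?I (x - Z n)) \<longlonglongrightarrow> ?I x"
      proof (cases "x \<in> U")
        case True
        have "(\<lambda>n. x - Z n) \<longlonglongrightarrow> x - 0" using Z by (intro tendsto_intros)
        then have "\<forall>\<^sub>F n in sequentially. x - Z n \<in> U"
          using True U(1) by (intro topological_tendstoD) auto
        then have "\<forall>\<^sub>F n in sequentially. ?I x * ?I (x - Z n) = ?I x"
          by eventually_elim (use True in auto)
        then show ?thesis by (rule tendsto_eventually)
      qed simp
    qed
  qed (use iU in \<open>auto simp: indicator_def\<close>)
  then have "(\<lambda>n. 2 * (LINT x|lborel. ?I x) - 2 * (LINT x|lborel. ?I x * ?I (x - Z n))) \<longlonglongrightarrow>
      2 * (LINT x|lborel. ?I x) - 2 * (LINT x|lborel. ?I x)"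
    by (intro tendsto_intros)
  then show "(\<lambda>n. LINT x|lborel. \<bar>?I (x - Z n) - ?I x\<bar>) \<longlonglongrightarrow> 0"
    unfolding eq by simp
qed

lemma transl_cont_add:
  assumes f: "integrable lborel f" "transl_cont f" and g: "integrable lborel g" "transl_cont g"
  shows "transl_cont (\<lambda>x. f x + g x)"
  unfolding transl_cont_def
proof (rule Lim_null_comparison)
  show "((\<lambda>z. (LINT x|lborel. \<bar>f (x - z) - f x\<bar>) + (LINT x|lborel. \<bar>g (x - z) - g x\<bar>)) \<longlongrightarrow> 0) (at 0)"
    using tendsto_add[OF f(2)[unfolded transl_cont_def] g(2)[unfolded transl_cont_def]] by simp
  show "\<forall>\<^sub>F z in at 0. norm (LINT x|lborel. \<bar>f (x - z) + g (x - z) - (f x + g x)\<bar>)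
     \<le> (LINT x|lborel. \<bar>f (x - z) - f x\<bar>) + (LINT x|lborel. \<bar>g (x - z) - g x\<bar>)"
  proof (rule always_eventually, rule allI)
    fix z
    have i: "integrable lborel (\<lambda>x. \<bar>f (x - z) - f x\<bar>)" "integrable lborel (\<lambda>x. \<bar>g (x - z) - g x\<bar>)"
      "integrable lborel (\<lambda>x. \<bar>f (x - z) + g (x - z) - (f x + g x)\<bar>)"
      using f g(1) integrable_translate[OF f(1)] integrable_translate[OF g(1)] by auto
    have "(LINT x|lborel. \<bar>f (x - z) + g (x - z) - (f x + g x)\<bar>) \<le>
      (LINT x|lborel. \<bar>f (x - z) - f x\<bar> + \<bar>g (x - z) - g x\<bar>)"
      using i by (intro integral_mono) auto
    then show "norm (LINT x|lborel. \<bar>f (x - z) + g (x - z) - (f x + g x)\<bar>)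
     \<le> (LINT x|lborel. \<bar>f (x - z) - f x\<bar>) + (LINT x|lborel. \<bar>g (x - z) - g x\<bar>)"
      using i by simp
  qed
qed

lemma transl_cont_cmult: "transl_cont f \<Longrightarrow> transl_cont (\<lambda>x. c * f x)"
proof -
  assume "transl_cont f"
  then have "((\<lambda>z. \<bar>c\<bar> * (LINT x|lborel. \<bar>f (x - z) - f x\<bar>)) \<longlongrightarrow> \<bar>c\<bar> * 0) (at 0)"
    unfolding transl_cont_def by (intro tendsto_intros)
  moreover have "\<bar>c\<bar> * (LINT x|lborel. \<bar>f (x - z) - f x\<bar>) = (LINT x|lborel. \<bar>c * f (x - z) - c * f x\<bar>)" for z
    by (subst integral_mult_right_zero[symmetric])
       (auto simp: abs_mult[symmetric] right_diff_distrib intro!: Bochner_Integration.integral_cong)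
  ultimately show ?thesis unfolding transl_cont_def by simp
qed

text \<open>Continuity of translations is stable under sums, multiples and L^1 limits, so indicators
  suffice; by outer regularity these are L^1 limits of indicators of open sets, the case settled
  directly.\<close>

lemma transl_cont_integrable:
  fixes f :: "real^'n::finite \<Rightarrow> real"
  assumes "integrable lborel f"
  shows "transl_cont f"
  using assms
proof (induction rule: integrable_induct)
  case (base A c)
  then have [measurable]: "A \<in> sets borel" by simp
  have "transl_cont (indicator A :: real^'n \<Rightarrow> real)"
  proof (rule transl_cont_approx)
    show iA: "integrable lborel (indicator A :: real^'n \<Rightarrow> real)" using base by (simp add: integrable_indicator_iff)
    fix e :: real assume e: "e > 0"
    obtain U where U: "open U" "A \<subseteq> U" "emeasure lborel (U - A) < ennreal e"
      using outer_regular_lborel[of A e] base e by auto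
    have [measurable]: "U \<in> sets borel" using U by simp
    have "emeasure lborel U \<le> emeasure lborel A + emeasure lborel (U - A)"
      using emeasure_subadditive[of A lborel "U - A"] U(2) by (simp add: Un_absorb1)
    also have "\<dots> < \<infinity>" using base order_less_trans[OF U(3) ennreal_less_top] by simp
    finally have fU: "emeasure lborel U < \<infinity>" .
    have "(LINT x|lborel. \<bar>indicator A x - indicator U x\<bar>) = (LINT x|lborel. indicator (U - A) x :: real)"
      by (intro Bochner_Integration.integral_cong) (use U(2) in \<open>auto simp: indicator_def\<close>)
    also have "\<dots> < e" 
      using U(3) e emeasure_eq_ennreal_measure[of lborel "U - A"] order_less_trans[OF U(3) ennreal_less_top]
      by (simp add: ennreal_less_iff less_top[symmetric])
    finally show "\<exists>g. integrable lborel g \<and> transl_cont g \<and> (LINT x|lborel. \<bar>indicator A x - g x\<bar>) < e"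
      using transl_cont_open[OF U(1) fU] fU by (intro exI[of _ "indicator U"]) (auto simp: integrable_indicator_iff)
  qed
  then show ?case using transl_cont_cmult[of "indicator A" c] by (simp add: mult.commute)
next
  case (add f g)
  then show ?case by (intro transl_cont_add)
next
  case (lim f s)
  have [measurable]: "f \<in> borel_measurable borel" "s i \<in> borel_measurable borel" for i
    using lim(1)[of i] lim(4) by auto
  show ?case
  proof (rule transl_cont_approx[OF lim(4)])
    fix e :: real assume e: "e > 0"
    \<comment> \<open>The induction rule supplies |s_i| \<le> 2 |f|, hence the majorant 3
      |f|.\<close>
    have "(\<lambda>i. LINT x|lborel. \<bar>f x - s i x\<bar>) \<longlonglongrightarrow> (LINT x|lborel. \<bar>f x - f x\<bar>)"
    proof (rule integral_dominated_convergence[where w="\<lambda>x. 3 * \<bar>f x\<bar>"])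
      show "AE x in lborel. (\<lambda>i. \<bar>f x - s i x\<bar>) \<longlonglongrightarrow> \<bar>f x - f x\<bar>"
        using lim(2) by (intro AE_I2 tendsto_intros) auto
      show "AE x in lborel. norm \<bar>f x - s i x\<bar> \<le> 3 * \<bar>f x\<bar>" for i
      proof (rule AE_I2)
        fix x
        show "norm \<bar>f x - s i x\<bar> \<le> 3 * \<bar>f x\<bar>" using lim(3)[of x i] by simp
      qed
    qed (use lim(4) in auto)
    then have "\<forall>\<^sub>F i in sequentially. (LINT x|lborel. \<bar>f x - s i x\<bar>) < e"
      using e by (intro order_tendstoD(2)[of _ 0]) auto
    then obtain i where "(LINT x|lborel. \<bar>f x - s i x\<bar>) < e"
      using eventually_happens by fastforce
    then show "\<exists>g. integrable lborel g \<and> transl_cont g \<and> (LINT x|lborel. \<bar>f x - g x\<bar>) < e"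
      using lim(1) lim(5) by blast
  qed
qed

section \<open>Translations in L^2\<close>

lemma square_add3_le: "((a::real) + b + c)\<^sup>2 \<le> 3 * (a\<^sup>2 + b\<^sup>2 + c\<^sup>2)"
proof -
  have "0 \<le> (a - b)\<^sup>2 + (b - c)\<^sup>2 + (a - c)\<^sup>2" by simp
  then show ?thesis by (simp add: power2_eq_square algebra_simps)
qed

lemma square_diff_le: "((a::real) - b)\<^sup>2 \<le> 2 * a\<^sup>2 + 2 * b\<^sup>2"
proof -
  have "0 \<le> (a + b)\<^sup>2" by simp
  then show ?thesis by (simp add: power2_eq_square algebra_simps)
qed

lemma integrable_square_diff:
  fixes f g :: "'a \<Rightarrow> real"
  assumes [measurable]: "f \<in> borel_measurable M" "g \<in> borel_measurable M"
    and i: "integrable M (\<lambda>x. (f x)\<^sup>2)" "integrable M (\<lambda>x. (g x)\<^sup>2)"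
  shows "integrable M (\<lambda>x. (f x - g x)\<^sup>2)"
proof (rule Bochner_Integration.integrable_bound)
  show "integrable M (\<lambda>x. 2 * (f x)\<^sup>2 + 2 * (g x)\<^sup>2)" using i by auto
  show "AE x in M. norm ((f x - g x)\<^sup>2) \<le> norm (2 * (f x)\<^sup>2 + 2 * (g x)\<^sup>2)"
    using square_diff_le by (intro AE_I2) auto
qed simp

text \<open>Truncation at height M reduces the claim to L^1: the part cut off is small in L^2, and
  for |g| \<le> M the square of g(x - z) - g(x) is at most 2M |g(x - z) - g(x)|.\<close>

lemma transl_L2:
  fixes f :: "real^'n::finite \<Rightarrow> real"
  assumes f: "integrable lborel f" and f2: "integrable lborel (\<lambda>x. (f x)\<^sup>2)"
  shows "((\<lambda>z. LINT x|lborel. (f (x - z) - f x)\<^sup>2) \<longlongrightarrow> 0) (at 0)"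
proof (rule tendstoI)
  fix e :: real assume e: "e > 0"
  have fm[measurable]: "f \<in> borel_measurable borel" using f by auto
  define T where "T M x = max (- real M) (min (real M) (f x))" for M x
  have Tm[measurable]: "T M \<in> borel_measurable borel" for M unfolding T_def[abs_def] by measurable
  have Tle: "\<bar>T M x\<bar> \<le> \<bar>f x\<bar>" "\<bar>T M x\<bar> \<le> real M" "\<bar>f x - T M x\<bar> \<le> \<bar>f x\<bar>" for M x
    unfolding T_def by auto
  have "(\<lambda>M. LINT x|lborel. (f x - T M x)\<^sup>2) \<longlonglongrightarrow> integral\<^sup>L (lborel :: (real^'n) measure) (\<lambda>_. 0::real)"
  proof (rule integral_dominated_convergence[where w="\<lambda>x. (f x)\<^sup>2" and f="\<lambda>_. 0"])
    show "AE x in lborel. (\<lambda>M. (f x - T M x)\<^sup>2) \<longlonglongrightarrow> 0"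
    proof (intro AE_I2 tendsto_eventually)
      fix x
      show "\<forall>\<^sub>F M in sequentially. (f x - T M x)\<^sup>2 = 0"
        using eventually_ge_at_top[of "nat \<lceil>\<bar>f x\<bar>\<rceil>"]
      proof eventually_elim
        case (elim M)
        then have "\<bar>f x\<bar> \<le> real M" by linarith
        then have "T M x = f x" unfolding T_def by linarith
        then show ?case by simp
      qed
    qed
    show "AE x in lborel. norm ((f x - T M x)\<^sup>2) \<le> (f x)\<^sup>2" for M
    proof (intro AE_I2)
      fix x
      show "norm ((f x - T M x)\<^sup>2) \<le> (f x)\<^sup>2"
        using Tle(3)[of x M] by (simp add: abs_le_square_iff)
    qed
  qed (use f2 in auto)
  \<comment> \<open>The bounds add up to 3 (e/12 + e/6 + e/12) = e, where the factor 3 comes from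
    \<open>square_add3_le\<close>.\<close>
  then have "\<forall>\<^sub>F M in sequentially. (LINT x|lborel. (f x - T M x)\<^sup>2) < e / 12"
    using e by (intro order_tendstoD(2)[of _ 0]) auto
  then obtain M where M: "(LINT x|lborel. (f x - T M x)\<^sup>2) < e / 12"
    using eventually_happens by fastforce
  define g where "g = T M"
  have gm[measurable]: "g \<in> borel_measurable borel" unfolding g_def by (rule Tm)
  have g: "integrable lborel g"
    by (rule Bochner_Integration.integrable_bound[OF f]) (use Tle in \<open>auto simp: g_def\<close>)
  have g2: "integrable lborel (\<lambda>x. (g x)\<^sup>2)"
    by (rule Bochner_Integration.integrable_bound[OF f2]) (use Tle in \<open>auto simp: g_def abs_le_square_iff[symmetric]\<close>)
  have "((\<lambda>z. 2 * real M * (LINT x|lborel. \<bar>g (x - z) - g x\<bar>)) \<longlongrightarrow> 2 * real M * 0) (at 0)"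
    using transl_cont_integrable[OF g] unfolding transl_cont_def by (intro tendsto_intros)
  then have "\<forall>\<^sub>F z in at 0. 2 * real M * (LINT x|lborel. \<bar>g (x - z) - g x\<bar>) < e / 6"
    using e by (intro order_tendstoD(2)[of _ 0]) auto
  then show "\<forall>\<^sub>F z in at 0. dist (LINT x|lborel. (f (x - z) - f x)\<^sup>2) 0 < e"
  proof eventually_elim
    case (elim z)
    note [measurable] = fm gm
    have tr: "integrable lborel (\<lambda>x. (f (x - z))\<^sup>2)" "integrable lborel (\<lambda>x. (g (x - z))\<^sup>2)" "integrable lborel (\<lambda>x. g (x - z))"
      using integrable_translate[OF f2] integrable_translate[OF g2] integrable_translate[OF g] by auto
    have i: "integrable lborel (\<lambda>x. (f (x - z) - g (x - z))\<^sup>2)" "integrable lborel (\<lambda>x. (f x - g x)\<^sup>2)"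
      "integrable lborel (\<lambda>x. (g (x - z) - g x)\<^sup>2)" "integrable lborel (\<lambda>x. (f (x - z) - f x)\<^sup>2)"
      by (intro integrable_square_diff tr f2 g2; simp)+
    have gabs: "integrable lborel (\<lambda>x. \<bar>g (x - z) - g x\<bar>)" using tr(3) g by auto
    have "(LINT x|lborel. (f (x - z) - f x)\<^sup>2) \<le>
      (LINT x|lborel. 3 * ((f (x - z) - g (x - z))\<^sup>2 + (g (x - z) - g x)\<^sup>2 + (f x - g x)\<^sup>2))"
    proof (rule integral_mono)
      fix x
      show "(f (x - z) - f x)\<^sup>2 \<le> 3 * ((f (x - z) - g (x - z))\<^sup>2 + (g (x - z) - g x)\<^sup>2 + (f x - g x)\<^sup>2)"
        using square_add3_le[of "f (x - z) - g (x - z)" "g (x - z) - g x" "g x - f x"]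
        by (simp add: power2_commute[of "g x" "f x"])
    qed (use i in auto)
    also have "\<dots> = 3 * ((LINT x|lborel. (f (x - z) - g (x - z))\<^sup>2) + (LINT x|lborel. (g (x - z) - g x)\<^sup>2) + (LINT x|lborel. (f x - g x)\<^sup>2))"
      using i by simp
    also have "(LINT x|lborel. (f (x - z) - g (x - z))\<^sup>2) = (LINT x|lborel. (f x - g x)\<^sup>2)"
      using integral_translate[of "\<lambda>x. (f x - g x)\<^sup>2" z] by simp
    also have "(LINT x|lborel. (g (x - z) - g x)\<^sup>2) \<le> (LINT x|lborel. 2 * real M * \<bar>g (x - z) - g x\<bar>)"
    proof (rule integral_mono)
      fix x
      have "\<bar>g (x - z) - g x\<bar> \<le> 2 * real M" using Tle(2)[of M x] Tle(2)[of M "x - z"] unfolding g_def by linarith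
      then have "\<bar>g (x - z) - g x\<bar> * \<bar>g (x - z) - g x\<bar> \<le> 2 * real M * \<bar>g (x - z) - g x\<bar>"
        by (rule mult_right_mono) simp
      then show "(g (x - z) - g x)\<^sup>2 \<le> 2 * real M * \<bar>g (x - z) - g x\<bar>" by (simp add: power2_eq_square abs_mult[symmetric])
    qed (use i gabs in auto)
    finally have "(LINT x|lborel. (f (x - z) - f x)\<^sup>2) < e" using elim M by (simp add: g_def)
    moreover have "(LINT x|lborel. (f (x - z) - f x)\<^sup>2) \<ge> 0" by simp
    ultimately show ?case by simp
  qed
qed

subsection \<open>Mollifiers\<close>

lemma cball_sets_borel[measurable]: "cball x r \<in> sets (borel :: (real^'n::finite) measure)"
  by simp

text \<open>A nonnegative integrable function with integral 0 vanishes almost everywhere, whereas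
  this one is positive on a ball.\<close>

lemma scaled_bump_integral_pos:
  assumes "c > 0"
  shows "0 < (LINT y|lborel. bump (c *\<^sub>R (y :: real^'n::finite)))"
proof -
  have i: "integrable lborel (\<lambda>y::real^'n. bump (c *\<^sub>R y))"
    using cont_csupp_integrable[OF cont_csupp_affine[OF cont_csupp_test[OF test_function_bump, of "[]"], of c 0]] assms by simp
  have "(LINT y|lborel. bump (c *\<^sub>R (y :: real^'n))) \<noteq> 0"
  proof
    assume "(LINT y|lborel. bump (c *\<^sub>R (y :: real^'n))) = 0"
    then have "AE y in lborel. bump (c *\<^sub>R (y :: real^'n)) = 0"
      using integral_nonneg_eq_0_iff_AE[OF i] bump_nonneg by auto
    then obtain N where N: "{y. bump (c *\<^sub>R (y :: real^'n)) \<noteq> 0} \<subseteq> N" "N \<in> null_sets lborel"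
      by (auto elim!: AE_E simp: null_setsI)
    have "ball (0::real^'n) (1 / c) \<subseteq> N"
    proof
      fix y :: "real^'n" assume "y \<in> ball 0 (1 / c)"
      then have "norm (c *\<^sub>R y) < 1" using assms by (simp add: field_simps)
      then have "bump (c *\<^sub>R y) \<noteq> 0" using bump_pos[of "c *\<^sub>R y"] by simp
      then show "y \<in> N" using N(1) by blast
    qed
    then have "negligible (ball (0::real^'n) (1 / c))"
      using N(2) null_sets_completionI negligible_iff_null_sets negligible_subset by blast
    moreover have "ball (0::real^'n) (1 / c) \<noteq> {}" using assms by simp
    ultimately show False using open_not_negligible open_ball by blast
  qed
  moreover have "0 \<le> (LINT y|lborel. bump (c *\<^sub>R (y :: real^'n)))"
    by (rule Bochner_Integration.integral_nonneg) (rule bump_nonneg)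
  ultimately show ?thesis by simp
qed

text \<open>Normalising by the integral of the scaled bump itself avoids the Jacobian of the
  scaling; \<open>Suc n\<close> keeps the scale away from 0.\<close>

definition mollifier :: "nat \<Rightarrow> real^'n::finite \<Rightarrow> real" where
  "mollifier n x = 1 / (LINT y|lborel. bump (real (Suc n) *\<^sub>R (y :: real^'n))) * bump (real (Suc n) *\<^sub>R x)"

lemma mollifier_nonneg: "0 \<le> mollifier n x"
  unfolding mollifier_def
  by (intro mult_nonneg_nonneg bump_nonneg) (simp add: bump_nonneg)

lemma mollifier_eq_0: "norm x > CARD('n) / real (Suc n) \<Longrightarrow> mollifier n x = 0" for x :: "real^'n::finite"
proof -
  assume "norm x > CARD('n) / real (Suc n)"
  then have "norm (real (Suc n) *\<^sub>R x) > CARD('n)" by (simp add: field_simps del: of_nat_Suc)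
  then show ?thesis unfolding mollifier_def by (subst bump_eq_0) auto
qed

lemma test_function_mollifier: "test_function (mollifier n)"
  unfolding mollifier_def[abs_def]
  using test_function_affine(2)[OF test_function_bump, of "real (Suc n)" _ 0]
  by (simp del: of_nat_Suc times_divide_eq_left)

lemma mollifier_partial_commute:
  "partial j (partial k (mollifier n)) = (partial k (partial j (mollifier n)) :: real^'n::finite \<Rightarrow> real)"
proof -
  define c where "c = 1 / (LINT y|lborel. bump (real (Suc n) *\<^sub>R (y :: real^'n)))"
  define s where "s = real (Suc n)"
  have s: "s \<noteq> 0" by (simp add: s_def)
  have m: "mollifier n = (\<lambda>x::real^'n. c * bump (0 + s *\<^sub>R x))"
    by (auto simp: mollifier_def c_def s_def)
  have "partial j (partial k (mollifier n)) = (\<lambda>x::real^'n. c * (s\<^sup>2 * partial j (partial k bump) (s *\<^sub>R x)))" for j k :: 'n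
  proof -
    have 1: "has_pd k (mollifier n) (\<lambda>x. c * (s * partials [k] bump (0 + s *\<^sub>R x)))"
      unfolding m using has_pd_cmult[OF has_pd_affine[OF test_function_has_pd[OF test_function_bump, of k "[]"], of 0 s], of c] by simp
    have 2: "has_pd j (\<lambda>x. c * (s * partials [k] bump (0 + s *\<^sub>R x))) (\<lambda>x. c * (s * (s * partials [j, k] bump (0 + s *\<^sub>R x))))"
      by (intro has_pd_cmult has_pd_affine test_function_has_pd test_function_bump)
    show ?thesis using has_pd_partial[OF 2] unfolding has_pd_partial[OF 1] by (simp add: power2_eq_square mult.assoc)
  qed
  then show ?thesis using bump_partial_commute by metis
qed

lemma cont_csupp_mollifier: "cont_csupp (mollifier n)"
  using cont_csupp_test[OF test_function_mollifier, of "[]"] by simp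

lemma mollifier_measurable[measurable]: "mollifier n \<in> borel_measurable borel"
  by (rule cont_csupp_measurable[OF cont_csupp_mollifier])

lemma mollifier_integrable: "integrable lborel (mollifier n :: real^'n::finite \<Rightarrow> real)"
  by (rule cont_csupp_integrable[OF cont_csupp_mollifier])

lemma integral_mollifier: "(LINT x|lborel. mollifier n (x :: real^'n::finite)) = 1"
  using scaled_bump_integral_pos[where 'n='n, of "real (Suc n)"] unfolding mollifier_def by simp

lemma nn_integral_mollifier: "(\<integral>\<^sup>+x. ennreal (mollifier n (x :: real^'n::finite)) \<partial>lborel) = 1"
  by (subst nn_integral_eq_integral[OF mollifier_integrable]) (simp_all add: mollifier_nonneg integral_mollifier)

lemma mollifier_mult_integrable:
  assumes "integrable lborel g"
  shows "integrable lborel (\<lambda>z. mollifier n z * g z)"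
proof -
  have "locally_integrable g"
    using assms by (intro locally_integrableI) (auto simp: mult.commute intro: integrable_real_mult_indicator)
  then show ?thesis by (rule locally_integrable_mult[OF _ cont_csupp_mollifier])
qed

text \<open>One argument for L^1 (w the absolute value) and L^2 (w the square). The difference of
  convolution and f is an average of translation differences; \<open>jensen\<close> moves w inside,
  Tonelli exchanges the integrals, and there remains an average of the integrals in \<open>J\<close>
  over the small support of the mollifier. On the ball of radius r the globally integrable g may
  replace f, since no mollifier reaches further than \<open>CARD('n)\<close>.\<close>

lemma mollifier_integral_tendsto:
  fixes f :: "real^'n::finite \<Rightarrow> real" and w :: "real \<Rightarrow> real" and r :: real
  assumes f: "locally_integrable f"
    and w[measurable]: "w \<in> borel_measurable borel" and w0: "w 0 = 0" and wpos: "\<And>t. w t \<ge> 0"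
    and g_def: "g = (\<lambda>x. indicator (cball 0 (r + real CARD('n))) x * f x)"
    and J: "((\<lambda>z. LINT x|lborel. w (g (x - z) - g x)) \<longlongrightarrow> 0) (at 0)"
    and Ji: "\<And>z. integrable lborel (\<lambda>x. w (g (x - z) - g x))"
    and jensen_i: "\<And>n x. integrable lborel (\<lambda>z. mollifier n z * w (g (x - z) - g x))"
    and jensen: "\<And>n x. w (LINT z|lborel. mollifier n z * (g (x - z) - g x)) \<le>
                          (LINT z|lborel. mollifier n z * w (g (x - z) - g x))"
  shows "(\<lambda>n. LINT x|lborel. indicator (cball 0 r) x * w (conv (mollifier n) f x - f x)) \<longlonglongrightarrow> 0"
proof (rule tendstoI)
  fix e :: real assume e: "e > 0"
  have fm[measurable]: "f \<in> borel_measurable borel" using f by (simp add: locally_integrable_def)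
  have gm[measurable]: "g \<in> borel_measurable borel" unfolding g_def by measurable
  have gi: "integrable lborel g" unfolding g_def by (rule locally_integrable_cball[OF f])
  have "\<forall>\<^sub>F z in at 0. dist (LINT x|lborel. w (g (x - z) - g x)) 0 < e / 2"
    by (rule tendstoD[OF J]) (use e in simp)
  then obtain d where d: "d > 0" "\<And>z. z \<noteq> 0 \<Longrightarrow> dist z 0 < d \<Longrightarrow> (LINT x|lborel. w (g (x - z) - g x)) < e / 2"
    unfolding eventually_at using wpos by auto
  \<comment> \<open>The limit \<open>at 0\<close> says nothing about z = 0, where the integrand is
    \<open>w 0\<close>, that is 0.\<close>
  have J_le: "(LINT x|lborel. w (g (x - z) - g x)) \<le> e / 2" if "norm z < d" for z
    using d(2)[of z] that e by (cases "z = 0") (auto simp: w0 less_imp_le)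
  have "(\<lambda>n. real CARD('n) * (1 / real (Suc n))) \<longlonglongrightarrow> real CARD('n) * 0"
    by (intro tendsto_mult tendsto_const LIMSEQ_Suc[OF lim_1_over_n])
  then have "\<forall>\<^sub>F n in sequentially. real CARD('n) * (1 / real (Suc n)) < d"
    using d(1) by (intro order_tendstoD(2)) auto
  then show "\<forall>\<^sub>F n in sequentially. dist (LINT x|lborel. indicator (cball 0 r) x * w (conv (mollifier n) f x - f x)) 0 < e"
  proof eventually_elim
    case (elim n)
    have eq: "conv (mollifier n) f x - f x = (LINT z|lborel. mollifier n z * (g (x - z) - g x))"
      if x: "norm x \<le> r" for x
    proof -
      have "conv (mollifier n) f x = conv (mollifier n) g x"
        unfolding conv_def
      proof (intro Bochner_Integration.integral_cong refl)
        fix y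
        show "mollifier n (x - y) * f y = mollifier n (x - y) * g y"
        proof (cases "norm y \<le> r + real CARD('n)")
          case False
          have "real CARD('n) / real (Suc n) \<le> real CARD('n) / 1"
            by (rule divide_left_mono) auto
          moreover have "norm (x - y) > real CARD('n)"
            using False x norm_triangle_ineq2[of y x] by (simp add: norm_minus_commute)
          ultimately have "mollifier n (x - y) = 0" by (intro mollifier_eq_0) simp
          then show ?thesis by simp
        qed (simp add: g_def)
      qed
      moreover have "f x = g x" using x by (simp add: g_def)
      moreover have "(LINT z|lborel. mollifier n z * (g (x - z) - g x)) =
        (LINT z|lborel. mollifier n z * g (x - z)) - g x"
      proof -
        have "integrable lborel (\<lambda>z. g (x - z))" using integrable_affine[OF _ gi, of "-1" x] by simp
        then have 1: "integrable lborel (\<lambda>z. mollifier n z * g (x - z))" by (rule mollifier_mult_integrable)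
        have 2: "integrable lborel (\<lambda>z::real^'n. mollifier n z * g x)"
          by (rule integrable_mult_left[OF mollifier_integrable])
        show ?thesis unfolding right_diff_distrib Bochner_Integration.integral_diff[OF 1 2]
          by (simp add: integral_mollifier)
      qed
      ultimately show ?thesis using conv_commute[OF gm mollifier_measurable, of n x]
        by (simp add: integral_mollifier)
    qed
    \<comment> \<open>Extended nonnegative integrals can be exchanged on measurability
      alone.\<close>
    have "(\<integral>\<^sup>+x. ennreal (indicator (cball 0 r) x * w (conv (mollifier n) f x - f x)) \<partial>lborel)
      \<le> (\<integral>\<^sup>+x. (\<integral>\<^sup>+z. ennreal (mollifier n z * w (g (x - z) - g x)) \<partial>lborel) \<partial>lborel)"
    proof (rule nn_integral_mono)
      fix x
      have "indicator (cball 0 r) x * w (conv (mollifier n) f x - f x) \<le> (LINT z|lborel. mollifier n z * w (g (x - z) - g x))"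
        using jensen[of n x] order_trans[OF wpos jensen[of n x]] eq[of x] by (cases "norm x \<le> r") auto
      then show "ennreal (indicator (cball 0 r) x * w (conv (mollifier n) f x - f x)) \<le> 
          (\<integral>\<^sup>+z. ennreal (mollifier n z * w (g (x - z) - g x)) \<partial>lborel)"
        by (subst nn_integral_eq_integral[OF jensen_i]) (auto simp: wpos mollifier_nonneg intro: ennreal_leI)
    qed
    also have "\<dots> = (\<integral>\<^sup>+z. (\<integral>\<^sup>+x. ennreal (mollifier n z * w (g (x - z) - g x)) \<partial>lborel) \<partial>lborel)"
      by (rule lborel_pair.Fubini') measurable
    also have "\<dots> \<le> (\<integral>\<^sup>+z. ennreal (mollifier n (z :: real^'n)) * ennreal (e / 2) \<partial>lborel)"
    proof (rule nn_integral_mono)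
      fix z :: "real^'n"
      have "(\<integral>\<^sup>+x. ennreal (mollifier n z * w (g (x - z) - g x)) \<partial>lborel) = ennreal (LINT x|lborel. mollifier n z * w (g (x - z) - g x))"
        by (rule nn_integral_eq_integral) (auto simp: wpos mollifier_nonneg intro!: integrable_mult_right Ji)
      also have "\<dots> = ennreal (mollifier n z * (LINT x|lborel. w (g (x - z) - g x)))" by simp
      also have "\<dots> \<le> ennreal (mollifier n z * (e / 2))"
      proof (rule ennreal_leI)
        show "mollifier n z * (LINT x|lborel. w (g (x - z) - g x)) \<le> mollifier n z * (e / 2)"
        proof (cases "norm z < d")
          case True
          then show ?thesis by (intro mult_left_mono J_le mollifier_nonneg)
        next
          case False
          then have "mollifier n z = 0" using elim by (intro mollifier_eq_0) simp
          then show ?thesis by simp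
        qed
      qed
      finally show "(\<integral>\<^sup>+x. ennreal (mollifier n z * w (g (x - z) - g x)) \<partial>lborel) \<le> ennreal (mollifier n z) * ennreal (e / 2)"
        using e by (subst ennreal_mult[OF mollifier_nonneg, symmetric]) simp_all
    qed
    also have "\<dots> = ennreal (e / 2)"
      by (simp add: nn_integral_multc nn_integral_mollifier)
    finally have "(LINT x|lborel. indicator (cball 0 r) x * w (conv (mollifier n) f x - f x)) \<le> e / 2"
      using e by (intro integral_real_bounded) auto
    moreover have "0 \<le> (LINT x|lborel. indicator (cball 0 r) x * w (conv (mollifier n) f x - f x))"
      using wpos by (intro Bochner_Integration.integral_nonneg) auto
    ultimately show ?case using e by simp
  qed
qed

text \<open>Serves the uniqueness of weak derivatives, which are only known to be locally
  integrable.\<close>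

lemma mollifier_tendsto_L1:
  fixes f :: "real^'n::finite \<Rightarrow> real"
  assumes f: "locally_integrable f"
  shows "(\<lambda>n. LINT x|lborel. indicator (cball 0 r) x * \<bar>conv (mollifier n) f x - f x\<bar>) \<longlonglongrightarrow> 0"
proof -
  define g where "g = (\<lambda>x. indicator (cball 0 (r + real CARD('n))) x * f x)"
  have gi: "integrable lborel g" unfolding g_def by (rule locally_integrable_cball[OF f])
  have gx: "integrable lborel (\<lambda>z. g (x - z))" for x using integrable_affine[OF _ gi, of "-1" x] by simp
  have i: "integrable lborel (\<lambda>z. mollifier n z * (g (x - z) - g x))" for n x
    using mollifier_mult_integrable[OF gx[of x], of n] integrable_mult_left[where c="g x", OF mollifier_integrable[of n]]
    unfolding right_diff_distrib by (rule Bochner_Integration.integrable_diff)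
  show ?thesis
  proof (rule mollifier_integral_tendsto[OF f _ _ _ g_def])
    show "((\<lambda>z. LINT x|lborel. \<bar>g (x - z) - g x\<bar>) \<longlongrightarrow> 0) (at 0)"
      using transl_cont_integrable[OF gi] by (simp add: transl_cont_def)
    show "integrable lborel (\<lambda>x. \<bar>g (x - z) - g x\<bar>)" for z using gi integrable_translate[OF gi] by auto
    have eq: "(\<lambda>z. mollifier n z * \<bar>g (x - z) - g x\<bar>) = (\<lambda>z. \<bar>mollifier n z * (g (x - z) - g x)\<bar>)" for n x
      by (simp add: abs_mult abs_of_nonneg[OF mollifier_nonneg])
    show "integrable lborel (\<lambda>z. mollifier n z * \<bar>g (x - z) - g x\<bar>)" for n x
      unfolding eq using i by (rule integrable_abs)
    show "\<bar>LINT z|lborel. mollifier n z * (g (x - z) - g x)\<bar> \<le> (LINT z|lborel. mollifier n z * \<bar>g (x - z) - g x\<bar>)" for n x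
      unfolding eq by (rule integral_abs_bound)
  qed auto
qed

subsection \<open>Local square integrability\<close>

definition L2loc :: "(real^'n::finite \<Rightarrow> real) \<Rightarrow> bool" where
  "L2loc f \<longleftrightarrow> f \<in> borel_measurable borel \<and> (\<forall>r. integrable lborel (\<lambda>x. indicator (cball 0 r) x * (f x)\<^sup>2))"

lemma L2loc_locally_integrable:
  assumes "L2loc f"
  shows "locally_integrable f"
proof (rule locally_integrableI)
  show [measurable]: "f \<in> borel_measurable borel" using assms by (simp add: L2loc_def)
  fix r
  have "integrable lborel (\<lambda>x. indicator (cball 0 r) x * 1 + indicator (cball 0 r) x * (f x)\<^sup>2)"
    using assms locally_integrable_cball[OF locally_integrable_continuous, of "\<lambda>_. 1" r]
    by (intro Bochner_Integration.integrable_add) (auto simp: L2loc_def)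
  then show "integrable lborel (\<lambda>x. indicator (cball 0 r) x * f x)"
  proof (rule Bochner_Integration.integrable_bound)
    have "\<bar>f x\<bar> \<le> 1 + (f x)\<^sup>2" for x
    proof -
      have "0 \<le> (\<bar>f x\<bar> - 1)\<^sup>2" by simp
      then have "2 * \<bar>f x\<bar> \<le> 1 + (f x)\<^sup>2" unfolding power2_diff by simp
      then show ?thesis by linarith
    qed
    then show "AE x in lborel. norm (indicator (cball 0 r) x * f x) \<le>
        norm (indicator (cball 0 r) x * 1 + indicator (cball 0 r) x * (f x)\<^sup>2)"
      by (intro AE_I2) (auto simp: indicator_def)
  qed simp
qed

lemma L2loc_continuous:
  assumes "continuous_on UNIV f"
  shows "L2loc f"
  unfolding L2loc_def
  using borel_measurable_continuous_onI[OF assms]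
    locally_integrable_cball[OF locally_integrable_continuous[OF continuous_on_power[OF assms, of 2]]] by blast

lemma mollifier_tendsto_L2:
  fixes f :: "real^'n::finite \<Rightarrow> real"
  assumes f2: "L2loc f"
  shows "(\<lambda>n. LINT x|lborel. indicator (cball 0 r) x * (conv (mollifier n) f x - f x)\<^sup>2) \<longlonglongrightarrow> 0"
proof -
  define g where "g = (\<lambda>x. indicator (cball 0 (r + real CARD('n))) x * f x)"
  note f = L2loc_locally_integrable[OF f2]
  have gi: "integrable lborel g" unfolding g_def by (rule locally_integrable_cball[OF f])
  have gm[measurable]: "g \<in> borel_measurable borel" using gi by auto
  have g2_eq: "(\<lambda>x. (g x)\<^sup>2) = (\<lambda>x. indicator (cball 0 (r + real CARD('n))) x * (f x)\<^sup>2)"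
    unfolding g_def by (auto simp: indicator_def)
  have g2: "integrable lborel (\<lambda>x. (g x)\<^sup>2)"
    using f2 unfolding g2_eq L2loc_def by blast
  have gx: "integrable lborel (\<lambda>z. g (x - z))" for x using integrable_affine[OF _ gi, of "-1" x] by simp
  have gx2: "integrable lborel (\<lambda>z. (g (x - z))\<^sup>2)" for x using integrable_affine[OF _ g2, of "-1" x] by simp
  have i: "integrable lborel (\<lambda>z. mollifier n z * (g (x - z) - g x))" for n x
    using mollifier_mult_integrable[OF gx[of x], of n] integrable_mult_left[where c="g x", OF mollifier_integrable[of n]]
    unfolding right_diff_distrib by (rule Bochner_Integration.integrable_diff)
  show ?thesis
  proof (rule mollifier_integral_tendsto[OF f _ _ _ g_def])
    show "((\<lambda>z. LINT x|lborel. (g (x - z) - g x)\<^sup>2) \<longlongrightarrow> 0) (at 0)"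
      by (rule transl_L2[OF gi g2])
    show "integrable lborel (\<lambda>x. (g (x - z) - g x)\<^sup>2)" for z
      by (rule integrable_square_diff) (use g2 integrable_translate[OF g2] in auto)
    show i2: "integrable lborel (\<lambda>z. mollifier n z * (g (x - z) - g x)\<^sup>2)" for n x
    proof -
      have "integrable lborel (\<lambda>z. mollifier n z * (g (x - z))\<^sup>2 - (2 * g x) * (mollifier n z * g (x - z)) + (g x)\<^sup>2 * mollifier n z)"
        by (intro Bochner_Integration.integrable_add Bochner_Integration.integrable_diff integrable_mult_right
            mollifier_mult_integrable gx gx2 mollifier_integrable)
      then show ?thesis by (simp add: power2_diff algebra_simps)
    qed
    show "(LINT z|lborel. mollifier n z * (g (x - z) - g x))\<^sup>2 \<le> (LINT z|lborel. mollifier n z * (g (x - z) - g x)\<^sup>2)" for n x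
    proof -
      \<comment> \<open>Jensen's inequality for the square: the variance with respect to the
        probability density \<open>mollifier n\<close> is nonnegative, and m is the mean.\<close>
      define m where "m = (LINT z|lborel. mollifier n z * (g (x - z) - g x))"
      have "0 \<le> (LINT z|lborel. mollifier n z * ((g (x - z) - g x) - m)\<^sup>2)"
        by (intro Bochner_Integration.integral_nonneg mult_nonneg_nonneg mollifier_nonneg zero_le_power2)
      also have "\<dots> = (LINT z|lborel. mollifier n z * (g (x - z) - g x)\<^sup>2 - (2 * m) * (mollifier n z * (g (x - z) - g x)) + m\<^sup>2 * mollifier n z)"
        by (intro Bochner_Integration.integral_cong) (auto simp: power2_eq_square algebra_simps)
      also have "\<dots> = (LINT z|lborel. mollifier n z * (g (x - z) - g x)\<^sup>2) - (2 * m) * m + m\<^sup>2 * 1"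
      proof -
        have "(LINT z|lborel. mollifier n z * (g (x - z) - g x)\<^sup>2 - c * (mollifier n z * (g (x - z) - g x)) + c' * mollifier n z) =
          (LINT z|lborel. mollifier n z * (g (x - z) - g x)\<^sup>2) - c * (LINT z|lborel. mollifier n z * (g (x - z) - g x)) + c' * 1" for c c'
          using i2[of n x] i[of n x] mollifier_integrable[where 'n='n, of n] by (simp add: integral_mollifier)
        then show ?thesis unfolding m_def by blast
      qed
      finally show ?thesis unfolding m_def[symmetric] by (simp add: power2_eq_square)
    qed
  qed auto
qed

text \<open>\<open>L2loc\<close> is demanded of the sequence and of the limit, because the integral
  of a nonintegrable function is 0 and would count as convergence.\<close>

definition L2loc_lim :: "(nat \<Rightarrow> real^'n::finite \<Rightarrow> real) \<Rightarrow> (real^'n \<Rightarrow> real) \<Rightarrow> bool" where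
  "L2loc_lim F f \<longleftrightarrow> (\<forall>n. L2loc (F n)) \<and> L2loc f \<and>
     (\<forall>r. (\<lambda>n. LINT x|lborel. indicator (cball 0 r) x * (F n x - f x)\<^sup>2) \<longlonglongrightarrow> 0)"

lemma L2loc_measurable: "L2loc f \<Longrightarrow> f \<in> borel_measurable borel"
  by (simp add: L2loc_def)

lemma L2loc_integrable: "L2loc f \<Longrightarrow> integrable lborel (\<lambda>x. indicator (cball 0 r) x * (f x)\<^sup>2)"
  by (simp add: L2loc_def)

lemma L2loc_diff:
  assumes "L2loc f" "L2loc g"
  shows "L2loc (\<lambda>x. f x - g x)"
  unfolding L2loc_def
proof (intro conjI allI)
  note [measurable] = assms[THEN L2loc_measurable]
  show "(\<lambda>x. f x - g x) \<in> borel_measurable borel" by measurable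
  fix r
  have "integrable lborel (\<lambda>x. 2 * (indicator (cball 0 r) x * (f x)\<^sup>2) + 2 * (indicator (cball 0 r) x * (g x)\<^sup>2))"
    using assms[THEN L2loc_integrable] by (intro Bochner_Integration.integrable_add integrable_mult_right)
  then show "integrable lborel (\<lambda>x. indicator (cball 0 r) x * (f x - g x)\<^sup>2)"
    by (rule Bochner_Integration.integrable_bound)
       (use square_diff_le in \<open>auto simp: indicator_def intro!: AE_I2\<close>)
qed

lemma L2loc_prod:
  assumes "L2loc f" "L2loc g"
  shows "locally_integrable (\<lambda>x. f x * g x)"
proof (rule locally_integrableI)
  note [measurable] = assms[THEN L2loc_measurable]
  show "(\<lambda>x. f x * g x) \<in> borel_measurable borel" by measurable
  fix r
  have le: "\<bar>f x * g x\<bar> \<le> (f x)\<^sup>2 + (g x)\<^sup>2" for x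
  proof -
    have "0 \<le> (\<bar>f x\<bar> - \<bar>g x\<bar>)\<^sup>2" by simp
    then have "2 * \<bar>f x * g x\<bar> \<le> (f x)\<^sup>2 + (g x)\<^sup>2" unfolding power2_diff by (simp add: abs_mult)
    then show ?thesis by linarith
  qed
  have "integrable lborel (\<lambda>x. indicator (cball 0 r) x * (f x)\<^sup>2 + indicator (cball 0 r) x * (g x)\<^sup>2)"
    using assms[THEN L2loc_integrable] by (intro Bochner_Integration.integrable_add)
  then show "integrable lborel (\<lambda>x. indicator (cball 0 r) x * (f x * g x))"
    by (rule Bochner_Integration.integrable_bound)
       (use le in \<open>auto simp: indicator_def intro!: AE_I2\<close>)
qed

lemma L2loc_mult_integrable:
  "cont_csupp c \<Longrightarrow> L2loc f \<Longrightarrow> L2loc g \<Longrightarrow> integrable lborel (\<lambda>x. c x * (f x * g x))"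
  by (intro locally_integrable_mult L2loc_prod)

lemma L2loc_lim_mollifier:
  assumes "L2loc f"
  shows "L2loc_lim (\<lambda>n. conv (mollifier n) f) f"
  unfolding L2loc_lim_def
  using assms mollifier_tendsto_L2[OF assms]
    L2loc_continuous[OF continuous_on_conv[OF cont_csupp_mollifier L2loc_locally_integrable[OF assms]]]
  by blast

text \<open>Young's inequality with a free parameter takes the place of Cauchy-Schwarz: for small s
  the differences receive a large weight and the fixed limits a small one.\<close>

lemma prod_diff_le:
  fixes F G f g s :: real
  assumes "s > 0"
  shows "\<bar>F * G - f * g\<bar> \<le> (1 + 1 / s) * ((F - f)\<^sup>2 + (G - g)\<^sup>2) + s * (f\<^sup>2 + g\<^sup>2)"
proof -
  have young: "\<bar>a * b\<bar> \<le> (1 / s) * a\<^sup>2 + s * b\<^sup>2" if "s > 0" for a b s :: real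
  proof -
    have "0 \<le> (1 / s) * (\<bar>a\<bar> - s * \<bar>b\<bar>)\<^sup>2" using that by simp
    also have "\<dots> = (1 / s) * a\<^sup>2 + s * b\<^sup>2 - 2 * \<bar>a * b\<bar>"
      using that by (simp add: power2_eq_square abs_mult field_simps)
    finally show ?thesis by (smt (verit) abs_ge_zero)
  qed
  have "F * G - f * g = (F - f) * (G - g) + (F - f) * g + (G - g) * f" by (simp add: algebra_simps)
  then have "\<bar>F * G - f * g\<bar> \<le> \<bar>(F - f) * (G - g)\<bar> + \<bar>(F - f) * g\<bar> + \<bar>(G - g) * f\<bar>" by linarith
  also have "\<dots> \<le> ((F - f)\<^sup>2 + (G - g)\<^sup>2) + ((1 / s) * (F - f)\<^sup>2 + s * g\<^sup>2) + ((1 / s) * (G - g)\<^sup>2 + s * f\<^sup>2)"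
    using young[of 1 "F - f" "G - g"] young[OF assms, of "F - f" g] young[OF assms, of "G - g" f] by simp
  finally show ?thesis by (simp add: algebra_simps)
qed

text \<open>Strong convergence of both factors is what lets quadratic expressions pass to the limit;
  every term of the integral identities has this form.\<close>

lemma L2loc_lim_prod:
  assumes c: "cont_csupp c" and F: "L2loc_lim F f" and G: "L2loc_lim G g"
  shows "(\<lambda>n. LINT x|lborel. c x * (F n x * G n x)) \<longlonglongrightarrow> (LINT x|lborel. c x * (f x * g x))"
proof (rule tendstoI)
  fix e :: real assume e: "e > 0"
  obtain r M where r: "M > 0" "\<And>x. norm x > r \<Longrightarrow> c x = 0" "\<And>x. \<bar>c x\<bar> \<le> M"
    using cont_csuppE[OF c] by metis
  have L: "L2loc (F n)" "L2loc (G n)" "L2loc f" "L2loc g" for n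
    using F G by (auto simp: L2loc_lim_def)
  define A where "A n = (LINT x|lborel. indicator (cball 0 r) x * (F n x - f x)\<^sup>2)" for n
  define B where "B n = (LINT x|lborel. indicator (cball 0 r) x * (G n x - g x)\<^sup>2)" for n
  define S where "S = (LINT x|lborel. indicator (cball 0 r) x * (f x)\<^sup>2) + (LINT x|lborel. indicator (cball 0 r) x * (g x)\<^sup>2)"
  have S0: "S \<ge> 0" unfolding S_def by simp
  \<comment> \<open>Makes the contribution M s S of the fixed limits less than e/2; S + 1 avoids a
    division by 0.\<close>
  define s where "s = e / (2 * M * (S + 1))"
  have s: "s > 0" using e r S0 by (simp add: s_def)
  have sS: "M * (s * S) < e / 2"
  proof -
    have "s * (2 * M * (S + 1)) = e" using r(1) S0 by (simp add: s_def)
    moreover have "M * s > 0" using r(1) s by simp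
    ultimately show ?thesis by (simp add: algebra_simps)
  qed
  have "(\<lambda>n. M * ((1 + 1 / s) * (A n + B n))) \<longlonglongrightarrow> M * ((1 + 1 / s) * (0 + 0))"
    unfolding A_def B_def using F G by (intro tendsto_intros) (auto simp: L2loc_lim_def)
  then have "\<forall>\<^sub>F n in sequentially. M * ((1 + 1 / s) * (A n + B n)) < e / 2"
    using e by (intro order_tendstoD(2)) auto
  then show "\<forall>\<^sub>F n in sequentially. dist (LINT x|lborel. c x * (F n x * G n x)) (LINT x|lborel. c x * (f x * g x)) < e"
  proof eventually_elim
    case (elim n)
    let ?I = "indicator (cball 0 r) :: _ \<Rightarrow> real"
    let ?b = "\<lambda>x. M * ((1 + 1 / s) * (?I x * (F n x - f x)\<^sup>2 + ?I x * (G n x - g x)\<^sup>2) + s * (?I x * (f x)\<^sup>2 + ?I x * (g x)\<^sup>2))"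
    note i = L2loc_integrable[OF L2loc_diff[OF L(1)[of n] L(3)], of r] L2loc_integrable[OF L2loc_diff[OF L(2)[of n] L(4)], of r]
      L2loc_integrable[OF L(3), of r] L2loc_integrable[OF L(4), of r]
    note j = L2loc_mult_integrable[OF c L(1)[of n] L(2)[of n]] L2loc_mult_integrable[OF c L(3,4)]
    have bi: "integrable lborel ?b"
      by (intro Bochner_Integration.integrable_add integrable_mult_right i)
    have "norm ((LINT x|lborel. c x * (F n x * G n x)) - (LINT x|lborel. c x * (f x * g x))) =
      norm (LINT x|lborel. c x * (F n x * G n x) - c x * (f x * g x))"
      by (subst Bochner_Integration.integral_diff[OF j]) simp
    also have "\<dots> \<le> (LINT x|lborel. ?b x)"
    proof (rule Bochner_Integration.integral_norm_bound_integral[OF Bochner_Integration.integrable_diff[OF j] bi])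
      fix x
      show "norm (c x * (F n x * G n x) - c x * (f x * g x)) \<le> ?b x"
      proof (cases "norm x \<le> r")
        case True
        have "norm (c x * (F n x * G n x) - c x * (f x * g x)) = \<bar>c x\<bar> * \<bar>F n x * G n x - f x * g x\<bar>"
          by (simp add: abs_mult[symmetric] right_diff_distrib)
        also have "\<dots> \<le> M * ((1 + 1 / s) * ((F n x - f x)\<^sup>2 + (G n x - g x)\<^sup>2) + s * ((f x)\<^sup>2 + (g x)\<^sup>2))"
          by (rule mult_mono[OF r(3) prod_diff_le[OF s]]) (use r(1) in auto)
        finally show ?thesis using True by simp
      next
        case False
        then show ?thesis using r(2)[of x] by simp
      qed
    qed
    also have "\<dots> = M * ((1 + 1 / s) * (A n + B n) + s * S)"
      unfolding A_def B_def S_def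
      by (simp only: integral_mult_right_zero Bochner_Integration.integral_add[OF i(1,2)] Bochner_Integration.integral_add[OF i(3,4)]
          Bochner_Integration.integral_add[OF integrable_mult_right[OF Bochner_Integration.integrable_add[OF i(1,2)]]
            integrable_mult_right[OF Bochner_Integration.integrable_add[OF i(3,4)]]])
    also have "\<dots> < e" using elim sS unfolding distrib_left[of M] by linarith
    finally show ?case by (simp add: dist_norm)
  qed
qed

section \<open>Completeness of L^2 on balls\<close>

text \<open>The Riesz-Fischer argument for all balls at once: a subsequence with rapidly decreasing
  differences converges almost everywhere, and Fatou's lemma turns the Cauchy estimates into
  estimates against the limit.\<close>

lemma L2loc_complete:
  fixes u :: "nat \<Rightarrow> real^'n::finite \<Rightarrow> real"
  assumes L: "\<And>n. L2loc (u n)"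
    and cauchy: "\<And>r e. e > 0 \<Longrightarrow> \<exists>N. \<forall>n\<ge>N. \<forall>m\<ge>N. (LINT x|lborel. indicator (cball 0 r) x * (u n x - u m x)\<^sup>2) < e"
  shows "\<exists>f. L2loc_lim u f"
proof -
  have um[measurable]: "u n \<in> borel_measurable borel" for n by (rule L2loc_measurable[OF L])
  define I where "I r = (indicator (cball 0 r) :: real^'n \<Rightarrow> real)" for r
  have Im[measurable]: "I r \<in> borel_measurable borel" for r unfolding I_def by measurable
  have i: "integrable lborel (\<lambda>x. I r x * (u n x - u m x)\<^sup>2)" for r n m
    unfolding I_def by (rule L2loc_integrable[OF L2loc_diff[OF L L]])
  have "\<exists>N. \<forall>n\<ge>N. \<forall>m\<ge>N. (LINT x|lborel. I (real k) x * (u n x - u m x)\<^sup>2) < (1 / 4) ^ k" for k :: nat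
    unfolding I_def by (rule cauchy) simp
  then obtain N where N: "\<And>k n m. N k \<le> n \<Longrightarrow> N k \<le> m \<Longrightarrow> (LINT x|lborel. I (real k) x * (u n x - u m x)\<^sup>2) < (1 / 4) ^ k"
    by metis
  \<comment> \<open>The sum makes \<sigma> monotone and at least \<open>N k\<close>; the summand k
    makes it tend to infinity, which the Fatou estimate uses.\<close>
  define \<sigma> where "\<sigma> k = (\<Sum>i\<le>k. N i) + k" for k
  have \<sigma>_ge: "N k \<le> \<sigma> k" "k \<le> \<sigma> k" for k
    unfolding \<sigma>_def using member_le_sum[of k "{..k}" N] by auto
  have \<sigma>_mono: "\<sigma> k \<le> \<sigma> (Suc k)" for k unfolding \<sigma>_def by simp
  define d where "d k x = u (\<sigma> (Suc k)) x - u (\<sigma> k) x" for k x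
  have dm[measurable]: "d k \<in> borel_measurable borel" for k unfolding d_def[abs_def] by measurable
  \<comment> \<open>The k-th difference is controlled on the ball of radius k. Shifting the index by
    R makes all estimates valid on the fixed ball of radius R.\<close>
  have d_le: "(LINT x|lborel. I (real R) x * (d (k + R) x)\<^sup>2) \<le> (1 / 4) ^ k" for k R
  proof -
    have "(LINT x|lborel. I (real R) x * (d (k + R) x)\<^sup>2) \<le> (LINT x|lborel. I (real (k + R)) x * (d (k + R) x)\<^sup>2)"
      unfolding d_def by (rule integral_mono[OF i i]) (auto simp: I_def indicator_def)
    also have "\<dots> < (1 / 4) ^ (k + R)"
      unfolding d_def using order_trans[OF \<sigma>_ge(1) \<sigma>_mono] \<sigma>_ge(1) by (intro N)
    also have "\<dots> \<le> (1 / 4) ^ k" by (rule power_decreasing) auto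
    finally show ?thesis by simp
  qed
  define V where "V R = (LINT x|lborel. I (real R) x * 1)" for R
  have Vi: "integrable lborel (\<lambda>x. I (real R) x * 1)" for R
    unfolding I_def by (rule locally_integrable_cball[OF locally_integrable_continuous]) simp
  have V0: "V R \<ge> 0" for R unfolding V_def I_def by simp
  have AE1: "AE x in lborel. (\<Sum>k. ennreal (I (real R) x * \<bar>d (k + R) x\<bar>)) \<noteq> \<infinity>" for R
  proof (rule nn_integral_PInf_AE)
    have "(\<integral>\<^sup>+x. (\<Sum>k. ennreal (I (real R) x * \<bar>d (k + R) x\<bar>)) \<partial>lborel) =
      (\<Sum>k. \<integral>\<^sup>+x. ennreal (I (real R) x * \<bar>d (k + R) x\<bar>) \<partial>lborel)"
      by (rule nn_integral_suminf) measurable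
    also have "\<dots> \<le> (\<Sum>k. ennreal ((V R + 1) * (1 / 2) ^ k))"
    proof (intro suminf_le allI summableI)
      fix k
      have "(\<integral>\<^sup>+x. ennreal (I (real R) x * \<bar>d (k + R) x\<bar>) \<partial>lborel) \<le>
        (\<integral>\<^sup>+x. ennreal ((1 / 2) ^ k * (I (real R) x * 1) + 2 ^ k * (I (real R) x * (d (k + R) x)\<^sup>2)) \<partial>lborel)"
      proof (intro nn_integral_mono ennreal_leI)
        fix x
        \<comment> \<open>Weighted arithmetic-geometric mean: since the integral of d^2 is at most
          4^(-k), both terms on the right integrate to multiples of 2^(-k).\<close>
        have "\<bar>d (k + R) x\<bar> \<le> (1 / 2) ^ k + 2 ^ k * (d (k + R) x)\<^sup>2"
        proof -
          define a where "a = \<bar>d (k + R) x\<bar>"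
          have "0 \<le> 2 ^ k * (a - (1 / 2) ^ k)\<^sup>2" by simp
          also have "\<dots> = 2 ^ k * a\<^sup>2 + (1 / 2) ^ k - 2 * a"
            by (simp add: power2_eq_square field_simps power_mult_distrib[symmetric])
          finally have "2 * a \<le> (1 / 2) ^ k + 2 ^ k * a\<^sup>2" by simp
          moreover have "a \<ge> 0" by (simp add: a_def)
          ultimately show ?thesis by (simp add: a_def)
        qed
        then show "I (real R) x * \<bar>d (k + R) x\<bar> \<le> (1 / 2) ^ k * (I (real R) x * 1) + 2 ^ k * (I (real R) x * (d (k + R) x)\<^sup>2)"
          unfolding I_def by (auto simp: indicator_def)
      qed
      also have "\<dots> = ennreal (LINT x|lborel. (1 / 2) ^ k * (I (real R) x * 1) + 2 ^ k * (I (real R) x * (d (k + R) x)\<^sup>2))"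
        unfolding d_def
        by (intro nn_integral_eq_integral Bochner_Integration.integrable_add integrable_mult_right Vi i) (auto simp: I_def)
      also have "(LINT x|lborel. (1 / 2) ^ k * (I (real R) x * 1) + 2 ^ k * (I (real R) x * (d (k + R) x)\<^sup>2)) =
        (1 / 2) ^ k * V R + 2 ^ k * (LINT x|lborel. I (real R) x * (d (k + R) x)\<^sup>2)"
        unfolding V_def d_def
        by (subst Bochner_Integration.integral_add[OF integrable_mult_right[OF Vi] integrable_mult_right[OF i]]) simp
      also have "ennreal \<dots> \<le> ennreal ((V R + 1) * (1 / 2) ^ k)"
      proof (rule ennreal_leI)
        have "2 ^ k * (LINT x|lborel. I (real R) x * (d (k + R) x)\<^sup>2) \<le> 2 ^ k * (1 / 4) ^ k"
          by (intro mult_left_mono d_le) simp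
        also have "\<dots> = (1 / 2 :: real) ^ k" by (simp add: power_mult_distrib[symmetric])
        finally show "(1 / 2) ^ k * V R + 2 ^ k * (LINT x|lborel. I (real R) x * (d (k + R) x)\<^sup>2) \<le> (V R + 1) * (1 / 2) ^ k"
          by (simp add: algebra_simps)
      qed
      finally show "(\<integral>\<^sup>+x. ennreal (I (real R) x * \<bar>d (k + R) x\<bar>) \<partial>lborel) \<le> ennreal ((V R + 1) * (1 / 2) ^ k)" .
    qed
    also have "\<dots> = ennreal (\<Sum>k. (V R + 1) * (1 / 2) ^ k)"
      by (rule suminf_ennreal2) (auto intro!: summable_mult summable_geometric mult_nonneg_nonneg simp: V0 add_nonneg_nonneg)
    finally show "(\<integral>\<^sup>+x. (\<Sum>k. ennreal (I (real R) x * \<bar>d (k + R) x\<bar>)) \<partial>lborel) \<noteq> \<infinity>"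
      by (auto simp: top_unique)
  qed measurable
  have AE2: "AE x in lborel. convergent (\<lambda>k. u (\<sigma> k) x)"
  proof -
    have "AE x in lborel. \<forall>R. (\<Sum>k. ennreal (I (real R) x * \<bar>d (k + R) x\<bar>)) \<noteq> \<infinity>"
      using AE1 by (simp add: AE_all_countable)
    then show ?thesis
    proof eventually_elim
      case (elim x)
      obtain R :: nat where R: "norm x \<le> real R" using real_arch_simple by blast
      then have "I (real R) x = 1" by (simp add: I_def)
      then have "summable (\<lambda>k. \<bar>d (k + R) x\<bar>)"
        using elim[rule_format, of R] by (intro summable_suminf_not_top) auto
      then have "summable (\<lambda>k. d (k + R) x)" by (rule summable_rabs_cancel)
      then have "summable (\<lambda>k. d k x)" using summable_iff_shift[of "\<lambda>k. d k x" R] by simp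
      then have "convergent (\<lambda>n. \<Sum>k<n. d k x)" by (simp add: summable_iff_convergent)
      moreover have "(\<Sum>k<n. d k x) = u (\<sigma> n) x - u (\<sigma> 0) x" for n
        unfolding d_def by (rule sum_lessThan_telescope)
      ultimately have "convergent (\<lambda>n. u (\<sigma> n) x - u (\<sigma> 0) x)" by simp
      then have "convergent (\<lambda>n. (u (\<sigma> n) x - u (\<sigma> 0) x) + u (\<sigma> 0) x)"
        by (intro convergent_add convergent_const)
      then show ?case by simp
    qed
  qed
  define f where "f x = lim (\<lambda>k. u (\<sigma> k) x)" for x
  have fm[measurable]: "f \<in> borel_measurable borel" unfolding f_def[abs_def] by measurable
  have AE3: "AE x in lborel. (\<lambda>k. u (\<sigma> k) x) \<longlonglongrightarrow> f x"
    using AE2 unfolding f_def by eventually_elim (simp add: convergent_LIMSEQ_iff)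
  \<comment> \<open>Extended integrals, since integrability of the square of u_n - f is still to be
    derived from this estimate.\<close>
  have fatou: "(\<integral>\<^sup>+x. ennreal (I r x * (u n x - f x)\<^sup>2) \<partial>lborel) \<le> ennreal e"
    if e: "e > 0" and Nr: "\<And>n m. n \<ge> Nr \<Longrightarrow> m \<ge> Nr \<Longrightarrow> (LINT x|lborel. I r x * (u n x - u m x)\<^sup>2) < e" and n: "n \<ge> Nr" for e r n Nr
  proof -
    have "(\<integral>\<^sup>+x. ennreal (I r x * (u n x - f x)\<^sup>2) \<partial>lborel) \<le>
      (\<integral>\<^sup>+x. liminf (\<lambda>k. ennreal (I r x * (u n x - u (\<sigma> k) x)\<^sup>2)) \<partial>lborel)"
    proof (rule nn_integral_mono_AE)
      show "AE x in lborel. ennreal (I r x * (u n x - f x)\<^sup>2) \<le> liminf (\<lambda>k. ennreal (I r x * (u n x - u (\<sigma> k) x)\<^sup>2))"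
        using AE3
      proof eventually_elim
        case (elim x)
        then have "(\<lambda>k. ennreal (I r x * (u n x - u (\<sigma> k) x)\<^sup>2)) \<longlonglongrightarrow> ennreal (I r x * (u n x - f x)\<^sup>2)"
          by (intro tendsto_ennrealI tendsto_intros)
        then show ?case by (simp add: lim_imp_Liminf)
      qed
    qed
    also have "\<dots> \<le> liminf (\<lambda>k. \<integral>\<^sup>+x. ennreal (I r x * (u n x - u (\<sigma> k) x)\<^sup>2) \<partial>lborel)"
      by (rule nn_integral_liminf) measurable
    also have "\<dots> \<le> ennreal e"
    proof (rule Liminf_le)
      show "\<forall>\<^sub>F k in sequentially. (\<integral>\<^sup>+x. ennreal (I r x * (u n x - u (\<sigma> k) x)\<^sup>2) \<partial>lborel) \<le> ennreal e"
        using eventually_ge_at_top[of Nr]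
      proof eventually_elim
        case (elim k)
        have "(\<integral>\<^sup>+x. ennreal (I r x * (u n x - u (\<sigma> k) x)\<^sup>2) \<partial>lborel) = ennreal (LINT x|lborel. I r x * (u n x - u (\<sigma> k) x)\<^sup>2)"
          by (rule nn_integral_eq_integral[OF i]) (auto simp: I_def)
        also have "\<dots> \<le> ennreal e"
          using Nr[OF n order_trans[OF elim \<sigma>_ge(2)]] by (intro ennreal_leI) simp
        finally show ?case .
      qed
    qed simp
    finally show ?thesis .
  qed
  have Lf: "L2loc f"
    unfolding L2loc_def
  proof (intro conjI allI fm)
    fix r
    obtain Nr where Nr: "\<And>n m. n \<ge> Nr \<Longrightarrow> m \<ge> Nr \<Longrightarrow> (LINT x|lborel. I r x * (u n x - u m x)\<^sup>2) < 1"
      using cauchy[of 1 r] unfolding I_def by auto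
    have "(\<integral>\<^sup>+x. ennreal (I r x * (u Nr x - f x)\<^sup>2) \<partial>lborel) < \<infinity>"
      by (rule order.strict_trans1[OF fatou[OF zero_less_one Nr order_refl]]) simp_all
    then have "integrable lborel (\<lambda>x. I r x * (u Nr x - f x)\<^sup>2)"
      by (intro integrableI_nonneg) (auto simp: I_def)
    moreover have "integrable lborel (\<lambda>x. I r x * (u Nr x)\<^sup>2)" unfolding I_def by (rule L2loc_integrable[OF L])
    ultimately have "integrable lborel (\<lambda>x. 2 * (I r x * (u Nr x)\<^sup>2) + 2 * (I r x * (u Nr x - f x)\<^sup>2))"
      by (intro Bochner_Integration.integrable_add integrable_mult_right)
    then have "integrable lborel (\<lambda>x. I r x * (f x)\<^sup>2)"
    proof (rule Bochner_Integration.integrable_bound)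
      have "(f x)\<^sup>2 \<le> 2 * (u Nr x)\<^sup>2 + 2 * (u Nr x - f x)\<^sup>2" for x
        using square_diff_le[of "u Nr x" "u Nr x - f x"] by simp
      then show "AE x in lborel. norm (I r x * (f x)\<^sup>2) \<le> norm (2 * (I r x * (u Nr x)\<^sup>2) + 2 * (I r x * (u Nr x - f x)\<^sup>2))"
        unfolding I_def by (intro AE_I2) (auto simp: indicator_def)
    qed measurable
    then show "integrable lborel (\<lambda>x. indicator (cball 0 r) x * (f x)\<^sup>2)" by (simp add: I_def)
  qed
  have "(\<lambda>n. LINT x|lborel. I r x * (u n x - f x)\<^sup>2) \<longlonglongrightarrow> 0" for r
  proof (rule LIMSEQ_I)
    fix e :: real assume e: "e > 0"
    obtain Nr where Nr: "\<And>n m. n \<ge> Nr \<Longrightarrow> m \<ge> Nr \<Longrightarrow> (LINT x|lborel. I r x * (u n x - u m x)\<^sup>2) < e / 2"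
      using cauchy[of "e / 2" r] e unfolding I_def by auto
    have "norm ((LINT x|lborel. I r x * (u n x - f x)\<^sup>2) - 0) < e" if n: "n \<ge> Nr" for n
    proof -
      have "(LINT x|lborel. I r x * (u n x - f x)\<^sup>2) \<le> e / 2"
        by (rule integral_real_bounded[OF _ fatou[OF _ Nr n]]) (use e in auto)
      moreover have "0 \<le> (LINT x|lborel. I r x * (u n x - f x)\<^sup>2)" by (simp add: I_def)
      ultimately show ?thesis using e by simp
    qed
    then show "\<exists>no. \<forall>n\<ge>no. norm ((LINT x|lborel. I r x * (u n x - f x)\<^sup>2) - 0) < e" by blast
  qed
  then show ?thesis using L Lf unfolding L2loc_lim_def I_def by blast
qed

subsection \<open>Integral identities for smooth functions\<close>

lemma cont_csupp_mult_integrable: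
  assumes "cont_csupp c" "continuous_on UNIV f" "continuous_on UNIV g"
  shows "integrable lborel (\<lambda>x. c x * (f x * g x))"
  by (intro L2loc_mult_integrable assms L2loc_continuous)

text \<open>The derivative of c u^2 has integral 0. In its limit form this removes products of
  \<psi> with its gradient, once with a weight containing v and once with one containing the
  gradient of the Laplacian of a.\<close>

lemma square_ibp:
  assumes c: "cont_csupp c" "has_pd j c c'" "continuous_on UNIV c'"
    and u: "has_pd j u u'" "continuous_on UNIV u" "continuous_on UNIV u'"
  shows "2 * (LINT x|lborel. c x * (u x * u' x)) + (LINT x|lborel. c' x * (u x * u x)) = 0"
proof -
  have c': "cont_csupp c'" by (rule cont_csupp_has_pd[OF c])
  have cc: "continuous_on UNIV c" using c(1) by (simp add: cont_csupp_def)
  have "has_pd j (\<lambda>x. c x * (u x * u x)) (\<lambda>x. c' x * (u x * u x) + c x * (u' x * u x + u x * u' x))"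
    by (intro has_pd_mult c u)
  then have "(LINT x|lborel. c' x * (u x * u x) + c x * (u' x * u x + u x * u' x)) = 0"
    by (rule integral_has_pd_eq_0[rotated])
       (intro cont_csupp_mult_right c continuous_intros u cc)+
  also have "(\<lambda>x. c' x * (u x * u x) + c x * (u' x * u x + u x * u' x)) =
      (\<lambda>x. c' x * (u x * u x) + 2 * (c x * (u x * u' x)))" by (auto simp: algebra_simps)
  finally show ?thesis
    using cont_csupp_mult_integrable[OF c' u(2,2)] cont_csupp_mult_integrable[OF c(1) u(2,3)] by simp
qed

lemma energy_identity:
  fixes u :: "real^'n::finite \<Rightarrow> real"
  assumes \<theta>: "cont_csupp \<theta>" "\<And>j. has_pd j \<theta> (\<theta>' j)" "\<And>j. continuous_on UNIV (\<theta>' j)"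
      "\<And>j. has_pd j (\<theta>' j) (\<theta>'' j)" "\<And>j. continuous_on UNIV (\<theta>'' j)"
    and u: "continuous_on UNIV u" "\<And>j. has_pd j u (u' j)" "\<And>j. continuous_on UNIV (u' j)"
      "\<And>j. has_pd j (u' j) (u'' j)" "\<And>j. continuous_on UNIV (u'' j)"
  shows "(\<Sum>j\<in>UNIV. LINT x|lborel. \<theta> x * (u' j x * u' j x)) + (LINT x|lborel. \<theta> x * (u x * (\<Sum>j\<in>UNIV. u'' j x)))
    - 1 / 2 * (LINT x|lborel. (\<Sum>j\<in>UNIV. \<theta>'' j x) * (u x * u x)) = 0"
proof -
  have cont: "continuous_on UNIV \<theta>" using \<theta>(1) by (simp add: cont_csupp_def)
  have \<theta>': "cont_csupp (\<theta>' j)" for j by (rule cont_csupp_has_pd[OF \<theta>(1-3)])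
  have \<theta>'': "cont_csupp (\<theta>'' j)" for j by (rule cont_csupp_has_pd[OF \<theta>' \<theta>(4,5)])
  have i: "integrable lborel (\<lambda>x. \<theta> x * (u' j x * u' j x))" "integrable lborel (\<lambda>x. \<theta> x * (u x * u'' j x))"
    "integrable lborel (\<lambda>x. \<theta>'' j x * (u x * u x))" for j
    by (intro cont_csupp_mult_integrable \<theta> \<theta>'' u)+
  have j: "(LINT x|lborel. \<theta> x * (u' j x * u' j x)) + (LINT x|lborel. \<theta> x * (u x * u'' j x))
      - 1 / 2 * (LINT x|lborel. \<theta>'' j x * (u x * u x)) = 0" for j
  proof -
    \<comment> \<open>The second term is chosen so that its derivative cancels \<theta>' u u',
      leaving the second derivative of \<theta> against u^2.\<close>
    have "has_pd j (\<lambda>x. \<theta> x * (u x * u' j x) - 1 / 2 * (\<theta>' j x * (u x * u x)))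
      (\<lambda>x. (\<theta>' j x * (u x * u' j x) + \<theta> x * (u' j x * u' j x + u x * u'' j x)) -
        1 / 2 * (\<theta>'' j x * (u x * u x) + \<theta>' j x * (u' j x * u x + u x * u' j x)))"
      by (intro has_pd_diff has_pd_mult has_pd_cmult \<theta> u)
    then have "(LINT x|lborel. (\<theta>' j x * (u x * u' j x) + \<theta> x * (u' j x * u' j x + u x * u'' j x)) -
        1 / 2 * (\<theta>'' j x * (u x * u x) + \<theta>' j x * (u' j x * u x + u x * u' j x))) = 0"
      by (rule integral_has_pd_eq_0[rotated])
         (intro cont_csupp_diff cont_csupp_mult_left[OF continuous_on_const] cont_csupp_mult_right \<theta> \<theta>' continuous_intros u cont)+
    also have "(\<lambda>x. (\<theta>' j x * (u x * u' j x) + \<theta> x * (u' j x * u' j x + u x * u'' j x)) -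
        1 / 2 * (\<theta>'' j x * (u x * u x) + \<theta>' j x * (u' j x * u x + u x * u' j x))) =
      (\<lambda>x. \<theta> x * (u' j x * u' j x) + \<theta> x * (u x * u'' j x) - 1 / 2 * (\<theta>'' j x * (u x * u x)))"
      by (auto simp: algebra_simps)
    finally show ?thesis
      by (simp only: Bochner_Integration.integral_diff[OF Bochner_Integration.integrable_add[OF i(1,2)] integrable_mult_right[OF i(3)]]
          Bochner_Integration.integral_add[OF i(1,2)] integral_mult_right_zero)
  qed
  have "(\<Sum>j\<in>UNIV. (LINT x|lborel. \<theta> x * (u' j x * u' j x)) + (LINT x|lborel. \<theta> x * (u x * u'' j x))
      - 1 / 2 * (LINT x|lborel. \<theta>'' j x * (u x * u x))) = 0"
    by (rule sum.neutral) (use j in blast)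
  moreover have "(LINT x|lborel. \<theta> x * (u x * (\<Sum>j\<in>UNIV. u'' j x))) = (\<Sum>j\<in>UNIV. LINT x|lborel. \<theta> x * (u x * u'' j x))"
    by (subst Bochner_Integration.integral_sum[symmetric]) (auto simp: sum_distrib_left i)
  moreover have "(LINT x|lborel. (\<Sum>j\<in>UNIV. \<theta>'' j x) * (u x * u x)) = (\<Sum>j\<in>UNIV. LINT x|lborel. \<theta>'' j x * (u x * u x))"
    by (subst Bochner_Integration.integral_sum[symmetric]) (auto simp: sum_distrib_right i)
  ultimately show ?thesis by (simp add: sum.distrib sum_subtractf sum_distrib_left)
qed

lemma virial_identity_smooth:
  fixes u :: "real^'n::finite \<Rightarrow> real"
  assumes b: "\<And>k. cont_csupp (b k)" "\<And>j k. has_pd j (b k) (b' j k)" "\<And>j k. continuous_on UNIV (b' j k)"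
    and d: "d = (\<lambda>x. \<Sum>k\<in>UNIV. b' k k x)" "\<And>j. has_pd j d (d' j)" "\<And>j. continuous_on UNIV (d' j)"
    and u: "continuous_on UNIV u" "\<And>j. has_pd j u (u' j)" "\<And>j. continuous_on UNIV (u' j)"
      "\<And>j k. has_pd j (u' k) (u'' j k)" "\<And>j k. continuous_on UNIV (u'' j k)"
    and sym: "\<And>j k. u'' j k = u'' k j"
  shows "2 * (\<Sum>j\<in>UNIV. \<Sum>k\<in>UNIV. LINT x|lborel. b' j k x * (u' j x * u' k x))
    + (\<Sum>j\<in>UNIV. LINT x|lborel. d' j x * (u x * u' j x))
    + 2 * (\<Sum>k\<in>UNIV. LINT x|lborel. b k x * (u' k x * (\<Sum>j\<in>UNIV. u'' j j x)))
    + (LINT x|lborel. d x * (u x * (\<Sum>j\<in>UNIV. u'' j j x))) = 0"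
proof -
  have bc: "continuous_on UNIV (b k)" for k using b(1) by (simp add: cont_csupp_def)
  have b': "cont_csupp (b' j k)" for j k by (rule cont_csupp_has_pd[OF b])
  have dcc: "cont_csupp d" unfolding d(1) by (intro cont_csupp_sum b')
  have d': "cont_csupp (d' j)" for j by (rule cont_csupp_has_pd[OF dcc d(2,3)])
  have dc: "continuous_on UNIV d" using dcc by (simp add: cont_csupp_def)
  \<comment> \<open>The flux of the Rellich-Pohozaev multiplier. In its divergence, 2 u_j b_k u_jk
    and -2 b_j u_k u_jk cancel by symmetry of the Hessian, and -d |grad u|^2 from the second term
    cancels against the derivative of d u u_j. Second derivatives of u survive only in the
    Laplacian.\<close>
  define X where "X j x = 2 * (u' j x * (\<Sum>k\<in>UNIV. b k x * u' k x)) - b j x * (\<Sum>k\<in>UNIV. u' k x * u' k x) + d x * (u x * u' j x)" for j x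
  define E where "E j x = 2 * (u'' j j x * (\<Sum>k\<in>UNIV. b k x * u' k x) + u' j x * (\<Sum>k\<in>UNIV. b' j k x * u' k x + b k x * u'' j k x))
      - (b' j j x * (\<Sum>k\<in>UNIV. u' k x * u' k x) + b j x * (\<Sum>k\<in>UNIV. u'' j k x * u' k x + u' k x * u'' j k x))
      + (d' j x * (u x * u' j x) + d x * (u' j x * u' j x + u x * u'' j j x))" for j x
  have Xpd: "has_pd j (X j) (E j)" for j
    unfolding X_def[abs_def] E_def[abs_def]
    by (intro has_pd_add has_pd_diff has_pd_mult has_pd_cmult has_pd_sum b u d)
  have Xcc: "cont_csupp (X j)" for j
    unfolding X_def[abs_def]
    by (intro cont_csupp_add cont_csupp_diff cont_csupp_mult_left[OF continuous_on_const] cont_csupp_mult_left[OF u(3)]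
         cont_csupp_sum cont_csupp_mult_right b dcc continuous_intros u)
  have Ec: "continuous_on UNIV (E j)" for j
    unfolding E_def[abs_def] by (intro continuous_intros b bc u d dc)
  have Ei: "integrable lborel (E j)" for j
    by (rule cont_csupp_integrable[OF cont_csupp_has_pd[OF Xcc Xpd Ec]])
  have "(LINT x|lborel. (\<Sum>j\<in>UNIV. E j x)) = 0"
    using integral_has_pd_eq_0[OF Xcc Xpd Ec] by (subst Bochner_Integration.integral_sum[OF Ei]) simp
  define L where "L x = (\<Sum>j\<in>UNIV. u'' j j x)" for x
  have Lc: "continuous_on UNIV L" unfolding L_def[abs_def] by (intro continuous_intros u)
  have swap: "(\<Sum>j\<in>UNIV. \<Sum>k\<in>UNIV. b j x * u' k x * u'' j k x) = (\<Sum>j\<in>UNIV. \<Sum>k\<in>UNIV. u' j x * b k x * u'' j k x)" for x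
    by (subst sum.swap) (simp add: sym[of _ _] mult_ac)
  have pt: "(\<Sum>j\<in>UNIV. E j x) = 2 * (\<Sum>j\<in>UNIV. \<Sum>k\<in>UNIV. b' j k x * (u' j x * u' k x))
    + (\<Sum>j\<in>UNIV. d' j x * (u x * u' j x)) + 2 * (\<Sum>k\<in>UNIV. b k x * (u' k x * L x)) + d x * (u x * L x)" for x
  proof -
    have "(\<Sum>j\<in>UNIV. E j x) = 2 * (\<Sum>j\<in>UNIV. u'' j j x * (\<Sum>k\<in>UNIV. b k x * u' k x))
      + 2 * (\<Sum>j\<in>UNIV. \<Sum>k\<in>UNIV. b' j k x * (u' j x * u' k x)) + 2 * (\<Sum>j\<in>UNIV. \<Sum>k\<in>UNIV. u' j x * b k x * u'' j k x)
      - (\<Sum>j\<in>UNIV. b' j j x * (\<Sum>k\<in>UNIV. u' k x * u' k x)) - 2 * (\<Sum>j\<in>UNIV. \<Sum>k\<in>UNIV. b j x * u' k x * u'' j k x)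
      + (\<Sum>j\<in>UNIV. d' j x * (u x * u' j x)) + (\<Sum>j\<in>UNIV. d x * (u' j x * u' j x)) + (\<Sum>j\<in>UNIV. d x * (u x * u'' j j x))"
      unfolding E_def
      by (simp add: sum.distrib sum_subtractf sum_distrib_left algebra_simps)
    also have "(\<Sum>j\<in>UNIV. u'' j j x * (\<Sum>k\<in>UNIV. b k x * u' k x)) = (\<Sum>k\<in>UNIV. b k x * (u' k x * L x))"
      unfolding sum_distrib_right[symmetric] L_def[symmetric] by (simp add: sum_distrib_left mult_ac)
    also have "(\<Sum>j\<in>UNIV. b' j j x * (\<Sum>k\<in>UNIV. u' k x * u' k x)) = (\<Sum>j\<in>UNIV. d x * (u' j x * u' j x))"
      unfolding sum_distrib_right[symmetric] sum_distrib_left[symmetric] d(1) by simp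
    also have "(\<Sum>j\<in>UNIV. d x * (u x * u'' j j x)) = d x * (u x * L x)"
      unfolding sum_distrib_left[symmetric] L_def ..
    finally show ?thesis unfolding swap by simp
  qed
  have i1: "integrable lborel (\<lambda>x. b' j k x * (u' j x * u' k x))" for j k by (intro cont_csupp_mult_integrable b' u)
  have i2: "integrable lborel (\<lambda>x. d' j x * (u x * u' j x))" for j by (intro cont_csupp_mult_integrable d' u)
  have i3: "integrable lborel (\<lambda>x. b k x * (u' k x * L x))" for k by (intro cont_csupp_mult_integrable b u Lc)
  have i4: "integrable lborel (\<lambda>x. d x * (u x * L x))" by (intro cont_csupp_mult_integrable dcc u Lc)
  note s1 = Bochner_Integration.integrable_sum[OF i1] 
  note s1' = integrable_mult_right[OF Bochner_Integration.integrable_sum[OF s1]]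
  note s2 = Bochner_Integration.integrable_sum[OF i2]
  note s3 = integrable_mult_right[OF Bochner_Integration.integrable_sum[OF i3]]
  have "(LINT x|lborel. (\<Sum>j\<in>UNIV. E j x)) = 2 * (\<Sum>j\<in>UNIV. \<Sum>k\<in>UNIV. LINT x|lborel. b' j k x * (u' j x * u' k x))
    + (\<Sum>j\<in>UNIV. LINT x|lborel. d' j x * (u x * u' j x)) + 2 * (\<Sum>k\<in>UNIV. LINT x|lborel. b k x * (u' k x * L x))
    + (LINT x|lborel. d x * (u x * L x))"
    unfolding pt
    by (simp only: Bochner_Integration.integral_add[OF Bochner_Integration.integrable_add[OF Bochner_Integration.integrable_add[OF s1' s2] s3] i4]
       Bochner_Integration.integral_add[OF Bochner_Integration.integrable_add[OF s1' s2] s3]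
       Bochner_Integration.integral_add[OF s1' s2] integral_mult_right_zero
       Bochner_Integration.integral_sum[OF s1] Bochner_Integration.integral_sum[OF i1]
       Bochner_Integration.integral_sum[OF i2] Bochner_Integration.integral_sum[OF i3])
  with \<open>(LINT x|lborel. (\<Sum>j\<in>UNIV. E j x)) = 0\<close> show ?thesis unfolding L_def by simp
qed

subsection \<open>Passage to the limit\<close>

text \<open>Packages the convergence that the identities use: functions, gradients and Laplacians,
  but no single second derivative. \<open>g\<close> stands for the Laplacian of \<psi>, and no
  equation is assumed yet. \<open>G\<close> is a parameter so that the same approximations can serve
  another representative of the gradient.\<close>

locale grad_approx =
  fixes \<psi> g :: "real^'n::finite \<Rightarrow> real" and G :: "'n \<Rightarrow> real^'n \<Rightarrow> real"
    and U :: "nat \<Rightarrow> real^'n \<Rightarrow> real" and U' :: "nat \<Rightarrow> 'n \<Rightarrow> real^'n \<Rightarrow> real"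
    and U'' :: "nat \<Rightarrow> 'n \<Rightarrow> 'n \<Rightarrow> real^'n \<Rightarrow> real"
  assumes pd: "\<And>n j. has_pd j (U n) (U' n j)" "\<And>n j k. has_pd j (U' n k) (U'' n j k)"
    and cont: "\<And>n. continuous_on UNIV (U n)" "\<And>n j. continuous_on UNIV (U' n j)"
      "\<And>n j k. continuous_on UNIV (U'' n j k)"
    and sym: "\<And>n j k. U'' n j k = U'' n k j"
    and lim: "L2loc_lim U \<psi>" "\<And>j. L2loc_lim (\<lambda>n. U' n j) (G j)" "L2loc_lim (\<lambda>n x. \<Sum>j\<in>UNIV. U'' n j j x) g"
begin

lemma L2loc_limits: "L2loc \<psi>" "L2loc (G j)" "L2loc g"
  using lim by (auto simp: L2loc_lim_def)

lemma weak_square_ibp: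
  assumes c: "cont_csupp c" "has_pd j c c'" "continuous_on UNIV c'"
  shows "2 * (LINT x|lborel. c x * (\<psi> x * G j x)) + (LINT x|lborel. c' x * (\<psi> x * \<psi> x)) = 0"
proof -
  have "(\<lambda>n. 2 * (LINT x|lborel. c x * (U n x * U' n j x)) + (LINT x|lborel. c' x * (U n x * U n x))) \<longlonglongrightarrow>
    2 * (LINT x|lborel. c x * (\<psi> x * G j x)) + (LINT x|lborel. c' x * (\<psi> x * \<psi> x))"
    by (intro tendsto_intros L2loc_lim_prod lim c cont_csupp_has_pd[OF c])
  moreover have "2 * (LINT x|lborel. c x * (U n x * U' n j x)) + (LINT x|lborel. c' x * (U n x * U n x)) = 0" for n
    by (rule square_ibp[OF c pd(1) cont(1,2)])
  ultimately show ?thesis by (simp add: LIMSEQ_const_iff)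
qed

lemma weak_ibp:
  assumes c: "cont_csupp c" "has_pd j c c'" "continuous_on UNIV c'"
  shows "(LINT x|lborel. c x * G j x) + (LINT x|lborel. c' x * \<psi> x) = 0"
proof -
  have c': "cont_csupp c'" by (rule cont_csupp_has_pd[OF c])
  have cc: "continuous_on UNIV c" using c(1) by (simp add: cont_csupp_def)
  \<comment> \<open>The constant 1 as a second factor turns linear terms into products covered by
    \<open>L2loc_lim_prod\<close>.\<close>
  have one: "L2loc_lim (\<lambda>n x. 1) (\<lambda>x::real^'n. 1)"
    unfolding L2loc_lim_def using L2loc_continuous[of "\<lambda>x::real^'n. 1"] by simp
  have "(\<lambda>n. (LINT x|lborel. c x * (U' n j x * 1)) + (LINT x|lborel. c' x * (U n x * 1))) \<longlonglongrightarrow>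
    (LINT x|lborel. c x * (G j x * 1)) + (LINT x|lborel. c' x * (\<psi> x * 1))"
    by (intro tendsto_add L2loc_lim_prod lim c c' one)
  moreover have "(LINT x|lborel. c x * (U' n j x * 1)) + (LINT x|lborel. c' x * (U n x * 1)) = 0" for n
  proof -
    have "has_pd j (\<lambda>x. c x * U n x) (\<lambda>x. c' x * U n x + c x * U' n j x)"
      by (intro has_pd_mult c pd)
    then have "(LINT x|lborel. c' x * U n x + c x * U' n j x) = 0"
      by (rule integral_has_pd_eq_0[rotated]) (intro cont_csupp_mult_right c cont continuous_intros cc)+
    then show ?thesis
      using locally_integrable_mult[OF locally_integrable_continuous[OF cont(1)] c', of n]
        locally_integrable_mult[OF locally_integrable_continuous[OF cont(2)] c(1), of n j] by simp
  qed
  ultimately show ?thesis by (simp add: LIMSEQ_const_iff)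
qed

lemma weak_energy:
  assumes \<theta>: "cont_csupp \<theta>" "\<And>j. has_pd j \<theta> (\<theta>' j)" "\<And>j. continuous_on UNIV (\<theta>' j)"
      "\<And>j. has_pd j (\<theta>' j) (\<theta>'' j)" "\<And>j. continuous_on UNIV (\<theta>'' j)"
  shows "(\<Sum>j\<in>UNIV. LINT x|lborel. \<theta> x * (G j x * G j x)) + (LINT x|lborel. \<theta> x * (\<psi> x * g x))
    - 1 / 2 * (LINT x|lborel. (\<Sum>j\<in>UNIV. \<theta>'' j x) * (\<psi> x * \<psi> x)) = 0"
proof -
  have \<theta>'': "cont_csupp (\<lambda>x. \<Sum>j\<in>UNIV. \<theta>'' j x)"
    by (intro cont_csupp_sum cont_csupp_has_pd[OF cont_csupp_has_pd[OF \<theta>(1-3)] \<theta>(4,5)])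
  have "(\<lambda>n. (\<Sum>j\<in>UNIV. LINT x|lborel. \<theta> x * (U' n j x * U' n j x)) + (LINT x|lborel. \<theta> x * (U n x * (\<Sum>j\<in>UNIV. U'' n j j x)))
    - 1 / 2 * (LINT x|lborel. (\<Sum>j\<in>UNIV. \<theta>'' j x) * (U n x * U n x))) \<longlonglongrightarrow>
    (\<Sum>j\<in>UNIV. LINT x|lborel. \<theta> x * (G j x * G j x)) + (LINT x|lborel. \<theta> x * (\<psi> x * g x))
    - 1 / 2 * (LINT x|lborel. (\<Sum>j\<in>UNIV. \<theta>'' j x) * (\<psi> x * \<psi> x))"
    by (intro tendsto_add tendsto_diff tendsto_sum tendsto_mult tendsto_const L2loc_lim_prod lim \<theta> \<theta>'')
  then show ?thesis
    unfolding energy_identity[OF \<theta> cont(1) pd(1) cont(2) pd(2) cont(3)] LIMSEQ_const_iff by simp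
qed

lemma weak_virial:
  assumes b: "\<And>k. cont_csupp (b k)" "\<And>j k. has_pd j (b k) (b' j k)" "\<And>j k. continuous_on UNIV (b' j k)"
    and d: "d = (\<lambda>x. \<Sum>k\<in>UNIV. b' k k x)" "\<And>j. has_pd j d (d' j)" "\<And>j. continuous_on UNIV (d' j)"
  shows "2 * (\<Sum>j\<in>UNIV. \<Sum>k\<in>UNIV. LINT x|lborel. b' j k x * (G j x * G k x))
    + (\<Sum>j\<in>UNIV. LINT x|lborel. d' j x * (\<psi> x * G j x))
    + 2 * (\<Sum>k\<in>UNIV. LINT x|lborel. b k x * (G k x * g x))
    + (LINT x|lborel. d x * (\<psi> x * g x)) = 0"
proof -
  have b': "cont_csupp (b' j k)" for j k by (rule cont_csupp_has_pd[OF b])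
  have dcc: "cont_csupp d" unfolding d(1) by (intro cont_csupp_sum b')
  have d': "cont_csupp (d' j)" for j by (rule cont_csupp_has_pd[OF dcc d(2,3)])
  have "(\<lambda>n. 2 * (\<Sum>j\<in>UNIV. \<Sum>k\<in>UNIV. LINT x|lborel. b' j k x * (U' n j x * U' n k x))
    + (\<Sum>j\<in>UNIV. LINT x|lborel. d' j x * (U n x * U' n j x))
    + 2 * (\<Sum>k\<in>UNIV. LINT x|lborel. b k x * (U' n k x * (\<Sum>j\<in>UNIV. U'' n j j x)))
    + (LINT x|lborel. d x * (U n x * (\<Sum>j\<in>UNIV. U'' n j j x)))) \<longlonglongrightarrow>
    2 * (\<Sum>j\<in>UNIV. \<Sum>k\<in>UNIV. LINT x|lborel. b' j k x * (G j x * G k x))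
    + (\<Sum>j\<in>UNIV. LINT x|lborel. d' j x * (\<psi> x * G j x))
    + 2 * (\<Sum>k\<in>UNIV. LINT x|lborel. b k x * (G k x * g x))
    + (LINT x|lborel. d x * (\<psi> x * g x))"
    by (intro tendsto_add tendsto_sum tendsto_mult tendsto_const L2loc_lim_prod lim b b' dcc d')
  then show ?thesis
    using virial_identity_smooth[OF b d cont(1) pd(1) cont(2) pd(2) cont(3) sym] by (simp add: LIMSEQ_const_iff)
qed

end

subsection \<open>Existence and uniqueness of the weak gradient\<close>

text \<open>Reflected and translated mollifiers are test functions, so all mollifications of f
  vanish identically, while they converge to f in L^1 on balls.\<close>

lemma du_bois_reymond:
  fixes f :: "real^'n::finite \<Rightarrow> real"
  assumes f: "locally_integrable f" and 0: "\<And>\<phi>. test_function \<phi> \<Longrightarrow> (LINT x|lborel. f x * \<phi> x) = 0"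
  shows "AE x in lborel. f x = 0"
proof -
  have [measurable]: "f \<in> borel_measurable borel" using f by (simp add: locally_integrable_def)
  have conv0: "conv (mollifier n) f x = 0" for n x
    using 0[of "\<lambda>y. 1 * mollifier n (x + (-1) *\<^sub>R y)"] test_function_affine(2)[OF test_function_mollifier[of n], of "-1" 1 x]
    by (simp add: conv_def mult.commute)
  have "AE x in lborel. indicator (cball 0 (real r)) x * \<bar>f x\<bar> = 0" for r :: nat
  proof -
    have "(LINT x|lborel. indicator (cball 0 (real r)) x * \<bar>f x\<bar>) = 0"
      using mollifier_tendsto_L1[OF f, of "real r"] by (simp add: conv0 LIMSEQ_const_iff)
    moreover have "integrable lborel (\<lambda>x. indicator (cball 0 (real r)) x * \<bar>f x\<bar>)"
      using integrable_abs[OF locally_integrable_cball[OF f, of "real r"]] by (simp add: abs_mult)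
    ultimately show ?thesis by (subst (asm) integral_nonneg_eq_0_iff_AE) auto
  qed
  then have "AE x in lborel. \<forall>r::nat. indicator (cball 0 (real r)) x * \<bar>f x\<bar> = 0"
    by (simp only: AE_all_countable) blast
  then show ?thesis
  proof eventually_elim
    case (elim x)
    obtain r :: nat where "norm x \<le> real r" using real_arch_simple by blast
    then show ?case using elim[rule_format, of r] by simp
  qed
qed

lemma L2loc_mult_continuous:
  assumes f: "L2loc f" and c: "continuous_on UNIV c"
  shows "L2loc (\<lambda>x. c x * f x)"
  unfolding L2loc_def
proof (intro conjI allI)
  have [measurable]: "f \<in> borel_measurable borel" "c \<in> borel_measurable borel"
    using L2loc_measurable[OF f] borel_measurable_continuous_onI[OF c] by auto
  show "(\<lambda>x. c x * f x) \<in> borel_measurable borel" by measurable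
  fix r
  have "compact (c ` cball 0 r)"
    by (rule compact_continuous_image[OF continuous_on_subset[OF c]]) auto
  then obtain B where B: "\<And>y. y \<in> c ` cball 0 r \<Longrightarrow> norm y \<le> B"
    using compact_imp_bounded bounded_iff by metis
  have "integrable lborel (\<lambda>x. B\<^sup>2 * (indicator (cball 0 r) x * (f x)\<^sup>2))"
    by (intro integrable_mult_right L2loc_integrable[OF f])
  then show "integrable lborel (\<lambda>x. indicator (cball 0 r) x * (c x * f x)\<^sup>2)"
  proof (rule Bochner_Integration.integrable_bound)
    show "AE x in lborel. norm (indicator (cball 0 r) x * (c x * f x)\<^sup>2) \<le> norm (B\<^sup>2 * (indicator (cball 0 r) x * (f x)\<^sup>2))"
    proof (intro AE_I2)
      fix x
      show "norm (indicator (cball 0 r) x * (c x * f x)\<^sup>2) \<le> norm (B\<^sup>2 * (indicator (cball 0 r) x * (f x)\<^sup>2))"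
      proof (cases "x \<in> cball 0 r")
        case True
        then have "\<bar>c x\<bar> \<le> \<bar>B\<bar>" using B[of "c x"] by auto
        then have "(c x)\<^sup>2 \<le> B\<^sup>2" by (simp add: abs_le_square_iff)
        then show ?thesis using True by (simp add: power_mult_distrib mult_right_mono)
      qed simp
    qed
  qed measurable
qed

text \<open>On the compact ball, positivity of a dilated bump becomes a positive lower bound, which
  is as good as a plateau for estimating an integral over the ball by a weighted one.\<close>

lemma cball_weight:
  fixes r :: real
  obtains \<theta> :: "real^'n::finite \<Rightarrow> real" and \<kappa>
  where "test_function \<theta>" "\<And>x. \<theta> x \<ge> 0" "\<kappa> > 0" "\<And>x. norm x \<le> r \<Longrightarrow> \<theta> x \<ge> \<kappa>"
proof -
  define s where "s = 1 / (\<bar>r\<bar> + 1)"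
  have s: "s > 0" by (simp add: s_def add_nonneg_pos)
  define \<theta> :: "real^'n \<Rightarrow> real" where "\<theta> x = 1 * bump (0 + s *\<^sub>R x)" for x
  have t: "test_function \<theta>" unfolding \<theta>_def[abs_def]
    by (rule test_function_affine(2)[OF test_function_bump]) (use s in simp)
  have pos: "\<theta> x > 0" if "norm x \<le> \<bar>r\<bar>" for x
  proof -
    have "norm (s *\<^sub>R x) < 1" using that s unfolding s_def by (simp add: field_simps)
    then show ?thesis using bump_pos[of "s *\<^sub>R x"] by (simp add: \<theta>_def)
  qed
  have "continuous_on (cball 0 \<bar>r\<bar>) \<theta>" by (rule continuous_on_subset[OF test_function_continuous[OF t]]) simp
  then obtain x0 where x0: "x0 \<in> cball 0 \<bar>r\<bar>" "\<forall>y\<in>cball 0 \<bar>r\<bar>. \<theta> x0 \<le> \<theta> y"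
    using continuous_attains_inf[of "cball 0 \<bar>r\<bar>" \<theta>] by auto
  show ?thesis
  proof (rule that[OF t])
    show "\<theta> x \<ge> 0" for x by (simp add: \<theta>_def bump_nonneg)
    show "\<theta> x0 > 0" using pos x0(1) by simp
    show "\<theta> x0 \<le> \<theta> x" if "norm x \<le> r" for x using x0(2) that by auto
  qed
qed

lemma test_function_laplacian_bound:
  assumes "test_function \<theta>"
  obtains M where "M > 0" "\<And>x. \<bar>\<theta> x\<bar> \<le> M" "\<And>x. \<bar>\<Sum>j\<in>UNIV. partials [j, j] \<theta> x\<bar> \<le> M"
proof -
  have cc: "cont_csupp (partials [] \<theta>)" "cont_csupp (\<lambda>x. \<Sum>j\<in>UNIV. partials [j, j] \<theta> x)"
    by (intro cont_csupp_test[OF assms] cont_csupp_sum)+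
  obtain M1 where M1: "M1 > 0" "\<And>x. \<bar>\<theta> x\<bar> \<le> M1" using cont_csuppE[OF cc(1)] by (metis partials.simps(1))
  obtain M2 where M2: "\<And>x. \<bar>\<Sum>j\<in>UNIV. partials [j, j] \<theta> x\<bar> \<le> M2" using cont_csuppE[OF cc(2)] by metis
  show ?thesis
    by (rule that[of "max M1 M2"]) (use M1 in simp, rule max.coboundedI1[OF M1(2)], rule max.coboundedI2[OF M2])
qed

text \<open>A Caccioppoli-type estimate. The Laplacian of u is arbitrary, so it applies to
  differences of two approximations. With L for the Laplacian, the constant comes from the pointwise
  bound (M/2) u^2 + M (u^2 + L^2) \<le> 2M (u^2 + L^2).\<close>

lemma energy_bound:
  fixes u :: "real^'n::finite \<Rightarrow> real"
  assumes \<theta>: "test_function \<theta>" "\<And>x. \<theta> x \<ge> 0"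
    and M: "\<And>x. \<bar>\<theta> x\<bar> \<le> M" "\<And>x. \<bar>\<Sum>j\<in>UNIV. partials [j, j] \<theta> x\<bar> \<le> M"
    and r: "\<And>js x. norm x > r \<Longrightarrow> partials js \<theta> x = 0"
    and u: "continuous_on UNIV u" "\<And>j. has_pd j u (u' j)" "\<And>j. continuous_on UNIV (u' j)"
      "\<And>j. has_pd j (u' j) (u'' j)" "\<And>j. continuous_on UNIV (u'' j)"
  shows "(LINT x|lborel. \<theta> x * (u' j x * u' j x)) \<le>
    2 * M * ((LINT x|lborel. indicator (cball 0 r) x * (u x)\<^sup>2) + (LINT x|lborel. indicator (cball 0 r) x * (\<Sum>j\<in>UNIV. u'' j x)\<^sup>2))"
proof -
  define L where "L x = (\<Sum>j\<in>UNIV. u'' j x)" for x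
  have Lc: "continuous_on UNIV L" unfolding L_def[abs_def] by (intro continuous_intros u)
  define \<Theta> where "\<Theta> x = (\<Sum>j\<in>UNIV. partials [j, j] \<theta> x)" for x
  have M0: "M \<ge> 0" using M(1)[of 0] by linarith
  have \<theta>cc: "cont_csupp \<theta>" using cont_csupp_test[OF \<theta>(1), of "[]"] by simp
  have \<Theta>cc: "cont_csupp \<Theta>" unfolding \<Theta>_def[abs_def] by (intro cont_csupp_sum cont_csupp_test \<theta>)
  have E: "(\<Sum>j\<in>UNIV. LINT x|lborel. \<theta> x * (u' j x * u' j x)) + (LINT x|lborel. \<theta> x * (u x * L x))
    - 1 / 2 * (LINT x|lborel. \<Theta> x * (u x * u x)) = 0"
    unfolding L_def \<Theta>_def
    by (rule energy_identity[where \<theta>'="\<lambda>j. partials [j] \<theta>"])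
       (use \<theta>cc test_function_has_pd[OF \<theta>(1), of _ "[]"] test_function_has_pd[OF \<theta>(1), of _ "[_]"]
         test_function_partials_continuous[OF \<theta>(1), of "[_]"] test_function_partials_continuous[OF \<theta>(1), of "[_, _]"] u in auto)
  let ?I = "indicator (cball 0 r) :: _ \<Rightarrow> real"
  note i1 = L2loc_integrable[OF L2loc_continuous[OF u(1)], of r]
  note i2 = L2loc_integrable[OF L2loc_continuous[OF Lc], of r]
  have "(LINT x|lborel. \<theta> x * (u' j x * u' j x)) \<le> (\<Sum>j\<in>UNIV. LINT x|lborel. \<theta> x * (u' j x * u' j x))"
    using \<theta>(2) by (intro member_le_sum Bochner_Integration.integral_nonneg) auto
  also have "\<dots> = 1 / 2 * (LINT x|lborel. \<Theta> x * (u x * u x)) - (LINT x|lborel. \<theta> x * (u x * L x))"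
    using E by linarith
  also have "\<dots> = (LINT x|lborel. 1 / 2 * (\<Theta> x * (u x * u x)) - \<theta> x * (u x * L x))"
    by (subst Bochner_Integration.integral_diff[OF integrable_mult_right[OF cont_csupp_mult_integrable[OF \<Theta>cc u(1) u(1)]] cont_csupp_mult_integrable[OF \<theta>cc u(1) Lc]]) simp
  also have "\<dots> \<le> (LINT x|lborel. 2 * M * (?I x * (u x)\<^sup>2 + ?I x * (L x)\<^sup>2))"
  proof (rule integral_mono)
    fix x
    show "1 / 2 * (\<Theta> x * (u x * u x)) - \<theta> x * (u x * L x) \<le> 2 * M * (?I x * (u x)\<^sup>2 + ?I x * (L x)\<^sup>2)"
    proof (cases "norm x \<le> r")
      case True
      have "\<Theta> x * (u x * u x) \<le> M * (u x)\<^sup>2"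
        using M(2)[of x] unfolding \<Theta>_def power2_eq_square by (intro mult_right_mono) auto
      moreover have "- (\<theta> x * (u x * L x)) \<le> M * ((u x)\<^sup>2 + (L x)\<^sup>2)"
      proof -
        have "0 \<le> (\<bar>u x\<bar> - \<bar>L x\<bar>)\<^sup>2" by simp
        then have "2 * \<bar>u x * L x\<bar> \<le> (u x)\<^sup>2 + (L x)\<^sup>2" unfolding power2_diff by (simp add: abs_mult)
        then have "\<bar>u x * L x\<bar> \<le> (u x)\<^sup>2 + (L x)\<^sup>2" using abs_ge_zero[of "u x * L x"] by linarith
        then have "\<bar>\<theta> x\<bar> * \<bar>u x * L x\<bar> \<le> M * ((u x)\<^sup>2 + (L x)\<^sup>2)"
          by (intro mult_mono M M0) auto
        then show ?thesis unfolding abs_mult[symmetric] by linarith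
      qed
      moreover have "0 \<le> M * (u x)\<^sup>2" "0 \<le> M * (L x)\<^sup>2" using M0 by auto
      ultimately show ?thesis using True unfolding distrib_left by simp
    next
      case False
      then show ?thesis using r[of x "[]"] r[of x "[_, _]"] by (simp add: \<Theta>_def)
    qed
  qed (intro Bochner_Integration.integrable_diff integrable_mult_right cont_csupp_mult_integrable \<Theta>cc \<theta>cc u Lc Bochner_Integration.integrable_add i1 i2)+
  also have "\<dots> = 2 * M * ((LINT x|lborel. ?I x * (u x)\<^sup>2) + (LINT x|lborel. ?I x * (L x)\<^sup>2))"
    by (simp only: integral_mult_right_zero Bochner_Integration.integral_add[OF i1 i2])
  finally show ?thesis unfolding L_def .
qed

lemma L2loc_lim_imp_Cauchy:
  assumes F: "L2loc_lim F f" and e: "e > 0"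
  shows "\<exists>N. \<forall>n\<ge>N. \<forall>m\<ge>N. (LINT x|lborel. indicator (cball 0 r) x * (F n x - F m x)\<^sup>2) < e"
proof -
  define A where "A n = (LINT x|lborel. indicator (cball 0 r) x * (F n x - f x)\<^sup>2)" for n
  have "A \<longlonglongrightarrow> 0" using F by (simp add: L2loc_lim_def A_def[abs_def])
  then have "\<forall>\<^sub>F n in sequentially. A n < e / 4" using e by (intro order_tendstoD(2)) auto
  then obtain N where N: "\<And>n. n \<ge> N \<Longrightarrow> A n < e / 4" by (auto simp: eventually_sequentially)
  have L: "L2loc (F n)" "L2loc f" for n using F by (auto simp: L2loc_lim_def)
  have "(LINT x|lborel. indicator (cball 0 r) x * (F n x - F m x)\<^sup>2) < e" if "n \<ge> N" "m \<ge> N" for n m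
  proof -
    note i = L2loc_integrable[OF L2loc_diff[OF L], of r]
    have "(LINT x|lborel. indicator (cball 0 r) x * (F n x - F m x)\<^sup>2) \<le>
      (LINT x|lborel. 2 * (indicator (cball 0 r) x * (F n x - f x)\<^sup>2) + 2 * (indicator (cball 0 r) x * (F m x - f x)\<^sup>2))"
    proof (rule integral_mono)
      fix x
      show "indicator (cball 0 r) x * (F n x - F m x)\<^sup>2 \<le> 2 * (indicator (cball 0 r) x * (F n x - f x)\<^sup>2) + 2 * (indicator (cball 0 r) x * (F m x - f x)\<^sup>2)"
        using square_diff_le[of "F n x - f x" "F m x - f x"] by (auto simp: indicator_def)
    qed (intro Bochner_Integration.integrable_add integrable_mult_right i L2loc_integrable[OF L2loc_diff[OF L(1) L(1)]])+
    also have "\<dots> = 2 * A n + 2 * A m"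
      unfolding A_def by (simp add: Bochner_Integration.integral_add[OF integrable_mult_right[OF i] integrable_mult_right[OF i]])
    also have "\<dots> < e" using N[OF that(1)] N[OF that(2)] by linarith
    finally show ?thesis .
  qed
  then show ?thesis by blast
qed

text \<open>Testing the weak equation with reflected mollifiers shows that the Laplacian of the
  mollified \<psi> is the mollified g. \<open>energy_bound\<close>, applied to differences of
  approximations, then makes the gradients Cauchy on balls, and completeness yields G.\<close>

lemma grad_approx_exists:
  fixes \<psi> g :: "real^'n::finite \<Rightarrow> real"
  assumes \<psi>: "L2loc \<psi>" and g: "L2loc g"
    and weak: "\<And>\<phi>. test_function \<phi> \<Longrightarrow> (LINT x|lborel. \<psi> x * laplacian \<phi> x) = (LINT x|lborel. g x * \<phi> x)"
  shows "\<exists>G U U' U''. grad_approx \<psi> g G U U' U''"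
proof -
  note \<psi>l = L2loc_locally_integrable[OF \<psi>]
  define U where "U n = conv (mollifier n) \<psi>" for n
  define U' where "U' n j = partials [j] (U n)" for n j
  define U'' where "U'' n j k = partials [j, k] (U n)" for n j k
  note P = partials_conv[OF test_function_mollifier \<psi>l, folded U_def]
  have cont: "continuous_on UNIV (U n)" "continuous_on UNIV (U' n j)" "continuous_on UNIV (U'' n j k)" for n j k
    using P(3)[of "[]" n] P(3)[of "[j]" n] P(3)[of "[j, k]" n] by (auto simp: U'_def U''_def)
  have pd: "has_pd j (U n) (U' n j)" "has_pd j (U' n k) (U'' n j k)" for n j k
    using P(2)[of j "[]" n] P(2)[of j "[k]" n] by (auto simp: U'_def U''_def)
  have sym: "U'' n j k = U'' n k j" for n j k
    unfolding U''_def P(1) by (simp add: mollifier_partial_commute[of j k])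
  have lap: "(\<Sum>j\<in>UNIV. U'' n j j x) = conv (mollifier n) g x" for n x
  proof -
    let ?\<phi> = "\<lambda>y. mollifier n (x + (-1) *\<^sub>R y)"
    have t: "test_function ?\<phi>" using test_function_affine(2)[OF test_function_mollifier[of n], of "-1" 1 x] by simp
    \<comment> \<open>Two derivatives of the reflected mollifier bring two minus signs, which
      cancel.\<close>
    have d: "partial j (partial j ?\<phi>) y = partials [j, j] (mollifier n) (x - y)" for j y
      using partials_affine[OF test_function_mollifier[of n], of "-1" "[j, j]" x] by simp
    have "(\<Sum>j\<in>UNIV. U'' n j j x) = (\<Sum>j\<in>UNIV. LINT y|lborel. partials [j, j] (mollifier n) (x - y) * \<psi> y)"
      unfolding U''_def P(1) conv_def ..
    also have "\<dots> = (LINT y|lborel. (\<Sum>j\<in>UNIV. partials [j, j] (mollifier n) (x - y) * \<psi> y))"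
      by (rule Bochner_Integration.integral_sum[symmetric])
         (rule conv_integrable[OF cont_csupp_test[OF test_function_mollifier] \<psi>l])
    also have "\<dots> = (LINT y|lborel. \<psi> y * laplacian ?\<phi> y)"
      unfolding laplacian_def d by (simp add: sum_distrib_left mult.commute)
    also have "\<dots> = (LINT y|lborel. g y * ?\<phi> y)" by (rule weak[OF t])
    finally show ?thesis by (simp add: conv_def mult.commute)
  qed
  have limU: "L2loc_lim U \<psi>" unfolding U_def[abs_def] by (rule L2loc_lim_mollifier[OF \<psi>])
  have limL: "L2loc_lim (\<lambda>n x. \<Sum>j\<in>UNIV. U'' n j j x) g" unfolding lap by (rule L2loc_lim_mollifier[OF g])
  have "\<exists>f. L2loc_lim (\<lambda>n. U' n j) f" for j
  proof (rule L2loc_complete)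
    show "L2loc (U' n j)" for n by (rule L2loc_continuous[OF cont(2)])
    fix r e :: real assume e: "e > 0"
    obtain \<theta> :: "real^'n \<Rightarrow> real" and \<kappa> where \<theta>: "test_function \<theta>" "\<And>x. \<theta> x \<ge> 0" "\<kappa> > 0" "\<And>x. norm x \<le> r \<Longrightarrow> \<theta> x \<ge> \<kappa>"
      by (rule cball_weight[where 'n='n, of r]) (rule that)
    obtain s where s: "\<And>js x. norm x > s \<Longrightarrow> partials js \<theta> x = 0" using test_function_support[OF \<theta>(1)] by metis
    have cc: "cont_csupp \<theta>" using cont_csupp_test[OF \<theta>(1), of "[]"] by simp
    obtain M where M: "M > 0" "\<And>x. \<bar>\<theta> x\<bar> \<le> M" "\<And>x. \<bar>\<Sum>j\<in>UNIV. partials [j, j] \<theta> x\<bar> \<le> M"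
      using test_function_laplacian_bound[OF \<theta>(1)] by metis
    \<comment> \<open>Chosen so that 2M (e' + e') = \<kappa> e.\<close>
    define e' where "e' = \<kappa> * e / (4 * M)"
    have e': "e' > 0" using \<theta>(3) M(1) e by (simp add: e'_def)
    obtain N1 where N1: "\<And>n m. n \<ge> N1 \<Longrightarrow> m \<ge> N1 \<Longrightarrow> (LINT x|lborel. indicator (cball 0 s) x * (U n x - U m x)\<^sup>2) < e'"
      using L2loc_lim_imp_Cauchy[OF limU e', of s] by blast
    obtain N2 where N2: "\<And>n m. n \<ge> N2 \<Longrightarrow> m \<ge> N2 \<Longrightarrow>
        (LINT x|lborel. indicator (cball 0 s) x * ((\<Sum>j\<in>UNIV. U'' n j j x) - (\<Sum>j\<in>UNIV. U'' m j j x))\<^sup>2) < e'"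
      using L2loc_lim_imp_Cauchy[OF limL e', of s] by blast
    have "(LINT x|lborel. indicator (cball 0 r) x * (U' n j x - U' m j x)\<^sup>2) < e" if nm: "n \<ge> max N1 N2" "m \<ge> max N1 N2" for n m
    proof -
      have cw: "continuous_on UNIV (\<lambda>x. U' n j x - U' m j x)" by (intro continuous_intros cont)
      have "\<kappa> * (LINT x|lborel. indicator (cball 0 r) x * (U' n j x - U' m j x)\<^sup>2) =
          (LINT x|lborel. \<kappa> * (indicator (cball 0 r) x * (U' n j x - U' m j x)\<^sup>2))" by simp
      also have "\<dots> \<le> (LINT x|lborel. \<theta> x * ((U' n j x - U' m j x) * (U' n j x - U' m j x)))"
      proof (rule integral_mono)
        show "integrable lborel (\<lambda>x. \<kappa> * (indicator (cball 0 r) x * (U' n j x - U' m j x)\<^sup>2))"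
          by (intro integrable_mult_right L2loc_integrable[OF L2loc_continuous[OF cw]])
        show "integrable lborel (\<lambda>x. \<theta> x * ((U' n j x - U' m j x) * (U' n j x - U' m j x)))"
          by (rule cont_csupp_mult_integrable[OF cc cw cw])
        fix x
        show "\<kappa> * (indicator (cball 0 r) x * (U' n j x - U' m j x)\<^sup>2) \<le> \<theta> x * ((U' n j x - U' m j x) * (U' n j x - U' m j x))"
          using \<theta>(2)[of x] \<theta>(4)[of x] by (cases "norm x \<le> r") (auto simp: power2_eq_square intro: mult_right_mono)
      qed
      also have "\<dots> \<le> 2 * M * ((LINT x|lborel. indicator (cball 0 s) x * (U n x - U m x)\<^sup>2) +
         (LINT x|lborel. indicator (cball 0 s) x * (\<Sum>j\<in>UNIV. U'' n j j x - U'' m j j x)\<^sup>2))"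
        by (rule energy_bound[OF \<theta>(1,2) M(2,3) s, where u'="\<lambda>j x. U' n j x - U' m j x"])
           (assumption | intro continuous_intros has_pd_diff cont pd)+
      also have "\<dots> < 2 * M * (e' + e')"
        using N1[of n m] N2[of n m] nm M(1) by (intro mult_strict_left_mono add_strict_mono) (auto simp: sum_subtractf)
      also have "\<dots> = \<kappa> * e" using M(1) by (simp add: e'_def)
      finally show ?thesis using \<theta>(3) by simp
    qed
    then show "\<exists>N. \<forall>n\<ge>N. \<forall>m\<ge>N. (LINT x|lborel. indicator (cball 0 r) x * (U' n j x - U' m j x)\<^sup>2) < e" by blast
  qed
  then obtain G where "\<And>j. L2loc_lim (\<lambda>n. U' n j) (G j)" by metis
  then have "grad_approx \<psi> g G U U' U''"
    by unfold_locales (use pd cont sym limU limL in auto)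
  then show ?thesis by blast
qed

lemma (in grad_approx) weak_partial_limit: "weak_partial j \<psi> (G j)"
  unfolding weak_partial_def
proof (intro conjI allI impI L2loc_locally_integrable L2loc_limits)
  fix \<phi> :: "real^'n \<Rightarrow> real" assume t: "test_function \<phi>"
  have "(LINT x|lborel. \<phi> x * G j x) + (LINT x|lborel. partial j \<phi> x * \<psi> x) = 0"
    using weak_ibp[of \<phi> j "partial j \<phi>"] cont_csupp_test[OF t, of "[]"] test_function_has_pd[OF t, of j "[]"]
      test_function_partials_continuous[OF t, of "[j]"] by simp
  then show "(LINT x|lborel. \<psi> x * partial j \<phi> x) = - (LINT x|lborel. G j x * \<phi> x)"
    by (simp add: mult.commute)
qed

lemma weak_partial_unique:
  assumes "weak_partial j f g1" "weak_partial j f g2"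
  shows "AE x in lborel. g1 x = g2 x"
proof -
  have l: "locally_integrable g1" "locally_integrable g2" using assms by (auto simp: weak_partial_def)
  have "locally_integrable (\<lambda>x. g1 x - g2 x)"
  proof (rule locally_integrableI)
    show "(\<lambda>x. g1 x - g2 x) \<in> borel_measurable borel" using l by (auto simp: locally_integrable_def)
    show "integrable lborel (\<lambda>x. indicator (cball 0 r) x * (g1 x - g2 x))" for r
      using l[THEN locally_integrable_cball] unfolding right_diff_distrib by (intro Bochner_Integration.integrable_diff)
  qed
  then have "AE x in lborel. g1 x - g2 x = 0"
  proof (rule du_bois_reymond)
    fix \<phi> :: "real^'a \<Rightarrow> real" assume t: "test_function \<phi>"
    have cc: "cont_csupp \<phi>" using cont_csupp_test[OF t, of "[]"] by simp
    have "(LINT x|lborel. (g1 x - g2 x) * \<phi> x) = (LINT x|lborel. g1 x * \<phi> x) - (LINT x|lborel. g2 x * \<phi> x)"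
      using locally_integrable_mult[OF l(1) cc] locally_integrable_mult[OF l(2) cc] 
      by (simp add: left_diff_distrib mult.commute[of "\<phi> _"])
    then show "(LINT x|lborel. (g1 x - g2 x) * \<phi> x) = 0"
      using assms t unfolding weak_partial_def by simp
  qed
  then show ?thesis by simp
qed

text \<open>Carries the convergence of the gradients from the constructed limit to an arbitrary weak
  gradient, which agrees with it only almost everywhere.\<close>

lemma L2loc_lim_cong_AE:
  assumes F: "L2loc_lim F f" and ae: "AE x in lborel. f' x = f x" and m: "f' \<in> borel_measurable borel"
  shows "L2loc_lim F f'"
proof -
  have [measurable]: "f' \<in> borel_measurable borel" "f \<in> borel_measurable borel" "F n \<in> borel_measurable borel" for n
    using F m by (auto simp: L2loc_lim_def L2loc_def)
  have "integrable lborel (\<lambda>x. indicator (cball 0 r) x * (f' x)\<^sup>2)" for r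
  proof -
    have "integrable lborel (\<lambda>x. indicator (cball 0 r) x * (f x)\<^sup>2)"
      using F by (auto simp: L2loc_lim_def intro: L2loc_integrable)
    then show ?thesis
      by (rule integrable_cong_AE_imp) (use ae in auto)
  qed
  moreover have "(LINT x|lborel. indicator (cball 0 r) x * (F n x - f' x)\<^sup>2) = (LINT x|lborel. indicator (cball 0 r) x * (F n x - f x)\<^sup>2)" for r n
    by (rule integral_cong_AE) (use ae in auto)
  ultimately show ?thesis using F m unfolding L2loc_lim_def L2loc_def by simp
qed

section \<open>Square integrability of the gradient on the whole space\<close>

text \<open>Where q is positive its term has a favourable sign, so only the lower bound -C has to be
  absorbed by \<psi>^2. Dilated bumps give a bound uniform in n, and Fatou's lemma lets them expand
  over the whole space.\<close>

lemma (in grad_approx) grad_square_integrable: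
  assumes \<psi>2: "integrable lborel (\<lambda>x. (\<psi> x)\<^sup>2)"
    and g: "\<And>x. g x = q x * \<psi> x" and q: "\<And>x. - C \<le> q x" "C \<ge> 0"
  shows "integrable lborel (\<lambda>x. (G j x)\<^sup>2)"
proof -
  have [measurable]: "G j \<in> borel_measurable borel" by (rule L2loc_measurable[OF L2loc_limits(2)])
  let ?B = "bump :: real^'n \<Rightarrow> real"
  note tb = test_function_bump[where 'n='n]
  have cc: "cont_csupp ?B" using cont_csupp_test[OF tb, of "[]"] by simp
  obtain M where M: "M > 0" "\<And>x. \<bar>?B x\<bar> \<le> M" "\<And>x. \<bar>\<Sum>j\<in>UNIV. partials [j, j] ?B x\<bar> \<le> M"
    using test_function_laplacian_bound[OF tb] by metis
  define \<theta> where "\<theta> n x = ?B (0 + (1 / real (Suc n)) *\<^sub>R x)" for n x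
  have \<theta>m[measurable]: "\<theta> n \<in> borel_measurable borel" for n
    unfolding \<theta>_def[abs_def] using cont_csupp_measurable[OF cc] by measurable
  have t: "test_function (\<theta> n)" for n
    using test_function_affine(2)[OF tb, of "1 / real (Suc n)" 1 0] by (simp add: \<theta>_def[abs_def])
  have \<theta>cc: "cont_csupp (\<theta> n)" for n using cont_csupp_test[OF t, of "[]"] by simp
  have \<theta>b: "0 \<le> \<theta> n x" "\<theta> n x \<le> M" for n x
    using M(2)[of "(1 / real (Suc n)) *\<^sub>R x"] bump_nonneg[of "(1 / real (Suc n)) *\<^sub>R x"] by (auto simp: \<theta>_def)
  have lap: "\<bar>\<Sum>j\<in>UNIV. partials [j, j] (\<theta> n) x\<bar> \<le> M" for n x
  proof -
    \<comment> \<open>Dilation by s \<le> 1 multiplies the Laplacian by s^2 \<le> 1, so one M serves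
      every n.\<close>
    define s where "s = 1 / real (Suc n)"
    have s: "s \<noteq> 0" "s\<^sup>2 \<le> 1" by (auto simp: s_def power_le_one)
    have "partials [j, j] (\<theta> n) x = s\<^sup>2 * partials [j, j] ?B (s *\<^sub>R x)" for j
      unfolding \<theta>_def[abs_def] s_def[symmetric] partials_affine[OF tb s(1)] by (simp add: power2_eq_square)
    then have "\<bar>\<Sum>j\<in>UNIV. partials [j, j] (\<theta> n) x\<bar> = s\<^sup>2 * \<bar>\<Sum>j\<in>UNIV. partials [j, j] ?B (s *\<^sub>R x)\<bar>"
      by (simp add: sum_distrib_left[symmetric] abs_mult)
    also have "\<dots> \<le> 1 * M" by (intro mult_mono s M) auto
    finally show ?thesis by simp
  qed
  define K where "K = (M * C + M) * (LINT x|lborel. (\<psi> x)\<^sup>2)"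
  have int_le: "(LINT x|lborel. \<theta> n x * (G j x * G j x)) \<le> K" for n
  proof -
    let ?T = "\<lambda>x. \<Sum>j\<in>UNIV. partials [j, j] (\<theta> n) x"
    have Tcc: "cont_csupp ?T" by (intro cont_csupp_sum cont_csupp_test t)
    note i1 = L2loc_mult_integrable[OF \<theta>cc[of n] L2loc_limits(1) L2loc_limits(3)]
    note i2 = L2loc_mult_integrable[OF Tcc L2loc_limits(1) L2loc_limits(1)]
    have E: "(\<Sum>j\<in>UNIV. LINT x|lborel. \<theta> n x * (G j x * G j x)) + (LINT x|lborel. \<theta> n x * (\<psi> x * g x))
        - 1 / 2 * (LINT x|lborel. ?T x * (\<psi> x * \<psi> x)) = 0"
      by (rule weak_energy[where \<theta>'="\<lambda>j. partials [j] (\<theta> n)"])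
         (use \<theta>cc test_function_has_pd[OF t, of _ "[]" n] test_function_has_pd[OF t, of _ "[_]"]
           test_function_partials_continuous[OF t, of "[_]"] test_function_partials_continuous[OF t, of "[_, _]"] in auto)
    have "(LINT x|lborel. \<theta> n x * (G j x * G j x)) \<le> (\<Sum>j\<in>UNIV. LINT x|lborel. \<theta> n x * (G j x * G j x))"
      using \<theta>b(1) by (intro member_le_sum Bochner_Integration.integral_nonneg) auto
    also have "\<dots> = 1 / 2 * (LINT x|lborel. ?T x * (\<psi> x * \<psi> x)) - (LINT x|lborel. \<theta> n x * (\<psi> x * g x))"
      using E by linarith
    also have "\<dots> = (LINT x|lborel. 1 / 2 * (?T x * (\<psi> x * \<psi> x)) - \<theta> n x * (\<psi> x * g x))"
      by (subst Bochner_Integration.integral_diff[OF integrable_mult_right[OF i2] i1]) simp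
    also have "\<dots> \<le> (LINT x|lborel. (M * C + M) * (\<psi> x)\<^sup>2)"
    proof (rule integral_mono)
      fix x
      have "?T x * (\<psi> x * \<psi> x) \<le> M * (\<psi> x * \<psi> x)"
        using lap[of n x] by (intro mult_right_mono) auto
      moreover have "- \<theta> n x * q x \<le> M * C"
      proof -
        have "\<theta> n x * (- q x) \<le> \<theta> n x * C" using q(1)[of x] \<theta>b by (intro mult_left_mono) auto
        also have "\<dots> \<le> M * C" using \<theta>b q by (intro mult_right_mono) auto
        finally show ?thesis by simp
      qed
      then have "- \<theta> n x * q x * (\<psi> x * \<psi> x) \<le> M * C * (\<psi> x * \<psi> x)" by (rule mult_right_mono) simp
      moreover have "0 \<le> M * (\<psi> x * \<psi> x)" using M(1) by simp
      moreover have "\<theta> n x * (\<psi> x * g x) = - (- \<theta> n x * q x * (\<psi> x * \<psi> x))" by (simp add: g)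
      moreover have "(M * C + M) * (\<psi> x)\<^sup>2 = M * C * (\<psi> x * \<psi> x) + M * (\<psi> x * \<psi> x)"
        by (simp add: power2_eq_square algebra_simps)
      ultimately show "1 / 2 * (?T x * (\<psi> x * \<psi> x)) - \<theta> n x * (\<psi> x * g x) \<le> (M * C + M) * (\<psi> x)\<^sup>2" by linarith
    qed (intro Bochner_Integration.integrable_diff integrable_mult_right i1 i2 \<psi>2)+
    also have "\<dots> = K" by (simp add: K_def)
    finally show ?thesis .
  qed
  \<comment> \<open>The expanding weights tend pointwise to \<open>bump 0\<close> rather than to 1;
    this positive constant is divided out at the end.\<close>
  have "(\<integral>\<^sup>+x. ennreal (?B 0 * (G j x)\<^sup>2) \<partial>lborel) \<le> (\<integral>\<^sup>+x. liminf (\<lambda>n. ennreal (\<theta> n x * (G j x * G j x))) \<partial>lborel)"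
  proof (rule nn_integral_mono)
    fix x :: "real^'n"
    have "(\<lambda>n. (1 / real (Suc n)) *\<^sub>R x) \<longlonglongrightarrow> 0 *\<^sub>R x"
      by (intro tendsto_intros LIMSEQ_Suc[OF lim_1_over_n])
    then have "(\<lambda>n. \<theta> n x) \<longlonglongrightarrow> ?B 0"
      using continuous_on_tendsto_compose[OF test_function_continuous[OF tb]] by (simp add: \<theta>_def)
    then have "(\<lambda>n. ennreal (\<theta> n x * (G j x * G j x))) \<longlonglongrightarrow> ennreal (?B 0 * (G j x * G j x))"
      by (intro tendsto_ennrealI tendsto_intros)
    then show "ennreal (?B 0 * (G j x)\<^sup>2) \<le> liminf (\<lambda>n. ennreal (\<theta> n x * (G j x * G j x)))"
      by (simp add: lim_imp_Liminf power2_eq_square)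
  qed
  also have "\<dots> \<le> liminf (\<lambda>n. \<integral>\<^sup>+x. ennreal (\<theta> n x * (G j x * G j x)) \<partial>lborel)"
    by (rule nn_integral_liminf) measurable
  also have "\<dots> \<le> ennreal K"
  proof (rule Liminf_le)
    have "(\<integral>\<^sup>+x. ennreal (\<theta> n x * (G j x * G j x)) \<partial>lborel) \<le> ennreal K" for n
      by (subst nn_integral_eq_integral[OF L2loc_mult_integrable[OF \<theta>cc L2loc_limits(2) L2loc_limits(2)]])
         (use int_le \<theta>b in \<open>auto intro: ennreal_leI\<close>)
    then show "\<forall>\<^sub>F n in sequentially. (\<integral>\<^sup>+x. ennreal (\<theta> n x * (G j x * G j x)) \<partial>lborel) \<le> ennreal K" by simp
  qed simp
  finally have "(\<integral>\<^sup>+x. ennreal (?B 0 * (G j x)\<^sup>2) \<partial>lborel) < \<infinity>"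
    by (rule order.strict_trans1) simp
  then have "integrable lborel (\<lambda>x. ?B 0 * (G j x)\<^sup>2)"
    by (intro integrableI_nonneg) (auto simp: bump_nonneg)
  moreover have "?B 0 \<noteq> 0" using bump_pos[of "0::real^'n"] by simp
  ultimately show ?thesis by simp
qed

subsection \<open>Cutoff errors\<close>

text \<open>The bound starts at R = 1, from where on all powers (1/R)^m with m \<ge> 1 are at most
  1/R; thus first and second derivatives of the cutoff are treated alike.\<close>

definition vanishing :: "(real \<Rightarrow> real^'n::finite \<Rightarrow> real) \<Rightarrow> bool" where
  "vanishing c \<longleftrightarrow> (\<forall>R. c R \<in> borel_measurable borel) \<and> (\<exists>K\<ge>0. \<forall>R\<ge>1. \<forall>x. \<bar>c R x\<bar> \<le> K / R)"

lemma vanishing_add: "vanishing c \<Longrightarrow> vanishing c' \<Longrightarrow> vanishing (\<lambda>R x. c R x + c' R x)"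
proof -
  assume c: "vanishing c" and c': "vanishing c'"
  obtain K K' where K: "K \<ge> 0" "K' \<ge> 0" "\<And>R x. R \<ge> 1 \<Longrightarrow> \<bar>c R x\<bar> \<le> K / R" "\<And>R x. R \<ge> 1 \<Longrightarrow> \<bar>c' R x\<bar> \<le> K' / R"
    using c c' unfolding vanishing_def by metis
  have "\<bar>c R x + c' R x\<bar> \<le> (K + K') / R" if "R \<ge> 1" for R x
    using K(3)[OF that, of x] K(4)[OF that, of x] by (simp add: add_divide_distrib)
  then show ?thesis using c c' K(1,2) unfolding vanishing_def
    by (intro conjI allI exI[of _ "K + K'"]) (auto intro: borel_measurable_add)
qed

lemma vanishing_sum:
  "finite I \<Longrightarrow> (\<And>i. i \<in> I \<Longrightarrow> vanishing (c i)) \<Longrightarrow> vanishing (\<lambda>R x. \<Sum>i\<in>I. c i R x)"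
proof (induction I rule: finite_induct)
  case empty
  then show ?case by (auto simp: vanishing_def intro!: exI[of _ 0])
next
  case (insert i I)
  then show ?case by (simp add: vanishing_add)
qed

lemma vanishing_mult:
  assumes c: "vanishing c" and f: "f \<in> borel_measurable borel" "bounded (range f)"
  shows "vanishing (\<lambda>R x. c R x * f x)"
proof -
  obtain K where K: "K \<ge> 0" "\<And>R x. R \<ge> 1 \<Longrightarrow> \<bar>c R x\<bar> \<le> K / R"
    using c unfolding vanishing_def by metis
  obtain B where B: "B > 0" "\<And>x. \<bar>f x\<bar> \<le> B" using f(2) unfolding bounded_pos by auto
  have "\<bar>c R x * f x\<bar> \<le> (K * B) / R" if "R \<ge> 1" for R x
    using mult_mono[OF K(2)[OF that, of x] B(2)[of x]] K(1) that by (simp add: abs_mult)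
  moreover have "K * B \<ge> 0" using K(1) B(1) by simp
  ultimately show ?thesis using c f(1) unfolding vanishing_def 
    by (intro conjI allI exI[of _ "K * B"]) (auto intro: borel_measurable_times)
qed

lemma vanishing_cutoff:
  assumes \<eta>: "test_function \<eta>" and js: "js \<noteq> []"
  shows "vanishing (\<lambda>R x. (1 / R) ^ length js * partials js \<eta> ((1 / R) *\<^sub>R x))"
proof -
  obtain M where M: "M > 0" "\<And>x. \<bar>partials js \<eta> x\<bar> \<le> M" using cont_csuppE[OF cont_csupp_test[OF \<eta>]] by metis
  have [measurable]: "partials js \<eta> \<in> borel_measurable borel" by (rule cont_csupp_measurable[OF cont_csupp_test[OF \<eta>]])
  have "\<bar>(1 / R) ^ length js * partials js \<eta> ((1 / R) *\<^sub>R x)\<bar> \<le> M / R" if R: "R \<ge> 1" for R x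
  proof -
    have "(1 / R) ^ length js \<le> (1 / R) ^ 1"
      using R js by (intro power_decreasing) (auto simp: Suc_le_eq)
    then have "\<bar>(1 / R) ^ length js\<bar> * \<bar>partials js \<eta> ((1 / R) *\<^sub>R x)\<bar> \<le> (1 / R) * M"
      using R by (intro mult_mono M) auto
    then show ?thesis by (simp add: abs_mult)
  qed
  then show ?thesis unfolding vanishing_def using M(1) by (intro conjI allI exI[of _ M]) auto
qed

text \<open>A product of two square integrable functions is integrable, so a coefficient that is
  uniformly O(1/R) sends the integral to 0.\<close>

lemma vanishing_integral:
  fixes c :: "real \<Rightarrow> real^'n::finite \<Rightarrow> real"
  assumes c: "vanishing c" and m[measurable]: "f \<in> borel_measurable borel" "g \<in> borel_measurable borel"
    and i: "integrable lborel (\<lambda>x. (f x)\<^sup>2)" "integrable lborel (\<lambda>x. (g x)\<^sup>2)"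
  shows "((\<lambda>R. LINT x|lborel. c R x * (f x * g x)) \<longlongrightarrow> 0) at_top"
proof -
  obtain K where K: "K \<ge> 0" "\<And>R x. R \<ge> 1 \<Longrightarrow> \<bar>c R x\<bar> \<le> K / R"
    using c unfolding vanishing_def by metis
  have [measurable]: "c R \<in> borel_measurable borel" for R using c by (simp add: vanishing_def)
  define S where "S = (LINT x|lborel. (f x)\<^sup>2 + (g x)\<^sup>2)"
  have "((\<lambda>R. K * S / R) \<longlongrightarrow> 0) at_top"
    by (intro tendsto_divide_0[OF tendsto_const] filterlim_at_top_imp_at_infinity filterlim_ident)
  moreover have "\<forall>\<^sub>F R in at_top. norm (LINT x|lborel. c R x * (f x * g x)) \<le> K * S / R"
    using eventually_ge_at_top[of 1]
  proof eventually_elim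
    case (elim R)
    have bi: "integrable lborel (\<lambda>x. K / R * ((f x)\<^sup>2 + (g x)\<^sup>2))" using i by (intro integrable_mult_right Bochner_Integration.integrable_add)
    have le: "norm (c R x * (f x * g x)) \<le> K / R * ((f x)\<^sup>2 + (g x)\<^sup>2)" for x
    proof -
      have "0 \<le> (\<bar>f x\<bar> - \<bar>g x\<bar>)\<^sup>2" by simp
      then have "2 * \<bar>f x * g x\<bar> \<le> (f x)\<^sup>2 + (g x)\<^sup>2" unfolding power2_diff by (simp add: abs_mult)
      then have "\<bar>f x * g x\<bar> \<le> (f x)\<^sup>2 + (g x)\<^sup>2" using abs_ge_zero[of "f x * g x"] by linarith
      then have "\<bar>c R x\<bar> * \<bar>f x * g x\<bar> \<le> K / R * ((f x)\<^sup>2 + (g x)\<^sup>2)"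
        using K elim by (intro mult_mono) auto
      then show ?thesis by (simp add: abs_mult)
    qed
    have ci: "integrable lborel (\<lambda>x. c R x * (f x * g x))"
    proof (rule Bochner_Integration.integrable_bound[OF bi])
      show "AE x in lborel. norm (c R x * (f x * g x)) \<le> norm (K / R * ((f x)\<^sup>2 + (g x)\<^sup>2))"
        by (rule AE_I2) (use le abs_ge_self order_trans in \<open>fastforce simp del: norm_mult\<close>)
    qed measurable
    have "norm (LINT x|lborel. c R x * (f x * g x)) \<le> (LINT x|lborel. K / R * ((f x)\<^sup>2 + (g x)\<^sup>2))"
      by (rule Bochner_Integration.integral_norm_bound_integral[OF ci bi]) (rule le)
    also have "\<dots> = K / R * S" by (simp only: S_def integral_mult_right_zero)
    finally show ?case by simp
  qed
  ultimately show ?thesis by (rule Lim_null_comparison[rotated])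
qed

section \<open>The virial identity under a cutoff\<close>

text \<open>The order of differentiation is the one in which the derivatives of the divergence of
  grad a arise below, so the two expressions match literally.\<close>

lemma laplacian_laplacian:
  assumes "C_k 4 a"
  shows "laplacian (laplacian a) = (\<lambda>x. \<Sum>j\<in>UNIV. \<Sum>k\<in>UNIV. partials [j, j, k, k] a x)"
proof -
  have 0: "laplacian a = (\<lambda>x. \<Sum>k\<in>UNIV. partials [k, k] a x)" by (auto simp: laplacian_def)
  have 1: "partial j (\<lambda>x. \<Sum>k\<in>UNIV. partials [k, k] a x) = (\<lambda>x. \<Sum>k\<in>UNIV. partials [j, k, k] a x)" for j
    by (intro has_pd_partial has_pd_sum C_k_has_pd[OF assms]) simp
  have 2: "partial j (\<lambda>x. \<Sum>k\<in>UNIV. partials [j, k, k] a x) = (\<lambda>x. \<Sum>k\<in>UNIV. partials [j, j, k, k] a x)" for j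
    by (intro has_pd_partial has_pd_sum C_k_has_pd[OF assms]) simp
  show ?thesis unfolding 0 by (simp only: laplacian_def[of "\<lambda>x. \<Sum>k\<in>UNIV. partials [k, k] a x", abs_def] 1 2)
qed

text \<open>The identity \<open>weak_virial\<close> for \<open>b = \<xi> \<nabla>a\<close>; every term on the right carries a derivative of \<open>\<xi>\<close>.\<close>
lemma (in grad_approx) virial_cutoff:
  assumes h: "h > 0" and v: "C_k 1 v" and a: "C_k 4 a" and \<xi>: "test_function \<xi>"
    and g: "\<And>x. g x = (v x - \<mu>) / h\<^sup>2 * \<psi> x"
  shows "integrable lborel (\<lambda>x. \<xi> x * virial_integrand h v a \<psi> G x)"
    and "(LINT x|lborel. \<xi> x * virial_integrand h v a \<psi> G x) =
      - 4 * h\<^sup>2 * (\<Sum>j\<in>UNIV. \<Sum>k\<in>UNIV. LINT x|lborel. (partials [j] \<xi> x * partials [k] a x) * (G j x * G k x))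
      + h\<^sup>2 * (\<Sum>j\<in>UNIV. LINT x|lborel. (partials [j] \<xi> x * (\<Sum>k\<in>UNIV. partials [j, k, k] a x)) * (\<psi> x * \<psi> x))
      - 2 * h\<^sup>2 * (\<Sum>j\<in>UNIV. LINT x|lborel. (\<Sum>k\<in>UNIV. partials [j, k] \<xi> x * partials [k] a x
           + partials [k] \<xi> x * partials [j, k] a x + partials [j] \<xi> x * partials [k, k] a x) * (\<psi> x * G j x))"
proof -
  define A where "A js = partials js a" for js
  define X where "X js = partials js \<xi>" for js
  define w where "w x = v x - \<mu>" for x
  define p where "p j x = (\<Sum>k\<in>UNIV. A [j, k, k] x)" for j x
  define p' where "p' j x = (\<Sum>k\<in>UNIV. A [j, j, k, k] x)" for j x
  define b where "b k x = X [] x * A [k] x" for k x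
  define b' where "b' j k x = X [j] x * A [k] x + X [] x * A [j, k] x" for j k x
  define d where "d x = (\<Sum>k\<in>UNIV. b' k k x)" for x
  \<comment> \<open>The part of the j-th derivative of div b in which \<xi> is differentiated; the
    rest is \<xi> times \<open>p j\<close>, the j-th derivative of the Laplacian of a.\<close>
  define e where "e j x = (\<Sum>k\<in>UNIV. X [j, k] x * A [k] x + X [k] x * A [j, k] x + X [j] x * A [k, k] x)" for j x
  define d' where "d' j x = e j x + X [] x * p j x" for j x
  have Ac: "continuous_on UNIV (A js)" if "length js \<le> 4" for js unfolding A_def by (rule C_k_continuous[OF a that])
  have Apd: "has_pd j (A js) (A (j # js))" if "length js < 4" for j js unfolding A_def by (rule C_k_has_pd[OF a that])
  have Xcc: "cont_csupp (X js)" for js unfolding X_def by (rule cont_csupp_test[OF \<xi>])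
  have Xc: "continuous_on UNIV (X js)" for js unfolding X_def by (rule test_function_partials_continuous[OF \<xi>])
  have Xpd: "has_pd j (X js) (X (j # js))" for j js unfolding X_def by (rule test_function_has_pd[OF \<xi>])
  have wc: "continuous_on UNIV w" "continuous_on UNIV (partial j v)" for j
    using C_k_continuous[OF v, of "[]"] C_k_continuous[OF v, of "[j]"] unfolding w_def[abs_def]
    by (auto intro!: continuous_intros)
  have wpd: "has_pd j w (partial j v)" for j
    using has_pd_diff[OF C_k_has_pd[OF v, of "[]" j] has_pd_const] unfolding w_def[abs_def] by simp
  have pc: "continuous_on UNIV (p j)" "continuous_on UNIV (p' j)" for j
    unfolding p_def[abs_def] p'_def[abs_def] by (intro continuous_intros Ac; simp)+
  have ppd: "has_pd j (p j) (p' j)" for j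
    unfolding p_def[abs_def] p'_def[abs_def] by (intro has_pd_sum Apd) simp
  have bcc: "cont_csupp (b k)" for k
    unfolding b_def[abs_def] by (intro cont_csupp_mult_right Xcc Ac) simp
  have bpd: "has_pd j (b k) (b' j k)" for j k
    unfolding b_def[abs_def] b'_def[abs_def] by (intro has_pd_mult Xpd Apd) simp
  have b'c: "continuous_on UNIV (b' j k)" for j k
    unfolding b'_def[abs_def] by (intro continuous_intros Xc Ac) auto
  have b'cc: "cont_csupp (b' j k)" for j k by (rule cont_csupp_has_pd[OF bcc bpd b'c])
  have ecc: "cont_csupp (e j)" for j
    unfolding e_def[abs_def] by (intro cont_csupp_sum cont_csupp_add cont_csupp_mult_right Xcc Ac) auto
  have Xpcc: "cont_csupp (\<lambda>x. X js x * p j x)" "cont_csupp (\<lambda>x. X js x * p' j x)" for js j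
    by (intro cont_csupp_mult_right Xcc pc)+
  have d'cc: "cont_csupp (d' j)" for j
    unfolding d'_def[abs_def] by (intro cont_csupp_add ecc Xpcc)
  have d'c: "continuous_on UNIV (d' j)" for j using d'cc by (simp add: cont_csupp_def)
  have d_eq: "d = (\<lambda>x. \<Sum>k\<in>UNIV. b' k k x)" by (auto simp: d_def)
  have dcc: "cont_csupp d" unfolding d_def[abs_def] by (intro cont_csupp_sum b'cc)
  have dpd: "has_pd j d (d' j)" for j
  proof -
    have "has_pd j d (\<lambda>x. \<Sum>k\<in>UNIV. (X [j, k] x * A [k] x + X [k] x * A [j, k] x) + (X [j] x * A [k, k] x + X [] x * A [j, k, k] x))"
      unfolding d_def[abs_def] b'_def by (intro has_pd_sum has_pd_add has_pd_mult Xpd Apd) auto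
    moreover have "(\<lambda>x. \<Sum>k\<in>UNIV. (X [j, k] x * A [k] x + X [k] x * A [j, k] x) + (X [j] x * A [k, k] x + X [] x * A [j, k, k] x)) = d' j"
      unfolding d'_def[abs_def] e_def p_def by (simp add: sum.distrib sum_distrib_left add.assoc)
    ultimately show ?thesis by simp
  qed
  note L = L2loc_limits
  define I where "I c f k = (LINT x|lborel. c x * (f x * k x))" for c f k :: "real^'n \<Rightarrow> real"
  have i: "integrable lborel (\<lambda>x. c x * (f x * k x))" if "cont_csupp c" "L2loc f" "L2loc k" for c f k
    by (rule L2loc_mult_integrable[OF that])
  have I_add: "I (\<lambda>x. c x + c' x) f k = I c f k + I c' f k"
    if "cont_csupp c" "cont_csupp c'" "L2loc f" "L2loc k" for c c' f k
    unfolding I_def distrib_right by (rule Bochner_Integration.integral_add[OF i i]) (rule that)+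
  have I_sum: "I (\<lambda>x. \<Sum>j\<in>UNIV. c j x) f k = (\<Sum>j\<in>UNIV. I (c j) f k)"
    if "\<And>j. cont_csupp (c j)" "L2loc f" "L2loc k" for c :: "'n \<Rightarrow> _" and f k
    unfolding I_def sum_distrib_right by (rule Bochner_Integration.integral_sum[OF i]) (rule that)+

  have virial: "2 * (\<Sum>j\<in>UNIV. \<Sum>k\<in>UNIV. I (b' j k) (G j) (G k)) + (\<Sum>j\<in>UNIV. I (d' j) \<psi> (G j))
      + 2 * (\<Sum>k\<in>UNIV. I (b k) (G k) g) + I d \<psi> g = 0"
    unfolding I_def by (rule weak_virial[OF bcc bpd b'c d_eq dpd d'c])

  have wbcc: "cont_csupp (\<lambda>x. w x * b j x)" "cont_csupp (\<lambda>x. w x * b' j k x)" "cont_csupp (\<lambda>x. w x * d x)"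
    "cont_csupp (\<lambda>x. partial j v x * b j x)" for j k
    by (intro cont_csupp_mult_left wc bcc b'cc dcc)+
  have bc: "continuous_on UNIV (b j)" for j using bcc by (simp add: cont_csupp_def)
  \<comment> \<open>The weight \<open>w * b j\<close> trades the terms coming from the equation for
    the gradient of v against \<psi>^2. The eigenvalue disappears because w and v differ by a
    constant.\<close>
  have wibp: "2 * I (\<lambda>x. w x * b j x) \<psi> (G j) + I (\<lambda>x. partial j v x * b j x + w x * b' j j x) \<psi> \<psi> = 0" for j
    unfolding I_def
    by (rule weak_square_ibp) (intro wbcc has_pd_mult wpd bpd continuous_intros wc bc b'c)+
  have "(\<Sum>j\<in>UNIV. 2 * I (\<lambda>x. w x * b j x) \<psi> (G j) + I (\<lambda>x. partial j v x * b j x + w x * b' j j x) \<psi> \<psi>) = 0"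
    using wibp by simp
  then have wsum: "2 * (\<Sum>j\<in>UNIV. I (\<lambda>x. w x * b j x) \<psi> (G j)) + (\<Sum>j\<in>UNIV. I (\<lambda>x. partial j v x * b j x) \<psi> \<psi>)
      + I (\<lambda>x. w x * d x) \<psi> \<psi> = 0"
  proof -
    have "I (\<lambda>x. w x * d x) \<psi> \<psi> = (\<Sum>j\<in>UNIV. I (\<lambda>x. w x * b' j j x) \<psi> \<psi>)"
      unfolding d_def sum_distrib_left by (rule I_sum[OF wbcc(2) L(1) L(1)])
    then show ?thesis
      using \<open>(\<Sum>j\<in>UNIV. 2 * I (\<lambda>x. w x * b j x) \<psi> (G j) + I (\<lambda>x. partial j v x * b j x + w x * b' j j x) \<psi> \<psi>) = 0\<close>
      by (simp add: I_add[OF wbcc(4) wbcc(2) L(1) L(1)] sum.distrib sum_distrib_left)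
  qed
  \<comment> \<open>Here the equation enters, in the form h^2 g = w \<psi>.\<close>
  have gw: "h\<^sup>2 * I c f g = I (\<lambda>x. w x * c x) \<psi> f" for c f
  proof -
    have "h\<^sup>2 * I c f g = (LINT x|lborel. h\<^sup>2 * (c x * (f x * g x)))" by (simp add: I_def)
    also have "\<dots> = I (\<lambda>x. w x * c x) \<psi> f"
      unfolding I_def using h by (intro Bochner_Integration.integral_cong) (auto simp: g w_def)
    finally show ?thesis .
  qed
  have "2 * h\<^sup>2 * (\<Sum>j\<in>UNIV. \<Sum>k\<in>UNIV. I (b' j k) (G j) (G k)) + h\<^sup>2 * (\<Sum>j\<in>UNIV. I (d' j) \<psi> (G j))
      + (2 * (\<Sum>k\<in>UNIV. h\<^sup>2 * I (b k) (G k) g) + h\<^sup>2 * I d \<psi> g) = h\<^sup>2 * 0"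
    unfolding virial[symmetric] by (simp add: sum_distrib_left algebra_simps)
  then have V2: "2 * h\<^sup>2 * (\<Sum>j\<in>UNIV. \<Sum>k\<in>UNIV. I (b' j k) (G j) (G k)) + h\<^sup>2 * (\<Sum>j\<in>UNIV. I (d' j) \<psi> (G j))
      = (\<Sum>j\<in>UNIV. I (\<lambda>x. partial j v x * b j x) \<psi> \<psi>)"
    unfolding gw using wsum by linarith

  \<comment> \<open>A further integration by parts, with weight \<xi> times \<open>p j\<close>,
    replaces \<psi> times its gradient by \<psi>^2. It differentiates the third derivatives of a
    once more and so produces the bi-Laplacian.\<close>
  have pibp: "2 * I (\<lambda>x. X [] x * p j x) \<psi> (G j) + (I (\<lambda>x. X [j] x * p j x) \<psi> \<psi> + I (\<lambda>x. X [] x * p' j x) \<psi> \<psi>) = 0" for j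
  proof -
    have "2 * I (\<lambda>x. X [] x * p j x) \<psi> (G j) + I (\<lambda>x. X [j] x * p j x + X [] x * p' j x) \<psi> \<psi> = 0"
      unfolding I_def by (rule weak_square_ibp) (intro Xpcc has_pd_mult Xpd ppd continuous_intros Xc pc)+
    then show ?thesis by (simp add: I_add[OF Xpcc L(1) L(1)])
  qed
  have dI: "I (d' j) \<psi> (G j) = I (e j) \<psi> (G j) + I (\<lambda>x. X [] x * p j x) \<psi> (G j)" for j
    unfolding d'_def[abs_def] by (rule I_add[OF ecc Xpcc(1) L(1,2)])
  have XAcc: "cont_csupp (\<lambda>x. X js x * A ks x)" if "length ks \<le> 4" for js ks
    by (intro cont_csupp_mult_right Xcc Ac that)
  have bI: "I (b' j k) (G j) (G k) = I (\<lambda>x. X [j] x * A [k] x) (G j) (G k) + I (\<lambda>x. X [] x * A [j, k] x) (G j) (G k)" for j k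
    unfolding b'_def[abs_def] by (rule I_add[OF XAcc XAcc L(2,2)]) auto
  have P: "2 * (\<Sum>j\<in>UNIV. I (\<lambda>x. X [] x * p j x) \<psi> (G j)) =
      - (\<Sum>j\<in>UNIV. I (\<lambda>x. X [j] x * p j x) \<psi> \<psi>) - (\<Sum>j\<in>UNIV. I (\<lambda>x. X [] x * p' j x) \<psi> \<psi>)"
  proof -
    have "2 * I (\<lambda>x. X [] x * p j x) \<psi> (G j) = - I (\<lambda>x. X [j] x * p j x) \<psi> \<psi> - I (\<lambda>x. X [] x * p' j x) \<psi> \<psi>" for j
      using pibp[of j] by linarith
    then show ?thesis by (simp add: sum_distrib_left sum_subtractf sum_negf)
  qed
  \<comment> \<open>Twice \<open>V2\<close> with \<open>P\<close> inserted; everything that carries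
    a derivative of the cutoff goes to the right.\<close>
  have main: "4 * h\<^sup>2 * (\<Sum>j\<in>UNIV. \<Sum>k\<in>UNIV. I (\<lambda>x. X [] x * A [j, k] x) (G j) (G k))
      - h\<^sup>2 * (\<Sum>j\<in>UNIV. I (\<lambda>x. X [] x * p' j x) \<psi> \<psi>) - 2 * (\<Sum>j\<in>UNIV. I (\<lambda>x. partial j v x * b j x) \<psi> \<psi>)
    = - 4 * h\<^sup>2 * (\<Sum>j\<in>UNIV. \<Sum>k\<in>UNIV. I (\<lambda>x. X [j] x * A [k] x) (G j) (G k))
      + h\<^sup>2 * (\<Sum>j\<in>UNIV. I (\<lambda>x. X [j] x * p j x) \<psi> \<psi>) - 2 * h\<^sup>2 * (\<Sum>j\<in>UNIV. I (e j) \<psi> (G j))"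
    (is "4 * h\<^sup>2 * ?s1 - h\<^sup>2 * ?s2 - 2 * ?s3 = - 4 * h\<^sup>2 * ?s4 + h\<^sup>2 * ?s5 - 2 * h\<^sup>2 * ?s6")
  proof -
    have "2 * h\<^sup>2 * (?s4 + ?s1) + h\<^sup>2 * (?s6 + (\<Sum>j\<in>UNIV. I (\<lambda>x. X [] x * p j x) \<psi> (G j))) = ?s3"
      using V2 unfolding dI bI by (simp add: sum.distrib)
    then have "4 * h\<^sup>2 * (?s4 + ?s1) + 2 * h\<^sup>2 * ?s6 + h\<^sup>2 * (2 * (\<Sum>j\<in>UNIV. I (\<lambda>x. X [] x * p j x) \<psi> (G j))) = 2 * ?s3"
      by (simp add: algebra_simps)
    then show ?thesis unfolding P by (simp add: algebra_simps)
  qed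

  have pt: "\<xi> x * virial_integrand h v a \<psi> G x =
      4 * h\<^sup>2 * (\<Sum>j\<in>UNIV. \<Sum>k\<in>UNIV. (X [] x * A [j, k] x) * (G j x * G k x))
      - h\<^sup>2 * (\<Sum>j\<in>UNIV. (X [] x * p' j x) * (\<psi> x * \<psi> x))
      - 2 * (\<Sum>j\<in>UNIV. (partial j v x * b j x) * (\<psi> x * \<psi> x))" for x
    unfolding virial_integrand_def laplacian_laplacian[OF a] p'_def b_def X_def A_def grad_def inner_vec_def
    by (simp add: sum_distrib_left sum_distrib_right right_diff_distrib power2_eq_square mult_ac)
  have i1: "integrable lborel (\<lambda>x. (X [] x * A [j, k] x) * (G j x * G k x))" for j k
    by (rule i[OF XAcc L(2,2)]) simp
  note i2 = i[OF Xpcc(2) L(1,1)]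
  note i3 = i[OF wbcc(4) L(1,1)]
  have s1: "integrable lborel (\<lambda>x. 4 * h\<^sup>2 * (\<Sum>j\<in>UNIV. \<Sum>k\<in>UNIV. (X [] x * A [j, k] x) * (G j x * G k x)))"
    by (intro integrable_mult_right Bochner_Integration.integrable_sum i1)
  have s2: "integrable lborel (\<lambda>x. h\<^sup>2 * (\<Sum>j\<in>UNIV. (X [] x * p' j x) * (\<psi> x * \<psi> x)))"
    by (intro integrable_mult_right Bochner_Integration.integrable_sum i2)
  have s3: "integrable lborel (\<lambda>x. 2 * (\<Sum>j\<in>UNIV. (partial j v x * b j x) * (\<psi> x * \<psi> x)))"
    by (intro integrable_mult_right Bochner_Integration.integrable_sum i3)
  show "integrable lborel (\<lambda>x. \<xi> x * virial_integrand h v a \<psi> G x)"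
    unfolding pt by (intro Bochner_Integration.integrable_diff s1 s2 s3)
  have "(LINT x|lborel. (\<Sum>j\<in>UNIV. \<Sum>k\<in>UNIV. (X [] x * A [j, k] x) * (G j x * G k x))) =
      (\<Sum>j\<in>UNIV. \<Sum>k\<in>UNIV. I (\<lambda>x. X [] x * A [j, k] x) (G j) (G k))"
    unfolding I_def
    by (simp only: Bochner_Integration.integral_sum[OF Bochner_Integration.integrable_sum[OF i1]]
        Bochner_Integration.integral_sum[OF i1])
  moreover have "(LINT x|lborel. (\<Sum>j\<in>UNIV. (X [] x * p' j x) * (\<psi> x * \<psi> x))) = (\<Sum>j\<in>UNIV. I (\<lambda>x. X [] x * p' j x) \<psi> \<psi>)"
    unfolding I_def by (rule Bochner_Integration.integral_sum[OF i2])
  moreover have "(LINT x|lborel. (\<Sum>j\<in>UNIV. (partial j v x * b j x) * (\<psi> x * \<psi> x))) = (\<Sum>j\<in>UNIV. I (\<lambda>x. partial j v x * b j x) \<psi> \<psi>)"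
    unfolding I_def by (rule Bochner_Integration.integral_sum[OF i3])
  ultimately have "(LINT x|lborel. \<xi> x * virial_integrand h v a \<psi> G x) =
      4 * h\<^sup>2 * (\<Sum>j\<in>UNIV. \<Sum>k\<in>UNIV. I (\<lambda>x. X [] x * A [j, k] x) (G j) (G k))
      - h\<^sup>2 * (\<Sum>j\<in>UNIV. I (\<lambda>x. X [] x * p' j x) \<psi> \<psi>) - 2 * (\<Sum>j\<in>UNIV. I (\<lambda>x. partial j v x * b j x) \<psi> \<psi>)"
    unfolding pt
    by (simp only: Bochner_Integration.integral_diff[OF Bochner_Integration.integrable_diff[OF s1 s2] s3]
        Bochner_Integration.integral_diff[OF s1 s2] integral_mult_right_zero)
  then show "(LINT x|lborel. \<xi> x * virial_integrand h v a \<psi> G x) =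
      - 4 * h\<^sup>2 * (\<Sum>j\<in>UNIV. \<Sum>k\<in>UNIV. LINT x|lborel. (partials [j] \<xi> x * partials [k] a x) * (G j x * G k x))
      + h\<^sup>2 * (\<Sum>j\<in>UNIV. LINT x|lborel. (partials [j] \<xi> x * (\<Sum>k\<in>UNIV. partials [j, k, k] a x)) * (\<psi> x * \<psi> x))
      - 2 * h\<^sup>2 * (\<Sum>j\<in>UNIV. LINT x|lborel. (\<Sum>k\<in>UNIV. partials [j, k] \<xi> x * partials [k] a x
           + partials [k] \<xi> x * partials [j, k] a x + partials [j] \<xi> x * partials [k, k] a x) * (\<psi> x * G j x))"
    unfolding main unfolding I_def e_def p_def X_def A_def .
qed

text \<open>The remainder in \<open>virial_cutoff\<close> is a finite sum of integrals of vanishing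
  coefficients against products of \<psi> and components of G, all square integrable; v and its
  gradient, whose growth is unrestricted, do not occur in it.\<close>

lemma (in grad_approx) has_cutoff_integral_virial:
  assumes h: "h > 0" and v: "C_k 1 v" "\<And>x. 0 \<le> v x" and a: "C_k 4 a"
    and a_bd: "\<And>js. 1 \<le> length js \<Longrightarrow> length js \<le> 4 \<Longrightarrow> bounded (range (partials js a))"
    and \<psi>2: "integrable lborel (\<lambda>x. (\<psi> x)\<^sup>2)"
    and g: "\<And>x. g x = (v x - \<mu>) / h\<^sup>2 * \<psi> x"
  shows "has_cutoff_integral (virial_integrand h v a \<psi> G) 0"
  unfolding has_cutoff_integral_def
proof (intro allI impI conjI)
  fix \<eta> :: "real^'n \<Rightarrow> real" assume "test_function \<eta> \<and> \<eta> 0 = 1"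
  then have \<eta>: "test_function \<eta>" by simp
  have t: "test_function (\<lambda>x. \<eta> ((1 / R) *\<^sub>R x))" if "R > 0" for R
    using test_function_affine(2)[OF \<eta>, of "1 / R" 1 0] that by simp
  note vc = virial_cutoff[OF h v(1) a t g]
  show "integrable lborel (\<lambda>x. \<eta> ((1 / R) *\<^sub>R x) * virial_integrand h v a \<psi> G x)" if "R > 0" for R
    using vc(1) that by blast
  have G2: "integrable lborel (\<lambda>x. (G j x)\<^sup>2)" for j
  proof (rule grad_square_integrable[OF \<psi>2 g])
    show "- (\<bar>\<mu>\<bar> / h\<^sup>2) \<le> (v x - \<mu>) / h\<^sup>2" for x
    proof -
      have "- \<bar>\<mu>\<bar> \<le> v x - \<mu>" using v(2)[of x] by linarith
      then show ?thesis using divide_right_mono[of "- \<bar>\<mu>\<bar>" "v x - \<mu>" "h\<^sup>2"] by simp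
    qed
  qed simp
  have [measurable]: "\<psi> \<in> borel_measurable borel" "G j \<in> borel_measurable borel" for j
    using L2loc_limits by (auto intro: L2loc_measurable)
  define Y where "Y js R x = (1 / R) ^ length js * partials js \<eta> ((1 / R) *\<^sub>R x)" for js R and x :: "real^'n"
  have Y: "partials js (\<lambda>x. \<eta> ((1 / R) *\<^sub>R x)) = Y js R" if "R > 0" for js R
    using partials_affine[OF \<eta>, of "1 / R" js 0] that by (simp add: Y_def fun_eq_iff)
  have van: "vanishing (\<lambda>R x. Y js R x * partials ks a x)" if "js \<noteq> []" "1 \<le> length ks" "length ks \<le> 4" for js ks
    unfolding Y_def
    by (intro vanishing_mult vanishing_cutoff \<eta> that a_bd borel_measurable_continuous_onI C_k_continuous[OF a])
  let ?rem = "\<lambda>R. - 4 * h\<^sup>2 * (\<Sum>j\<in>UNIV. \<Sum>k\<in>UNIV. LINT x|lborel. (Y [j] R x * partials [k] a x) * (G j x * G k x))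
      + h\<^sup>2 * (\<Sum>j\<in>UNIV. LINT x|lborel. (Y [j] R x * (\<Sum>k\<in>UNIV. partials [j, k, k] a x)) * (\<psi> x * \<psi> x))
      - 2 * h\<^sup>2 * (\<Sum>j\<in>UNIV. LINT x|lborel. (\<Sum>k\<in>UNIV. Y [j, k] R x * partials [k] a x
           + Y [k] R x * partials [j, k] a x + Y [j] R x * partials [k, k] a x) * (\<psi> x * G j x))"
  have "(?rem \<longlongrightarrow> - 4 * h\<^sup>2 * (\<Sum>j\<in>(UNIV::'n set). \<Sum>k\<in>(UNIV::'n set). 0) + h\<^sup>2 * (\<Sum>j\<in>(UNIV::'n set). 0)
      - 2 * h\<^sup>2 * (\<Sum>j\<in>(UNIV::'n set). 0)) at_top"
    unfolding sum_distrib_left[of "Y _ _ _"]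
    by (intro tendsto_add tendsto_diff tendsto_mult tendsto_const tendsto_sum vanishing_integral vanishing_sum
        vanishing_add van \<psi>2 G2) (auto intro: L2loc_measurable L2loc_limits)
  then have "(?rem \<longlongrightarrow> 0) at_top" by simp
  \<comment> \<open>The formula for derivatives of the dilated cutoff is available for R > 0, so the
    two sides agree eventually.\<close>
  moreover have "\<forall>\<^sub>F R in at_top. ?rem R = (LINT x|lborel. \<eta> ((1 / R) *\<^sub>R x) * virial_integrand h v a \<psi> G x)"
    using eventually_gt_at_top[of 0]
  proof eventually_elim
    case (elim R)
    show ?case unfolding vc(2)[OF elim] Y[OF elim] ..
  qed
  ultimately show "((\<lambda>R. LINT x|lborel. \<eta> ((1 / R) *\<^sub>R x) * virial_integrand h v a \<psi> G x) \<longlongrightarrow> 0) at_top"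
    by (rule Lim_transform_eventually)
qed

section \<open>The identity for eigenfunctions\<close>

text \<open>For integrable F the cutoff limit is the Lebesgue integral, and limits are unique;
  otherwise the integral is 0 by convention.\<close>

lemma has_cutoff_integral_0_imp_integral_0:
  fixes F :: "real^'n::finite \<Rightarrow> real"
  assumes "has_cutoff_integral F 0"
  shows "integral\<^sup>L lborel F = 0"
proof (cases "integrable lborel F")
  case True
  \<comment> \<open>\<open>has_cutoff_integral\<close> quantifies over admissible cutoffs; the
    normalised bump shows that there is one.\<close>
  define \<eta> :: "real^'n \<Rightarrow> real" where "\<eta> x = 1 / bump (0::real^'n) * bump (0 + 1 *\<^sub>R x)" for x
  have "test_function \<eta>" unfolding \<eta>_def[abs_def] by (rule test_function_affine(2)[OF test_function_bump]) simp
  moreover have "\<eta> 0 = 1" using bump_pos[of "0::real^'n"] by (simp add: \<eta>_def)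
  ultimately have "((\<lambda>R. LINT x|lborel. \<eta> ((1 / R) *\<^sub>R x) * F x) \<longlongrightarrow> integral\<^sup>L lborel F) at_top"
    "((\<lambda>R. LINT x|lborel. \<eta> ((1 / R) *\<^sub>R x) * F x) \<longlongrightarrow> 0) at_top"
    using has_cutoff_integral_lebesgue[OF True] assms unfolding has_cutoff_integral_def by blast+
  then show ?thesis by (rule tendsto_unique[rotated]) simp
qed (rule not_integrable_integral_eq)

text \<open>A weak gradient is determined only almost everywhere, so the identity is asserted for
  each one, and the existence part keeps this from being vacuous.\<close>

theorem theorem2p1:
  fixes v a \<psi> :: "real^'n::finite \<Rightarrow> real" and h \<mu> :: real
  assumes "h > 0"
    and "C_k 1 v"
    and "\<forall>x. 0 \<le> v x" and "\<exists>x. v x = 0"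
    and "C_k 4 a"
    and "\<forall>js. 1 \<le> length js \<and> length js \<le> 4 \<longrightarrow> bounded (range (partials js a))"
    and "eigenfunction h v \<mu> \<psi>"
  shows "(\<exists>G. \<forall>j. weak_partial j \<psi> (G j)) \<and>
    (\<forall>G. (\<forall>j. weak_partial j \<psi> (G j)) \<longrightarrow>
       (LINT x|lborel. virial_integrand h v a \<psi> G x) = 0 \<and>
       has_cutoff_integral (virial_integrand h v a \<psi> G) 0)"
proof -
  have S: "schrodinger_graph h v \<psi> (\<lambda>x. \<mu> * \<psi> x)" using assms(7) by (simp add: eigenfunction_def)
  have m: "\<psi> \<in> borel_measurable borel" and \<psi>2: "integrable lborel (\<lambda>x. (\<psi> x)\<^sup>2)"
    using S by (auto simp: schrodinger_graph_def L2_function_def)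
  have \<psi>: "L2loc \<psi>"
    unfolding L2loc_def
  proof (intro conjI allI m)
    show "integrable lborel (\<lambda>x. indicator (cball 0 r) x * (\<psi> x)\<^sup>2)" for r
      using integrable_real_mult_indicator[OF _ \<psi>2, of "cball 0 r"] by (simp add: mult.commute)
  qed
  note \<psi>l = L2loc_locally_integrable[OF \<psi>]
  have vc: "continuous_on UNIV v" using C_k_continuous[OF assms(2), of "[]"] by simp
  \<comment> \<open>The distributional Laplacian of \<psi> that the eigenvalue equation dictates; it
    is locally square integrable because the continuous v is bounded on balls.\<close>
  define g where "g x = (v x - \<mu>) / h\<^sup>2 * \<psi> x" for x
  have g: "L2loc g" unfolding g_def[abs_def]
    by (rule L2loc_mult_continuous[OF \<psi>]) (use assms(1) in \<open>auto intro!: continuous_intros vc\<close>)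
  have weak: "(LINT x|lborel. \<psi> x * laplacian \<phi> x) = (LINT x|lborel. g x * \<phi> x)" if t: "test_function \<phi>" for \<phi>
  proof -
    have cc: "cont_csupp \<phi>" using cont_csupp_test[OF t, of "[]"] by simp
    have lcc: "cont_csupp (laplacian \<phi>)"
    proof -
      have "laplacian \<phi> = (\<lambda>x. \<Sum>j\<in>UNIV. partials [j, j] \<phi> x)" by (auto simp: laplacian_def)
      then show ?thesis using cont_csupp_sum[of UNIV "\<lambda>j. partials [j, j] \<phi>"] cont_csupp_test[OF t] by metis
    qed
    have i1: "integrable lborel (\<lambda>x. laplacian \<phi> x * \<psi> x)" by (rule locally_integrable_mult[OF \<psi>l lcc])
    have i2: "integrable lborel (\<lambda>x. (v x * \<phi> x) * \<psi> x)"
      by (rule locally_integrable_mult[OF \<psi>l cont_csupp_mult_left[OF vc cc]])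
    have i3: "integrable lborel (\<lambda>x. \<phi> x * \<psi> x)" by (rule locally_integrable_mult[OF \<psi>l cc])
    have "(LINT x|lborel. \<psi> x * (- h\<^sup>2 * laplacian \<phi> x + v x * \<phi> x)) = (LINT x|lborel. \<mu> * \<psi> x * \<phi> x)"
      using S t unfolding schrodinger_graph_def by blast
    also have "(\<lambda>x. \<mu> * \<psi> x * \<phi> x) = (\<lambda>x. \<mu> * (\<phi> x * \<psi> x))" by (auto simp: mult_ac)
    also have "(\<lambda>x. \<psi> x * (- h\<^sup>2 * laplacian \<phi> x + v x * \<phi> x)) =
        (\<lambda>x. (v x * \<phi> x) * \<psi> x - h\<^sup>2 * (laplacian \<phi> x * \<psi> x))" by (auto simp: algebra_simps)
    finally have E: "(LINT x|lborel. (v x * \<phi> x) * \<psi> x) - h\<^sup>2 * (LINT x|lborel. laplacian \<phi> x * \<psi> x) = \<mu> * (LINT x|lborel. \<phi> x * \<psi> x)"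
      by (simp only: Bochner_Integration.integral_diff[OF i2 integrable_mult_right[OF i1]] integral_mult_right_zero)
    have "(\<lambda>x. g x * \<phi> x) = (\<lambda>x. 1 / h\<^sup>2 * ((v x * \<phi> x) * \<psi> x - \<mu> * (\<phi> x * \<psi> x)))"
      by (auto simp: g_def field_simps)
    then have "(LINT x|lborel. g x * \<phi> x) = 1 / h\<^sup>2 * ((LINT x|lborel. (v x * \<phi> x) * \<psi> x) - \<mu> * (LINT x|lborel. \<phi> x * \<psi> x))"
      by (simp only: Bochner_Integration.integral_diff[OF i2 integrable_mult_right[OF i3]] integral_mult_right_zero)
    also have "\<dots> = (LINT x|lborel. laplacian \<phi> x * \<psi> x)" using E assms(1) by (simp add: field_simps)
    finally show ?thesis by (simp add: mult.commute)
  qed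
  obtain G0 U U' U'' where "grad_approx \<psi> g G0 U U' U''" using grad_approx_exists[OF \<psi> g weak] by blast
  then interpret G0: grad_approx \<psi> g G0 U U' U'' .
  have "has_cutoff_integral (virial_integrand h v a \<psi> G) 0" if G: "\<forall>j. weak_partial j \<psi> (G j)" for G
  proof -
    have lim: "L2loc_lim (\<lambda>n. U' n j) (G j)" for j
    proof (rule L2loc_lim_cong_AE[OF G0.lim(2)])
      show "AE x in lborel. G j x = G0 j x"
        by (rule weak_partial_unique[OF _ G0.weak_partial_limit]) (use G in blast)
      show "G j \<in> borel_measurable borel" using G by (simp add: weak_partial_def locally_integrable_def)
    qed
    \<comment> \<open>The approximations built for \<open>G0\<close> converge to \<open>G\<close> as
      well, so the locale applies with \<open>G\<close> itself.\<close>
    interpret G: grad_approx \<psi> g G U U' U''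
      by unfold_locales (use G0.pd G0.cont G0.sym G0.lim lim in auto)
    show ?thesis
      by (rule G.has_cutoff_integral_virial[where \<mu>=\<mu>]) (use assms \<psi>2 g_def in auto)
  qed
  then show ?thesis
    using G0.weak_partial_limit has_cutoff_integral_0_imp_integral_0 by blast
qed

end
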